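(* Let $\mathcal{C}$ be a small category. There is a combinatorial model structure on the slice category $\mathrm{Cat}_{/\mathcal{C}}$, denoted $(\mathrm{Cat}_{/\mathcal{C}})_{\mathrm{discfib}}$, in which (i) the cofibrations are all functors over $\mathcal{C}$; (ii) the fibrant objects are the discrete fibrations over $\mathcal{C}$; (iii) the weak equivalences between fibrant objects are the isomorphisms (of categories over $\mathcal{C}$); (iv) every functor over $\mathcal{C}$ between fibrant objects is a fibration.
   Context: $\mathrm{Cat}$ is the category of small categories. $\mathrm{Cat}_{/\mathcal{C}}$ is the slice category: objects are functors $P\colon\mathcal{P}\to\mathcal{C}$ and morphisms $(P\colon\mathcal{P}\to\mathcal{C})\to(Q\colon\mathcal{Q}\to\mathcal{C})$ are functors $F\colon\mathcal{P}\to\mathcal{Q}$ with $QF=P$. A functor $P\colon\mathcal{P}\to\mathcal{C}$ is a discrete fibration if for every object $a\in\mathcal{P}$ and every morphism $f\colon c\to Pa$ in $\mathcal{C}$ there is a unique morphism $g\colon a'\to a$ in $\mathcal{P}$ with $Pg=f$. *)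

theory Defs
  imports Main "HOL-Library.FuncSet"
begin

unbundle cardinal_syntax

section \<open>Universes\<close>

text \<open>
  HOL has no set-theoretic universes, so smallness is taken relative to a type \<^typ>\<open>'u\<close> whose
  cardinality is strongly inaccessible (uncountable, regular, strong limit): the sets equipotent to
  some \<open>A :: 'u set\<close> with \<open>|A| <o |UNIV :: 'u set|\<close> play the role of the elements of a Grothendieck
  universe.
\<close>

definition inaccessible_universe :: "'u itself \<Rightarrow> bool" where
  "inaccessible_universe U \<longleftrightarrow>
     natLeq <o |UNIV :: 'u set| \<and>
     regularCard |UNIV :: 'u set| \<and>
     (\<forall>A :: 'u set. |A| <o |UNIV :: 'u set| \<longrightarrow> |Pow A| <o |UNIV :: 'u set| )"

definition small :: "'u itself \<Rightarrow> 'a set \<Rightarrow> bool" where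
  "small U A \<longleftrightarrow> |A| <o |UNIV :: 'u set|"

definition small_regular_cardinal :: "'u rel \<Rightarrow> bool" where
  "small_regular_cardinal \<kappa> \<longleftrightarrow> Cinfinite \<kappa> \<and> regularCard \<kappa> \<and> \<kappa> <o |UNIV :: 'u set|"


section \<open>Categories\<close>

text \<open>\<open>Comp K g f\<close> is \<open>g\<close> after \<open>f\<close>.\<close>

record ('o, 'm) cat =
  Obj :: "'o set"
  Mor :: "'m set"
  Dom :: "'m \<Rightarrow> 'o"
  Cod :: "'m \<Rightarrow> 'o"
  Ident :: "'o \<Rightarrow> 'm"
  Comp :: "'m \<Rightarrow> 'm \<Rightarrow> 'm"

definition hom :: "('o, 'm) cat \<Rightarrow> 'o \<Rightarrow> 'o \<Rightarrow> 'm set" where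
  "hom K x y = {f \<in> Mor K. Dom K f = x \<and> Cod K f = y}"

definition category :: "('o, 'm) cat \<Rightarrow> bool" where
  "category K \<longleftrightarrow>
     (\<forall>f \<in> Mor K. Dom K f \<in> Obj K \<and> Cod K f \<in> Obj K) \<and>
     (\<forall>x \<in> Obj K. Ident K x \<in> hom K x x) \<and>
     (\<forall>f \<in> Mor K. \<forall>g \<in> Mor K. Dom K g = Cod K f \<longrightarrow> Comp K g f \<in> hom K (Dom K f) (Cod K g)) \<and>
     (\<forall>f \<in> Mor K. Comp K f (Ident K (Dom K f)) = f \<and> Comp K (Ident K (Cod K f)) f = f) \<and>
     (\<forall>f \<in> Mor K. \<forall>g \<in> Mor K. \<forall>h \<in> Mor K. Dom K g = Cod K f \<longrightarrow> Dom K h = Cod K g \<longrightarrow>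
        Comp K h (Comp K g f) = Comp K (Comp K h g) f)"

definition iso_in :: "('o, 'm) cat \<Rightarrow> 'm \<Rightarrow> bool" where
  "iso_in K f \<longleftrightarrow> f \<in> Mor K \<and>
     (\<exists>g \<in> hom K (Cod K f) (Dom K f).
        Comp K g f = Ident K (Dom K f) \<and> Comp K f g = Ident K (Cod K f))"

definition terminal :: "('o, 'm) cat \<Rightarrow> 'o \<Rightarrow> bool" where
  "terminal K t \<longleftrightarrow> t \<in> Obj K \<and> (\<forall>x \<in> Obj K. \<exists>!f. f \<in> hom K x t)"

definition op_cat :: "('o, 'm) cat \<Rightarrow> ('o, 'm) cat" where
  "op_cat K = \<lparr>Obj = Obj K, Mor = Mor K, Dom = Cod K, Cod = Dom K, Ident = Ident K,
     Comp = (\<lambda>g f. Comp K f g)\<rparr>"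

definition is_functor ::
  "('o, 'm) cat \<Rightarrow> ('p, 'n) cat \<Rightarrow> ('o \<Rightarrow> 'p) \<Rightarrow> ('m \<Rightarrow> 'n) \<Rightarrow> bool" where
  "is_functor A B Fo Fm \<longleftrightarrow>
     (\<forall>x \<in> Obj A. Fo x \<in> Obj B) \<and>
     (\<forall>f \<in> Mor A. Fm f \<in> hom B (Fo (Dom A f)) (Fo (Cod A f))) \<and>
     (\<forall>x \<in> Obj A. Fm (Ident A x) = Ident B (Fo x)) \<and>
     (\<forall>f \<in> Mor A. \<forall>g \<in> Mor A. Dom A g = Cod A f \<longrightarrow> Fm (Comp A g f) = Comp B (Fm g) (Fm f))"

text \<open>
  Objects are arrows \<open>p\<close> into \<open>c\<close>; a morphism from \<open>p\<close> to \<open>q\<close> is a triple \<open>(p, f, q)\<close> with \<open>q f = p\<close>.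
\<close>

definition slice :: "('o, 'm) cat \<Rightarrow> 'o \<Rightarrow> ('m, 'm \<times> 'm \<times> 'm) cat" where
  "slice K c = \<lparr>
     Obj = {p \<in> Mor K. Cod K p = c},
     Mor = {(p, f, q) | p f q. p \<in> Mor K \<and> Cod K p = c \<and> q \<in> Mor K \<and> Cod K q = c \<and>
              f \<in> hom K (Dom K p) (Dom K q) \<and> Comp K q f = p},
     Dom = (\<lambda>(p, f, q). p),
     Cod = (\<lambda>(p, f, q). q),
     Ident = (\<lambda>p. (p, Ident K (Dom K p), p)),
     Comp = (\<lambda>(q', g, r) (p, f, q). (p, Comp K g f, r))\<rparr>"


section \<open>The category of small categories\<close>

text \<open>
  The structure maps of a small category, and the two components of a functor, are required to be
  \<^const>\<open>undefined\<close> outside their domain of definition, so that equality of the records is equality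
  of categories and of functors.
\<close>

definition small_category :: "('u, 'u) cat \<Rightarrow> bool" where
  "small_category A \<longleftrightarrow> category A \<and>
     small TYPE('u) (Obj A) \<and> small TYPE('u) (Mor A) \<and>
     Dom A \<in> extensional (Mor A) \<and> Cod A \<in> extensional (Mor A) \<and>
     Ident A \<in> extensional (Obj A) \<and>
     (\<forall>g f. \<not> (f \<in> Mor A \<and> g \<in> Mor A \<and> Dom A g = Cod A f) \<longrightarrow> Comp A g f = undefined)"

record 'u cat_functor =
  src :: "('u, 'u) cat"
  tgt :: "('u, 'u) cat"
  omap :: "'u \<Rightarrow> 'u"
  amap :: "'u \<Rightarrow> 'u"

definition small_functor :: "'u cat_functor \<Rightarrow> bool" where
  "small_functor F \<longleftrightarrow> small_category (src F) \<and> small_category (tgt F) \<and>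
     is_functor (src F) (tgt F) (omap F) (amap F) \<and>
     omap F \<in> extensional (Obj (src F)) \<and> amap F \<in> extensional (Mor (src F))"

definition Cat :: "(('u, 'u) cat, 'u cat_functor) cat" where
  "Cat = \<lparr>
     Obj = {A. small_category A},
     Mor = {F. small_functor F},
     Dom = src,
     Cod = tgt,
     Ident = (\<lambda>A. \<lparr>src = A, tgt = A, omap = restrict id (Obj A), amap = restrict id (Mor A)\<rparr>),
     Comp = (\<lambda>G F. \<lparr>src = src F, tgt = tgt G,
               omap = compose (Obj (src F)) (omap G) (omap F),
               amap = compose (Mor (src F)) (amap G) (amap F)\<rparr>)\<rparr>"

definition discrete_fibration :: "'u cat_functor \<Rightarrow> bool" where
  "discrete_fibration P \<longleftrightarrow>
     (\<forall>a \<in> Obj (src P). \<forall>f \<in> Mor (tgt P). Cod (tgt P) f = omap P a \<longrightarrow>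
        (\<exists>!g. g \<in> Mor (src P) \<and> Cod (src P) g = a \<and> amap P g = f))"


section \<open>Colimits and locally presentable categories\<close>

definition cocone ::
  "('j, 'k) cat \<Rightarrow> ('o, 'm) cat \<Rightarrow> ('j \<Rightarrow> 'o) \<Rightarrow> ('k \<Rightarrow> 'm) \<Rightarrow> 'o \<Rightarrow> ('j \<Rightarrow> 'm) \<Rightarrow> bool" where
  "cocone J K Do Dm x l \<longleftrightarrow> x \<in> Obj K \<and>
     (\<forall>j \<in> Obj J. l j \<in> hom K (Do j) x) \<and>
     (\<forall>u \<in> Mor J. Comp K (l (Cod J u)) (Dm u) = l (Dom J u))"

definition colimit_cocone ::
  "('j, 'k) cat \<Rightarrow> ('o, 'm) cat \<Rightarrow> ('j \<Rightarrow> 'o) \<Rightarrow> ('k \<Rightarrow> 'm) \<Rightarrow> 'o \<Rightarrow> ('j \<Rightarrow> 'm) \<Rightarrow> bool" where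
  "colimit_cocone J K Do Dm x l \<longleftrightarrow> cocone J K Do Dm x l \<and>
     (\<forall>y m. cocone J K Do Dm y m \<longrightarrow>
        (\<exists>!h. h \<in> hom K x y \<and> (\<forall>j \<in> Obj J. Comp K h (l j) = m j)))"

definition cocomplete :: "'u itself \<Rightarrow> ('o, 'm) cat \<Rightarrow> bool" where
  "cocomplete U K \<longleftrightarrow>
     (\<forall>(J :: ('u, 'u) cat) Do Dm. small_category J \<and> is_functor J K Do Dm \<longrightarrow>
        (\<exists>x l. colimit_cocone J K Do Dm x l))"

definition complete :: "'u itself \<Rightarrow> ('o, 'm) cat \<Rightarrow> bool" where
  "complete U K \<longleftrightarrow> cocomplete U (op_cat K)"

definition locally_small :: "'u itself \<Rightarrow> ('o, 'm) cat \<Rightarrow> bool" where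
  "locally_small U K \<longleftrightarrow> (\<forall>x \<in> Obj K. \<forall>y \<in> Obj K. small U (hom K x y))"

text \<open>A small \<open>\<kappa>\<close>-directed poset, regarded as a category.\<close>

definition directed_poset :: "'u rel \<Rightarrow> ('u, 'u) cat \<Rightarrow> bool" where
  "directed_poset \<kappa> J \<longleftrightarrow> small_category J \<and>
     (\<forall>i \<in> Obj J. \<forall>j \<in> Obj J. \<forall>u \<in> hom J i j. \<forall>v \<in> hom J i j. u = v) \<and>
     (\<forall>i \<in> Obj J. \<forall>j \<in> Obj J. hom J i j \<noteq> {} \<and> hom J j i \<noteq> {} \<longrightarrow> i = j) \<and>
     (\<forall>S. S \<subseteq> Obj J \<and> |S| <o \<kappa> \<longrightarrow> (\<exists>b \<in> Obj J. \<forall>s \<in> S. hom J s b \<noteq> {}))"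

text \<open>
  \<open>hom(a, -)\<close> sends the cocone \<open>(x, l)\<close> under \<open>D\<close> to a colimit cocone in the category of small sets:
  every cocone \<open>\<phi>\<close> from \<open>hom(a, D -)\<close> to a small set \<open>X\<close> factors uniquely through \<open>hom(a, x)\<close>.
  For locally small \<open>K\<close> it is enough to let \<open>X\<close> range over small subsets of \<^typ>\<open>'u\<close>, as every small
  set is in bijection with one of these.
\<close>

definition hom_preserves_colimit ::
  "('o, 'm) cat \<Rightarrow> 'o \<Rightarrow> ('u, 'u) cat \<Rightarrow> ('u \<Rightarrow> 'o) \<Rightarrow> ('u \<Rightarrow> 'm) \<Rightarrow> 'o \<Rightarrow> ('u \<Rightarrow> 'm) \<Rightarrow> bool" where
  "hom_preserves_colimit K a J Do Dm x l \<longleftrightarrow>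
     (\<forall>(X :: 'u set) \<phi>. small TYPE('u) X \<and>
        (\<forall>j \<in> Obj J. \<phi> j \<in> hom K a (Do j) \<rightarrow> X) \<and>
        (\<forall>u \<in> Mor J. \<forall>g \<in> hom K a (Do (Dom J u)).
           \<phi> (Cod J u) (Comp K (Dm u) g) = \<phi> (Dom J u) g) \<longrightarrow>
        (\<exists>!\<psi>. \<psi> \<in> hom K a x \<rightarrow>\<^sub>E X \<and>
           (\<forall>j \<in> Obj J. \<forall>g \<in> hom K a (Do j). \<psi> (Comp K (l j) g) = \<phi> j g)))"

definition presentable :: "'u rel \<Rightarrow> ('o, 'm) cat \<Rightarrow> 'o \<Rightarrow> bool" where
  "presentable \<kappa> K a \<longleftrightarrow> a \<in> Obj K \<and>
     (\<forall>(J :: ('u, 'u) cat) Do Dm x l.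
        directed_poset \<kappa> J \<and> is_functor J K Do Dm \<and> colimit_cocone J K Do Dm x l \<longrightarrow>
        hom_preserves_colimit K a J Do Dm x l)"

definition locally_presentable :: "'u itself \<Rightarrow> ('o, 'm) cat \<Rightarrow> bool" where
  "locally_presentable U K \<longleftrightarrow> category K \<and> locally_small U K \<and> cocomplete U K \<and>
     (\<exists>\<kappa> :: 'u rel. small_regular_cardinal \<kappa> \<and>
       (\<exists>S. small U S \<and> (\<forall>s \<in> S. presentable \<kappa> K s) \<and>
         (\<forall>x \<in> Obj K. \<exists>(J :: ('u, 'u) cat) Do Dm l.
            directed_poset \<kappa> J \<and> is_functor J K Do Dm \<and> (\<forall>j \<in> Obj J. Do j \<in> S) \<and>
            colimit_cocone J K Do Dm x l)))"


section \<open>Model structures\<close>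

definition lifts :: "('o, 'm) cat \<Rightarrow> 'm \<Rightarrow> 'm \<Rightarrow> bool" where
  "lifts K f g \<longleftrightarrow>
     (\<forall>u \<in> hom K (Dom K f) (Dom K g). \<forall>v \<in> hom K (Cod K f) (Cod K g).
        Comp K g u = Comp K v f \<longrightarrow>
        (\<exists>h \<in> hom K (Cod K f) (Dom K g). Comp K h f = u \<and> Comp K g h = v))"

definition llp :: "('o, 'm) cat \<Rightarrow> 'm set \<Rightarrow> 'm set" where
  "llp K R = {f \<in> Mor K. \<forall>g \<in> R. lifts K f g}"

definition rlp :: "('o, 'm) cat \<Rightarrow> 'm set \<Rightarrow> 'm set" where
  "rlp K L = {g \<in> Mor K. \<forall>f \<in> L. lifts K f g}"

definition weak_factorisation_system :: "('o, 'm) cat \<Rightarrow> 'm set \<Rightarrow> 'm set \<Rightarrow> bool" where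
  "weak_factorisation_system K L R \<longleftrightarrow> L = llp K R \<and> R = rlp K L \<and>
     (\<forall>f \<in> Mor K. \<exists>l \<in> L. \<exists>r \<in> R. Cod K l = Dom K r \<and> f = Comp K r l)"

definition two_out_of_three :: "('o, 'm) cat \<Rightarrow> 'm set \<Rightarrow> bool" where
  "two_out_of_three K W \<longleftrightarrow>
     (\<forall>f \<in> Mor K. \<forall>g \<in> Mor K. Dom K g = Cod K f \<longrightarrow>
        (f \<in> W \<and> g \<in> W \<longrightarrow> Comp K g f \<in> W) \<and>
        (f \<in> W \<and> Comp K g f \<in> W \<longrightarrow> g \<in> W) \<and>
        (g \<in> W \<and> Comp K g f \<in> W \<longrightarrow> f \<in> W))"

record 'm model_structure =
  weq :: "'m set"
  cof :: "'m set"
  fib :: "'m set"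

text \<open>
  Closure of all three classes under retracts is a consequence of the axioms below
  (for \<open>weq\<close> this is due to Joyal and Tierney).
\<close>

definition model_category :: "'u itself \<Rightarrow> ('o, 'm) cat \<Rightarrow> 'm model_structure \<Rightarrow> bool" where
  "model_category U K M \<longleftrightarrow>
     category K \<and> complete U K \<and> cocomplete U K \<and>
     weq M \<subseteq> Mor K \<and> two_out_of_three K (weq M) \<and>
     weak_factorisation_system K (cof M) (fib M \<inter> weq M) \<and>
     weak_factorisation_system K (cof M \<inter> weq M) (fib M)"

text \<open>
  The smallness conditions needed for the small object argument are omitted from
  \<open>cofibrantly_generated\<close>, which is only used for locally presentable \<open>K\<close>, where they hold for
  every small set of morphisms.
\<close>

definition cofibrantly_generated :: "'u itself \<Rightarrow> ('o, 'm) cat \<Rightarrow> 'm model_structure \<Rightarrow> bool" where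
  "cofibrantly_generated U K M \<longleftrightarrow>
     (\<exists>I J. I \<subseteq> Mor K \<and> J \<subseteq> Mor K \<and> small U I \<and> small U J \<and>
        fib M \<inter> weq M = rlp K I \<and> fib M = rlp K J)"

definition combinatorial_model_category ::
  "'u itself \<Rightarrow> ('o, 'm) cat \<Rightarrow> 'm model_structure \<Rightarrow> bool" where
  "combinatorial_model_category U K M \<longleftrightarrow>
     model_category U K M \<and> locally_presentable U K \<and> cofibrantly_generated U K M"

definition fibrant :: "('o, 'm) cat \<Rightarrow> 'm model_structure \<Rightarrow> 'o \<Rightarrow> bool" where
  "fibrant K M x \<longleftrightarrow> x \<in> Obj K \<and> (\<exists>t. terminal K t \<and> (\<exists>f \<in> hom K x t. f \<in> fib M))"

end

(* The weak equivalences are the functors w over C such that precomposition with w is bijective on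
   functors over C into discrete fibrations, and the fibrations are the functors with the right lifting
   property against them. A functor X -> Y is factored through the smallest subcategory E of
   Y x_C RX that contains the image of X and whose inclusion has that lifting property, where RX is the
   reflection of X into discrete fibrations; X -> E is a weak equivalence since the equaliser of two
   functors from E to a discrete fibration is again such a subcategory.
   For cofibrant generation, a zigzag argument (weak equivalences are detected on components of the
   comma categories c/P) shows that every weak equivalence is covered by a directed family of weak
   equivalences between subcategories of bounded size; lifts against the latter are unique, so they
   glue. *)
theory Submission
  imports Defs
begin

section \<open>Small and bounded sets\<close>

text \<open>Since every functor is a cofibration, the trivial fibrations are forced to be the
  isomorphisms, and the only substantial factorisation is the one into a weak equivalence and a
  fibration. For a functor X -> Y the product Y x_C RX does half of the work: its projection to Y is
  a fibration because RX is a discrete fibration, and every functor from X to a discrete fibration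
  extends to it through RX. What can fail is uniqueness of the extension; cutting down to the
  smallest subcategory restores it. Size is governed by an infinite small set \<open>B\<close>. The
  cardinal of local presentability is the successor of |B|, so that all counting can be done with
  \<open>\<le>o |B|\<close>. For the generating sets \<open>B\<close> also bounds the arrows of C,
  because zigzags are adjoined for every arrow of the base. Products, colimits and reflections are
  first built on whatever type is natural and then copied into \<open>'u\<close>. To keep this
  cheap, categories are handled through their arrows alone: a functor is one function and a
  subcategory is one set.\<close>

lemma finite_ordLess_infinite_set: "finite A \<Longrightarrow> infinite B \<Longrightarrow> |A| <o |B|"
  by (rule Cfinite_ordLess_Cinfinite) (simp_all add: cfinite_def cinfinite_def card_of_card_order_on Field_card_of)

lemma small_subset: "A \<subseteq> B \<Longrightarrow> small U B \<Longrightarrow> small U A"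
  unfolding small_def using card_of_mono1 ordLeq_ordLess_trans by blast

lemma small_ordLeq: "|A| \<le>o |B| \<Longrightarrow> small U B \<Longrightarrow> small U A"
  unfolding small_def using ordLeq_ordLess_trans by blast

lemma small_image: "small U A \<Longrightarrow> small U (f ` A)"
  using small_ordLeq card_of_image by blast

lemma small_inj: "inj_on f A \<Longrightarrow> f ` A \<subseteq> B \<Longrightarrow> small U B \<Longrightarrow> small U A"
  using small_ordLeq card_of_ordLeq by metis

lemma small_embed:
  assumes "small (U :: 'u itself) (A :: 'a set)"
  obtains f :: "'a \<Rightarrow> 'u" where "inj_on f A"
  using assms unfolding small_def by (metis card_of_ordLeq ordLess_imp_ordLeq)

text \<open>A successor cardinal is regular, and the strong limit property keeps the successor of
  |B| below the universe, since it is at most |Pow B|. The last conclusion is the form used later: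
  smallness with respect to \<open>\<kappa>\<close> is a bound by \<open>B\<close>.\<close>

lemma regular_cardinal_exists:
  fixes B :: "'u set"
  assumes U: "inaccessible_universe TYPE('u)" and B: "infinite B" "small TYPE('u) B"
  shows "\<exists>\<kappa> :: 'u rel. small_regular_cardinal \<kappa> \<and> (\<forall>A :: 'u set. |A| <o \<kappa> \<longleftrightarrow> |A| \<le>o |B| )"
proof -
  have P: "|Pow B| <o |UNIV :: 'u set|" using U B(2) by (auto simp: inaccessible_universe_def small_def)
  have cs: "cardSuc |B| \<le>o |Pow B|"
    by (rule iffD1[OF cardSuc_ordLess_ordLeq card_of_Pow]) (rule card_of_Card_order)+
  then have csU: "cardSuc |B| <o |UNIV :: 'u set|" using P ordLeq_ordLess_trans by blast
  have co: "Card_order (cardSuc |B| )" by (simp add: cardSuc_Card_order card_of_Card_order)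
  \<comment> \<open>\<open>cardSuc |B|\<close> is an order on \<open>'u set\<close>; an injection of
    its field into \<open>'u\<close> provides the copy \<open>|B1|\<close> of the required
    type.\<close>
  have FF: "|Field (cardSuc |B| )| =o cardSuc |B|" using co card_of_Field_ordIso by blast
  then have "|Field (cardSuc |B| )| \<le>o |UNIV :: 'u set|"
    using csU ordIso_ordLess_trans ordLess_imp_ordLeq by blast
  then obtain f :: "'u set \<Rightarrow> 'u" where f: "inj_on f (Field (cardSuc |B| ))"
    by (metis card_of_ordLeq)
  define B1 where "B1 = f ` Field (cardSuc |B| )"
  have "|Field (cardSuc |B| )| =o |B1|"
    unfolding B1_def using f by (meson card_of_ordIso inj_on_imp_bij_betw)
  then have iso: "cardSuc |B| =o |B1|" using FF ordIso_symmetric ordIso_transitive by blast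
  have inf: "Cinfinite |B|" using B(1) by (simp add: cinfinite_def card_of_card_order_on Field_card_of)
  then have ci: "Cinfinite (cardSuc |B| )" by (rule Cinfinite_cardSuc)
  have "Cinfinite |B1|" using Cinfinite_cong[OF iso ci] .
  moreover have "regularCard |B1|"
    by (rule regularCard_ordIso[OF iso ci regularCard_cardSuc[OF inf]])
  moreover have "|B1| <o |UNIV :: 'u set|"
    using iso csU ordIso_symmetric ordIso_ordLess_trans by blast
  moreover have "|A| <o |B1| \<longleftrightarrow> |A| \<le>o |B|" for A :: "'u set"
  proof -
    have "|A| <o |B1| \<longleftrightarrow> |A| <o cardSuc |B|"
      using iso by (meson ordIso_symmetric ordLess_ordIso_trans)
    also have "\<dots> \<longleftrightarrow> |A| \<le>o |B|"
      by (rule cardSuc_ordLeq_ordLess) (rule card_of_Card_order)+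
    finally show ?thesis .
  qed
  ultimately show ?thesis unfolding small_regular_cardinal_def by blast
qed

locale universe =
  fixes U :: "'u itself"
  assumes universe: "inaccessible_universe TYPE('u)"
begin

abbreviation sml :: "'a set \<Rightarrow> bool" where "sml \<equiv> small U"

lemma small_TYPE: "small TYPE('u) A \<longleftrightarrow> sml A"
  by (simp add: small_def)

lemma natLeq_less: "natLeq <o |UNIV :: 'u set|" 
  using universe by (auto simp: inaccessible_universe_def)

lemma infinite_universe: "infinite (UNIV :: 'u set)"
  using natLeq_less infinite_iff_natLeq_ordLeq ordLess_imp_ordLeq by blast

lemma small_nat: "sml (UNIV :: nat set)"
  unfolding small_def using card_of_nat natLeq_less ordIso_ordLess_trans by blast

lemma small_finite: "finite A \<Longrightarrow> sml A"
  unfolding small_def by (rule finite_ordLess_infinite_set[OF _ infinite_universe])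

lemma small_Pow:
  assumes "sml A" shows "sml (Pow A)"
proof -
  obtain f :: "'a \<Rightarrow> 'u" where f: "inj_on f A" using assms by (rule small_embed)
  have "|Pow (f ` A)| <o |UNIV :: 'u set|"
    using universe small_image[OF assms, of f] by (auto simp: inaccessible_universe_def small_def)
  then have "sml (Pow (f ` A))" by (simp add: small_def)
  moreover have "inj_on ((`) f) (Pow A)"
    using f by (auto simp: inj_on_def inj_on_image_eq_iff)
  moreover have "(`) f ` Pow A \<subseteq> Pow (f ` A)" by auto
  ultimately show ?thesis by (meson small_inj)
qed

lemma small_UN:
  fixes I :: "'i set"
  assumes I: "sml I" and A: "\<And>i. i \<in> I \<Longrightarrow> sml (A i)"
  shows "sml (\<Union>i\<in>I. A i)"
proof -
  obtain f :: "'i \<Rightarrow> 'u" where f: "inj_on f I" using I by (rule small_embed)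
  have "Cinfinite |UNIV :: 'u set|" using infinite_universe by (simp add: cinfinite_def card_of_card_order_on Field_card_of)
  moreover have "regularCard |UNIV :: 'u set|" using universe by (auto simp: inaccessible_universe_def)
  moreover have "|f ` I| <o |UNIV :: 'u set|" using small_image[OF I, of f] by (simp add: small_def)
  moreover have "\<forall>j \<in> f ` I. |A (inv_into I f j)| <o |UNIV :: 'u set|"
    using A f by (auto simp: small_def)
  ultimately have "|\<Union>j\<in>f ` I. A (inv_into I f j)| <o |UNIV :: 'u set|"
    by (intro card_of_UNION_ordLess_infinite_Field_regularCard)
  moreover have "(\<Union>j\<in>f ` I. A (inv_into I f j)) = (\<Union>i\<in>I. A i)" using f by auto
  ultimately show ?thesis by (simp add: small_def)
qed

lemma small_Sigma:
  assumes I: "sml I" and A: "\<And>i. i \<in> I \<Longrightarrow> sml (A i)"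
  shows "sml (Sigma I A)"
proof -
  have "Sigma I A = (\<Union>i\<in>I. Pair i ` A i)" by auto
  moreover have "sml (\<Union>i\<in>I. Pair i ` A i)" by (intro small_UN I small_image A)
  ultimately show ?thesis by simp
qed

lemma small_Times: "sml A \<Longrightarrow> sml B \<Longrightarrow> sml (A \<times> B)"
  by (simp add: small_Sigma)

text \<open>A function is coded by its graph, a subset of \<open>Sigma I A\<close>, so that the
  strong limit property in the form \<open>small_Pow\<close> applies.\<close>

lemma small_PiE:
  assumes I: "sml I" and A: "\<And>i. i \<in> I \<Longrightarrow> sml (A i)"
  shows "sml (PiE I A)"
proof (rule small_inj)
  let ?g = "\<lambda>f. (\<lambda>i. (i, f i)) ` I"
  show "inj_on ?g (PiE I A)"
  proof (rule inj_onI)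
    fix f g assume f: "f \<in> PiE I A" and g: "g \<in> PiE I A" and eq: "?g f = ?g g"
    show "f = g"
    proof (rule PiE_ext[OF f g])
      fix i assume "i \<in> I"
      then have "(i, f i) \<in> ?g g" using eq by blast
      then show "f i = g i" by auto
    qed
  qed
  show "?g ` PiE I A \<subseteq> Pow (Sigma I A)" by auto
  show "sml (Pow (Sigma I A))" by (rule small_Pow[OF small_Sigma[OF I A]])
qed

lemma small_Un: "sml A \<Longrightarrow> sml B \<Longrightarrow> sml (A \<union> B)"
  using small_UN[of "{True, False}" "\<lambda>b. if b then A else B"] small_finite[of "{True, False}"]
  by (simp add: Un_commute)

lemma infinite_bound_exists:
  assumes "sml A"
  obtains B :: "'u set" where "infinite B" "sml B" "|A| \<le>o |B|"
proof -
  have s: "sml (A <+> (UNIV :: nat set))"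
    unfolding Plus_def by (intro small_Un small_image assms small_nat)
  obtain f :: "'a + nat \<Rightarrow> 'u" where f: "inj_on f (A <+> UNIV)" using s by (rule small_embed)
  let ?B = "f ` (A <+> (UNIV :: nat set))"
  have iso: "|A <+> (UNIV :: nat set)| =o |?B|" using f by (meson card_of_ordIso inj_on_imp_bij_betw)
  show thesis
  proof
    show "infinite ?B" using f by (simp add: finite_image_iff)
    show "sml ?B" by (rule small_image[OF s])
    show "|A| \<le>o |?B|" using card_of_Plus1 iso ordLeq_ordIso_trans by blast
  qed
qed

end

section \<open>Sets with at most |B| elements\<close>

lemma bounded_UN: "infinite B \<Longrightarrow> |I| \<le>o |B| \<Longrightarrow> (\<And>i. i \<in> I \<Longrightarrow> |A i| \<le>o |B| ) \<Longrightarrow> |\<Union>i\<in>I. A i| \<le>o |B|"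
  by (simp add: card_of_UNION_ordLeq_infinite)

lemma bounded_Times: "infinite B \<Longrightarrow> |X| \<le>o |B| \<Longrightarrow> |Y| \<le>o |B| \<Longrightarrow> |X \<times> Y| \<le>o |B|"
  by (simp add: card_of_Sigma_ordLeq_infinite)

lemma bounded_image: "|X| \<le>o |B| \<Longrightarrow> |f ` X| \<le>o |B|"
  using card_of_image ordLeq_transitive by blast

lemma bounded_subset: "X \<subseteq> Y \<Longrightarrow> |Y| \<le>o |B| \<Longrightarrow> |X| \<le>o |B|"
  using card_of_mono1 ordLeq_transitive by blast

lemma bounded_finite: "infinite B \<Longrightarrow> finite X \<Longrightarrow> |X| \<le>o |B|"
  by (simp add: ordLess_imp_ordLeq finite_ordLess_infinite_set)

lemma bounded_Un: "infinite B \<Longrightarrow> |X| \<le>o |B| \<Longrightarrow> |Y| \<le>o |B| \<Longrightarrow> |X \<union> Y| \<le>o |B|"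
  using bounded_UN[of B "{True, False}" "\<lambda>b. if b then X else Y"] bounded_finite[of B "{True, False}"]
  by (simp add: Un_commute)

text \<open>Closing off in countably many rounds: each round adds at most |B| elements, and so does
  their countable union. Two elements of the union already occur in a common round, which is why a
  binary \<open>G\<close> is closed off in the limit.\<close>

lemma bounded_closure:
  assumes B: "infinite B" and X: "X \<subseteq> S" "|X| \<le>o |B|"
    and G: "\<And>x y. x \<in> S \<Longrightarrow> y \<in> S \<Longrightarrow> G x y \<subseteq> S \<and> |G x y| \<le>o |B|"
  obtains X' where "X \<subseteq> X'" "X' \<subseteq> S" "|X'| \<le>o |B|" "\<And>x y. x \<in> X' \<Longrightarrow> y \<in> X' \<Longrightarrow> G x y \<subseteq> X'"
proof -
  define Z where "Z = rec_nat X (\<lambda>_ W. W \<union> (\<Union>(x, y)\<in>W \<times> W. G x y))"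
  have Z0: "Z 0 = X" and ZS: "Z (Suc n) = Z n \<union> (\<Union>(x, y)\<in>Z n \<times> Z n. G x y)" for n
    by (simp_all add: Z_def)
  have Z: "Z n \<subseteq> S \<and> |Z n| \<le>o |B|" for n
  proof (induction n)
    case 0 then show ?case using X by (simp add: Z0)
  next
    case (Suc n)
    have "|\<Union>(x, y)\<in>Z n \<times> Z n. G x y| \<le>o |B|"
      using Suc G by (intro bounded_UN[OF B] bounded_Times[OF B]) auto
    then show ?case unfolding ZS using Suc G bounded_Un[OF B] by blast
  qed
  have mono: "m \<le> n \<Longrightarrow> Z m \<subseteq> Z n" for m n
    by (induction rule: dec_induct) (auto simp: ZS)
  have nat: "|UNIV :: nat set| \<le>o |B|" using B infinite_iff_card_of_nat by blast
  show thesis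
  proof
    show "X \<subseteq> (\<Union>n. Z n)" using Z0 by blast
    show "(\<Union>n. Z n) \<subseteq> S" using Z by blast
    show "|\<Union>n. Z n| \<le>o |B|" using Z by (intro bounded_UN[OF B nat]) auto
    fix x y assume "x \<in> (\<Union>n. Z n)" "y \<in> (\<Union>n. Z n)"
    then obtain m n where "x \<in> Z m" "y \<in> Z n" by blast
    then have "x \<in> Z (max m n)" "y \<in> Z (max m n)" using mono[of m "max m n"] mono[of n "max m n"] by auto
    then show "G x y \<subseteq> (\<Union>n. Z n)" using ZS[of "max m n"] by blast
  qed
qed

section \<open>Categories over a base, described by their arrows\<close>

text \<open>
  A category over a base is described by its arrows alone: an object is represented by its identity,
  \<open>dm f\<close> and \<open>cd f\<close> are the identities of the domain and the codomain of \<open>f\<close>, \<open>cm g f\<close> is \<open>g\<close>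
  after \<open>f\<close>, and \<open>pr\<close> is the functor to the base.
\<close>

record ('m, 'c) overcat =
  Ar :: "'m set"
  dm :: "'m \<Rightarrow> 'm"
  cd :: "'m \<Rightarrow> 'm"
  cm :: "'m \<Rightarrow> 'm \<Rightarrow> 'm"
  pr :: "'m \<Rightarrow> 'c"

definition over :: "('o, 'c) cat \<Rightarrow> ('m, 'c) overcat \<Rightarrow> bool" where
  "over C X \<longleftrightarrow>
     (\<forall>f \<in> Ar X. dm X f \<in> Ar X \<and> cd X f \<in> Ar X \<and>
        dm X (dm X f) = dm X f \<and> cd X (dm X f) = dm X f \<and>
        dm X (cd X f) = cd X f \<and> cd X (cd X f) = cd X f \<and>
        cm X f (dm X f) = f \<and> cm X (cd X f) f = f \<and> pr X f \<in> Mor C \<and>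
        pr X (dm X f) = Ident C (Dom C (pr X f)) \<and> pr X (cd X f) = Ident C (Cod C (pr X f))) \<and>
     (\<forall>f \<in> Ar X. \<forall>g \<in> Ar X. dm X g = cd X f \<longrightarrow>
        cm X g f \<in> Ar X \<and> dm X (cm X g f) = dm X f \<and> cd X (cm X g f) = cd X g \<and>
        pr X (cm X g f) = Comp C (pr X g) (pr X f)) \<and>
     (\<forall>f \<in> Ar X. \<forall>g \<in> Ar X. \<forall>h \<in> Ar X. dm X g = cd X f \<longrightarrow> dm X h = cd X g \<longrightarrow>
        cm X h (cm X g f) = cm X (cm X h g) f)"

definition omor :: "('m, 'c) overcat \<Rightarrow> ('n, 'c) overcat \<Rightarrow> ('m \<Rightarrow> 'n) \<Rightarrow> bool" where
  "omor X Y \<phi> \<longleftrightarrow>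
     (\<forall>f \<in> Ar X. \<phi> f \<in> Ar Y \<and> \<phi> (dm X f) = dm Y (\<phi> f) \<and> \<phi> (cd X f) = cd Y (\<phi> f) \<and>
        pr Y (\<phi> f) = pr X f) \<and>
     (\<forall>f \<in> Ar X. \<forall>g \<in> Ar X. dm X g = cd X f \<longrightarrow> \<phi> (cm X g f) = cm Y (\<phi> g) (\<phi> f))"

definition view :: "'u cat_functor \<Rightarrow> ('u, 'u) overcat" where
  "view P = \<lparr>Ar = Mor (src P), dm = (\<lambda>f. Ident (src P) (Dom (src P) f)),
     cd = (\<lambda>f. Ident (src P) (Cod (src P) f)), cm = Comp (src P), pr = amap P\<rparr>"

definition act :: "'u cat_functor \<times> 'u cat_functor \<times> 'u cat_functor \<Rightarrow> 'u \<Rightarrow> 'u" where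
  "act F = amap (fst (snd F))"

text \<open>The object map is forced: the image of \<open>x\<close> is the domain of the image of
  its identity. \<open>restrict\<close> supplies the undefined values outside the domain that
  extensionality of functors demands.\<close>

definition mk :: "'u cat_functor \<Rightarrow> 'u cat_functor \<Rightarrow> ('u \<Rightarrow> 'u) \<Rightarrow>
    'u cat_functor \<times> 'u cat_functor \<times> 'u cat_functor" where
  "mk P Q \<phi> = (P, \<lparr>src = src P, tgt = src Q,
     omap = restrict (\<lambda>x. Dom (src Q) (\<phi> (Ident (src P) x))) (Obj (src P)),
     amap = restrict \<phi> (Mor (src P))\<rparr>, Q)"

lemma overD:
  assumes "over C X" "f \<in> Ar X"
  shows "dm X f \<in> Ar X" "cd X f \<in> Ar X"
    "dm X (dm X f) = dm X f" "cd X (dm X f) = dm X f"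
    "dm X (cd X f) = cd X f" "cd X (cd X f) = cd X f"
    "cm X f (dm X f) = f" "cm X (cd X f) f = f" "pr X f \<in> Mor C"
    "pr X (dm X f) = Ident C (Dom C (pr X f))" "pr X (cd X f) = Ident C (Cod C (pr X f))"
  using assms unfolding over_def by blast+

lemma over_compD:
  assumes "over C X" "f \<in> Ar X" "g \<in> Ar X" "dm X g = cd X f"
  shows "cm X g f \<in> Ar X" "dm X (cm X g f) = dm X f" "cd X (cm X g f) = cd X g"
    "pr X (cm X g f) = Comp C (pr X g) (pr X f)"
  using assms unfolding over_def by blast+

lemma over_assoc:
  assumes "over C X" "f \<in> Ar X" "g \<in> Ar X" "h \<in> Ar X" "dm X g = cd X f" "dm X h = cd X g"
  shows "cm X h (cm X g f) = cm X (cm X h g) f"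
  using assms unfolding over_def by blast

lemma omorD:
  assumes "omor X Y \<phi>" "f \<in> Ar X"
  shows "\<phi> f \<in> Ar Y" "\<phi> (dm X f) = dm Y (\<phi> f)" "\<phi> (cd X f) = cd Y (\<phi> f)" "pr Y (\<phi> f) = pr X f"
  using assms unfolding omor_def by blast+

lemma omor_comp:
  assumes "omor X Y \<phi>" "f \<in> Ar X" "g \<in> Ar X" "dm X g = cd X f"
  shows "\<phi> (cm X g f) = cm Y (\<phi> g) (\<phi> f)"
  using assms unfolding omor_def by blast

lemma omor_compose:
  assumes "over C X" "omor X Y \<phi>" "omor Y Z \<psi>"
  shows "omor X Z (\<lambda>f. \<psi> (\<phi> f))"
  unfolding omor_def
proof (intro conjI ballI impI)
  fix f assume f: "f \<in> Ar X"
  show "\<psi> (\<phi> f) \<in> Ar Z" "\<psi> (\<phi> (dm X f)) = dm Z (\<psi> (\<phi> f))" "\<psi> (\<phi> (cd X f)) = cd Z (\<psi> (\<phi> f))"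
    "pr Z (\<psi> (\<phi> f)) = pr X f"
    using omorD[OF assms(2) f] omorD[OF assms(3), of "\<phi> f"] by auto
next
  fix f g assume *: "f \<in> Ar X" "g \<in> Ar X" "dm X g = cd X f"
  have "dm Y (\<phi> g) = cd Y (\<phi> f)" using omorD[OF assms(2)] * by metis
  then show "\<psi> (\<phi> (cm X g f)) = cm Z (\<psi> (\<phi> g)) (\<psi> (\<phi> f))"
    using omor_comp[OF assms(2) *] omorD(1)[OF assms(2)] * omor_comp[OF assms(3)] by auto
qed

lemma omor_id: "omor X X (\<lambda>f. f)"
  by (auto simp: omor_def)

lemma omor_inverse:
  assumes X: "over C X" and \<phi>: "omor X Y \<phi>" and bij: "bij_betw \<phi> (Ar X) (Ar Y)"
  shows "omor Y X (inv_into (Ar X) \<phi>)"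
proof -
  let ?\<psi> = "inv_into (Ar X) \<phi>"
  have inj: "inj_on \<phi> (Ar X)" using bij by (rule bij_betw_imp_inj_on)
  have in_X: "?\<psi> f \<in> Ar X" and eq: "\<phi> (?\<psi> f) = f" if "f \<in> Ar Y" for f
    using that bij by (auto simp: bij_betw_def inv_into_into f_inv_into_f)
  have inv: "?\<psi> (\<phi> f) = f" if "f \<in> Ar X" for f using that inj by simp
  show ?thesis
    unfolding omor_def
  proof (intro conjI ballI impI)
    fix f assume f: "f \<in> Ar Y"
    show "?\<psi> f \<in> Ar X" using f by (rule in_X)
    show "?\<psi> (dm Y f) = dm X (?\<psi> f)" "?\<psi> (cd Y f) = cd X (?\<psi> f)" "pr X (?\<psi> f) = pr Y f"
      using omorD[OF \<phi> in_X[OF f]] inv[of "dm X (?\<psi> f)"] inv[of "cd X (?\<psi> f)"]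
        overD(1,2)[OF X in_X[OF f]] eq[OF f] by simp_all
  next
    fix f g assume *: "f \<in> Ar Y" "g \<in> Ar Y" "dm Y g = cd Y f"
    have "\<phi> (dm X (?\<psi> g)) = \<phi> (cd X (?\<psi> f))"
      using * omorD[OF \<phi>] in_X eq by simp
    then have "dm X (?\<psi> g) = cd X (?\<psi> f)"
      using inj_onD[OF inj] overD(1,2)[OF X] in_X * by metis
    then have "cm X (?\<psi> g) (?\<psi> f) \<in> Ar X" "\<phi> (cm X (?\<psi> g) (?\<psi> f)) = cm Y g f"
      using over_compD(1)[OF X] omor_comp[OF \<phi>] * in_X eq by auto
    then show "?\<psi> (cm Y g f) = cm X (?\<psi> g) (?\<psi> f)" using inv by metis
  qed
qed

section \<open>The slice category seen through arrows\<close>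

locale small_base = universe U for U :: "'u itself" +
  fixes C :: "('u, 'u) cat"
  assumes C: "small_category C"
begin

abbreviation K where "K \<equiv> slice Cat C"

lemma category_C: "category C" using C by (simp add: small_category_def)

lemma small_C: "sml (Mor C)" "sml (Obj C)" using C by (auto simp: small_category_def small_TYPE)

lemma Obj_K: "P \<in> Obj K \<longleftrightarrow> small_functor P \<and> tgt P = C"
  by (simp add: slice_def Cat_def)

lemma C_Dom [simp]: "u \<in> Mor C \<Longrightarrow> Dom C u \<in> Obj C" and C_Cod [simp]: "u \<in> Mor C \<Longrightarrow> Cod C u \<in> Obj C"
  and C_Ident [simp]: "x \<in> Obj C \<Longrightarrow> Ident C x \<in> Mor C"
    "x \<in> Obj C \<Longrightarrow> Dom C (Ident C x) = x" "x \<in> Obj C \<Longrightarrow> Cod C (Ident C x) = x"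
  and C_unit [simp]: "u \<in> Mor C \<Longrightarrow> Comp C u (Ident C (Dom C u)) = u" 
    "u \<in> Mor C \<Longrightarrow> Comp C (Ident C (Cod C u)) u = u"
  using category_C by (auto simp: category_def hom_def)

lemma C_Comp [simp]:
  assumes "u \<in> Mor C" "v \<in> Mor C" "Dom C v = Cod C u"
  shows "Comp C v u \<in> Mor C" "Dom C (Comp C v u) = Dom C u" "Cod C (Comp C v u) = Cod C v"
  using category_C assms by (auto simp: category_def hom_def)

lemma C_assoc:
  assumes "u \<in> Mor C" "v \<in> Mor C" "w \<in> Mor C" "Dom C v = Cod C u" "Dom C w = Cod C v"
  shows "Comp C w (Comp C v u) = Comp C (Comp C w v) u"
  using category_C assms by (auto simp: category_def)

lemma over_view:
  assumes "P \<in> Obj K"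
  shows "over C (view P)"
proof -
  define A where "A = src P"
  have A: "category A" and fn: "is_functor A C (omap P) (amap P)"
    using assms by (auto simp: Obj_K small_functor_def small_category_def A_def)
  have a: "Dom A f \<in> Obj A" "Cod A f \<in> Obj A" "Comp A f (Ident A (Dom A f)) = f"
    "Comp A (Ident A (Cod A f)) f = f" if "f \<in> Mor A" for f
    using A that by (auto simp: category_def)
  have i: "Ident A x \<in> Mor A" "Dom A (Ident A x) = x" "Cod A (Ident A x) = x" if "x \<in> Obj A" for x
    using A that by (auto simp: category_def hom_def)
  then have inj: "Ident A x = Ident A y \<longleftrightarrow> x = y" if "x \<in> Obj A" "y \<in> Obj A" for x y
    using that by metis
  have c: "Comp A g f \<in> Mor A" "Dom A (Comp A g f) = Dom A f" "Cod A (Comp A g f) = Cod A g"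
    "amap P (Comp A g f) = Comp C (amap P g) (amap P f)"
    if "f \<in> Mor A" "g \<in> Mor A" "Dom A g = Cod A f" for f g
    using A fn that by (auto simp: category_def hom_def is_functor_def)
  have asc: "Comp A h (Comp A g f) = Comp A (Comp A h g) f"
    if "f \<in> Mor A" "g \<in> Mor A" "h \<in> Mor A" "Dom A g = Cod A f" "Dom A h = Cod A g" for f g h
    using A that by (auto simp: category_def)
  have p: "amap P f \<in> Mor C" "Dom C (amap P f) = omap P (Dom A f)" "Cod C (amap P f) = omap P (Cod A f)"
    if "f \<in> Mor A" for f
    using fn that by (auto simp: is_functor_def hom_def)
  have "amap P (Ident A x) = Ident C (omap P x)" if "x \<in> Obj A" for x
    using fn that by (auto simp: is_functor_def)
  then show ?thesis
    unfolding over_def view_def A_def[symmetric] using asc by (simp add: a i inj c p)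
qed

lemma small_view: "P \<in> Obj K \<Longrightarrow> sml (Ar (view P))"
  by (auto simp: Obj_K small_functor_def small_category_def view_def small_TYPE)

lemma hom_K:
  "F \<in> hom K P Q \<longleftrightarrow> P \<in> Obj K \<and> Q \<in> Obj K \<and>
     (\<exists>f. F = (P, f, Q) \<and> small_functor f \<and> src f = src P \<and> tgt f = src Q \<and> Comp Cat Q f = P)"
  by (auto simp: hom_def slice_def Cat_def)

lemma homD: "F \<in> hom K P Q \<Longrightarrow> P \<in> Obj K" "F \<in> hom K P Q \<Longrightarrow> Q \<in> Obj K"
  by (auto simp: hom_K)

lemma hom_Mor: "F \<in> hom K P Q \<Longrightarrow> F \<in> Mor K" "F \<in> hom K P Q \<Longrightarrow> Dom K F = P" "F \<in> hom K P Q \<Longrightarrow> Cod K F = Q"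
  by (auto simp: hom_def)

lemma Mor_hom: "F \<in> Mor K \<Longrightarrow> F \<in> hom K (Dom K F) (Cod K F)"
  by (simp add: hom_def)

lemma act_omor:
  assumes "F \<in> hom K P Q"
  shows "omor (view P) (view Q) (act F)"
proof -
  from assms obtain f where f: "F = (P, f, Q)" "small_functor f" "src f = src P" "tgt f = src Q"
    "Comp Cat Q f = P" by (auto simp: hom_K)
  define A B where "A = src P" and "B = src Q"
  have A: "category A" and B: "category B" and fn: "is_functor A B (omap f) (amap f)"
    using f(2-4) by (auto simp: small_functor_def small_category_def A_def B_def)
  have "Ident B x = Ident B y \<longleftrightarrow> x = y" if "x \<in> Obj B" "y \<in> Obj B" for x y
    using B that unfolding category_def hom_def by (metis (mono_tags, lifting) mem_Collect_eq)
  moreover have a: "Dom A f \<in> Obj A" "Cod A f \<in> Obj A" if "f \<in> Mor A" for f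
    using A that by (auto simp: category_def)
  moreover have "Ident A x = Ident A y \<longleftrightarrow> x = y" if "x \<in> Obj A" "y \<in> Obj A" for x y
    using A that unfolding category_def hom_def by (metis (mono_tags, lifting) mem_Collect_eq)
  moreover have "Dom B (amap f m) = omap f (Dom A m)" "Cod B (amap f m) = omap f (Cod A m)"
    "amap f m \<in> Mor B" if "m \<in> Mor A" for m
    using fn that by (auto simp: is_functor_def hom_def)
  moreover have "amap f (Ident A x) = Ident B (omap f x)" if "x \<in> Obj A" for x
    using fn that by (auto simp: is_functor_def)
  moreover have "amap f (Comp A g m) = Comp B (amap f g) (amap f m)"
    if "m \<in> Mor A" "g \<in> Mor A" "Dom A g = Cod A m" for m g
    using fn that by (auto simp: is_functor_def)
  moreover have "amap P m = amap Q (amap f m)" if "m \<in> Mor A" for m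
  proof -
    have "amap P = compose (Mor (src P)) (amap Q) (amap f)"
      using arg_cong[OF f(5), of amap] f(3) by (simp add: Cat_def)
    then show ?thesis using fun_cong[of _ _ m] that by (simp add: A_def compose_eq)
  qed
  ultimately show ?thesis
    unfolding omor_def view_def A_def[symmetric] B_def[symmetric] act_def f(1) by simp
qed

text \<open>The value of a functor on an object is the domain of its value on the identity, so the
  arrow map determines the object map.\<close>

lemma small_functor_eqI:
  assumes f: "small_functor f" and g: "small_functor g" and s: "src f = src g" and t: "tgt f = tgt g"
    and eq: "\<And>m. m \<in> Mor (src f) \<Longrightarrow> amap f m = amap g m"
  shows "f = g"
proof -
  have "amap f = amap g"
    using f g s eq unfolding small_functor_def by (metis extensionalityI)
  moreover have "omap f = omap g"
  proof (rule extensionalityI)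
    show "omap f \<in> extensional (Obj (src f))" using f by (simp add: small_functor_def)
    show "omap g \<in> extensional (Obj (src f))" using g s by (simp add: small_functor_def)
    fix x assume x: "x \<in> Obj (src f)"
    have cs: "category (src f)" "category (tgt f)"
      using f by (auto simp: small_functor_def small_category_def)
    have "Ident (src f) x \<in> Mor (src f)" using cs x by (auto simp: category_def hom_def)
    then have e: "amap f (Ident (src f) x) = amap g (Ident (src f) x)" by (rule eq)
    have "amap f (Ident (src f) x) = Ident (tgt f) (omap f x)" "omap f x \<in> Obj (tgt f)"
      using f x by (auto simp: small_functor_def is_functor_def)
    moreover have "amap g (Ident (src f) x) = Ident (tgt f) (omap g x)" "omap g x \<in> Obj (tgt f)"
      using g x s t by (auto simp: small_functor_def is_functor_def)
    moreover have "Dom (tgt f) (Ident (tgt f) y) = y" if "y \<in> Obj (tgt f)" for y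
      using cs that by (auto simp: category_def hom_def)
    ultimately show "omap f x = omap g x" using e by metis
  qed
  ultimately show ?thesis using s t by simp
qed

text \<open>Reduces equations between morphisms of \<open>K\<close> to pointwise equations between
  arrows; most diagram chases below end here.\<close>

lemma hom_eqI:
  assumes F: "F \<in> hom K P Q" and G: "G \<in> hom K P Q"
    and eq: "\<And>m. m \<in> Ar (view P) \<Longrightarrow> act F m = act G m"
  shows "F = G"
proof -
  from F G obtain f g where "F = (P, f, Q)" "G = (P, g, Q)" "small_functor f" "small_functor g"
    "src f = src P" "src g = src P" "tgt f = src Q" "tgt g = src Q"
    by (auto simp: hom_K)
  then show ?thesis using eq small_functor_eqI[of f g] by (auto simp: act_def view_def)
qed

lemma mk_small_functor:
  assumes P: "P \<in> Obj K" and Q: "Q \<in> Obj K" and \<phi>: "omor (view P) (view Q) \<phi>"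
  shows "small_functor (fst (snd (mk P Q \<phi>)))"
proof -
  define A B where "A = src P" and "B = src Q"
  have cs: "small_category A" "small_category B"
    using P Q by (auto simp: Obj_K small_functor_def A_def B_def)
  then have A: "category A" and B: "category B" by (auto simp: small_category_def)
  have idA: "Ident A x \<in> Mor A" "Dom A (Ident A x) = x" "Cod A (Ident A x) = x" if "x \<in> Obj A" for x
    using A that by (auto simp: category_def hom_def)
  have idB: "Ident B x \<in> Mor B" "Dom B (Ident B x) = x" "Cod B (Ident B x) = x" if "x \<in> Obj B" for x
    using B that by (auto simp: category_def hom_def)
  have morA: "Dom A f \<in> Obj A" "Cod A f \<in> Obj A" if "f \<in> Mor A" for f
    using A that by (auto simp: category_def)
  have compA: "Comp A g f \<in> Mor A" if "f \<in> Mor A" "g \<in> Mor A" "Dom A g = Cod A f" for f g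
    using A that by (auto simp: category_def hom_def)
  have morB: "Dom B f \<in> Obj B" "Cod B f \<in> Obj B" if "f \<in> Mor B" for f
    using B that by (auto simp: category_def)
  have phi: "\<phi> f \<in> Mor B" "\<phi> (Ident A (Dom A f)) = Ident B (Dom B (\<phi> f))"
    "\<phi> (Ident A (Cod A f)) = Ident B (Cod B (\<phi> f))" if "f \<in> Mor A" for f
    using omorD[OF \<phi>, of f] that by (auto simp: view_def A_def B_def)
  have phi_comp: "\<phi> (Comp A g f) = Comp B (\<phi> g) (\<phi> f)"
    if "f \<in> Mor A" "g \<in> Mor A" "Dom A g = Cod A f" for f g
    using omor_comp[OF \<phi>, of f g] that by (auto simp: view_def A_def B_def)
  have id: "\<phi> (Ident A x) = Ident B (Dom B (\<phi> (Ident A x)))" if "x \<in> Obj A" for x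
    using phi(2)[OF idA(1)[OF that]] idA[OF that] by simp
  let ?o = "restrict (\<lambda>x. Dom B (\<phi> (Ident A x))) (Obj A)"
  have "is_functor A B ?o (restrict \<phi> (Mor A))"
    unfolding is_functor_def
  proof (intro conjI ballI impI)
    fix x assume x: "x \<in> Obj A"
    show "?o x \<in> Obj B" using x morB phi(1) idA(1) by simp
    show "restrict \<phi> (Mor A) (Ident A x) = Ident B (?o x)" using x id idA(1) by simp
  next
    fix f assume f: "f \<in> Mor A"
    show "restrict \<phi> (Mor A) f \<in> hom B (?o (Dom A f)) (?o (Cod A f))"
      using f phi[OF f] idB morB morA by (simp add: hom_def)
  next
    fix f g assume "f \<in> Mor A" "g \<in> Mor A" "Dom A g = Cod A f"
    then show "restrict \<phi> (Mor A) (Comp A g f) = Comp B (restrict \<phi> (Mor A) g) (restrict \<phi> (Mor A) f)"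
      using phi_comp compA by simp
  qed
  then show ?thesis using cs by (auto simp: small_functor_def mk_def A_def B_def)
qed

lemma act_mk [simp]: "f \<in> Ar (view P) \<Longrightarrow> act (mk P Q \<phi>) f = \<phi> f"
  by (simp add: act_def mk_def view_def)

lemma mk_hom:
  assumes P: "P \<in> Obj K" and Q: "Q \<in> Obj K" and \<phi>: "omor (view P) (view Q) \<phi>"
  shows "mk P Q \<phi> \<in> hom K P Q"
proof -
  define f where "f = fst (snd (mk P Q \<phi>))"
  have f: "small_functor f" "src f = src P" "tgt f = src Q"
    using mk_small_functor[OF P Q \<phi>] by (auto simp: f_def mk_def)
  have PQ: "small_functor P" "small_functor Q" "tgt P = C" "tgt Q = C" using P Q by (auto simp: Obj_K)
  let ?c = "Comp Cat Q f"
  have sc: "src ?c = src P" "tgt ?c = C" using f PQ by (simp_all add: Cat_def)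
  have fn: "is_functor (src P) (src Q) (omap f) (amap f)" "is_functor (src Q) C (omap Q) (amap Q)"
    using f PQ by (auto simp: small_functor_def)
  have "is_functor (src P) C (omap ?c) (amap ?c)"
  proof -
    have A: "category (src P)" using PQ by (auto simp: small_functor_def small_category_def)
    show ?thesis using fn A unfolding is_functor_def category_def
      by (auto simp: Cat_def f hom_def compose_eq)
  qed
  then have "small_functor ?c"
    using PQ sc f by (auto simp: small_functor_def) (auto simp: Cat_def)
  then have "?c = P"
  proof (rule small_functor_eqI)
    fix m assume "m \<in> Mor (src ?c)"
    then have m: "m \<in> Mor (src P)" by (simp add: sc)
    then have "amap Q (\<phi> m) = amap P m" using omorD(4)[OF \<phi>, of m] by (simp add: view_def)
    then show "amap ?c m = amap P m" using m f by (simp add: Cat_def compose_eq) (simp add: f_def mk_def)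
  qed (use PQ sc in auto)
  moreover have "mk P Q \<phi> = (P, f, Q)" by (simp add: f_def mk_def)
  ultimately show ?thesis using P Q f by (auto simp: hom_K)
qed

lemma act_in: "F \<in> hom K P Q \<Longrightarrow> f \<in> Ar (view P) \<Longrightarrow> act F f \<in> Ar (view Q)"
  using act_omor omorD(1) by metis

lemma Comp_K:
  assumes F: "F \<in> hom K P Q" and G: "G \<in> hom K Q R"
  shows "Comp K G F \<in> hom K P R" "\<And>f. f \<in> Ar (view P) \<Longrightarrow> act (Comp K G F) f = act G (act F f)"
proof -
  note PQR = homD[OF F] homD[OF G]
  from F obtain f where f: "F = (P, f, Q)" "small_functor f" "src f = src P" "tgt f = src Q"
    by (auto simp: hom_K)
  from G obtain g where g: "G = (Q, g, R)" "small_functor g" "src g = src Q" "tgt g = src R"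
    by (auto simp: hom_K)
  have c: "Comp K G F = (P, Comp Cat g f, R)" by (simp add: f g slice_def)
  show a: "act (Comp K G F) m = act G (act F m)" if "m \<in> Ar (view P)" for m
    unfolding c using that f g by (simp add: act_def Cat_def view_def compose_eq)
  have om: "omor (view P) (view R) (\<lambda>m. act G (act F m))"
    using omor_compose[OF over_view[OF PQR(1)]] act_omor[OF F] act_omor[OF G] by blast
  \<comment> \<open>The composite is identified with a morphism made by \<open>mk\<close>, whose
    membership in the hom-set is already known; only the object maps remain to be compared.\<close>
  have h: "mk P R (\<lambda>m. act G (act F m)) \<in> hom K P R" using mk_hom[OF PQR(1,4) om] .
  have "fst (snd (mk P R (\<lambda>m. act G (act F m)))) = Comp Cat g f"
  proof -
    have "is_functor (src P) (src Q) (omap f) (amap f)" "is_functor (src Q) (src R) (omap g) (amap g)"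
      using f g by (auto simp: small_functor_def)
    moreover have "category (src R)" "category (src P)"
      using PQR by (auto simp: Obj_K small_functor_def small_category_def)
    ultimately have "Dom (src R) (amap g (amap f (Ident (src P) x))) = omap g (omap f x)"
      if "x \<in> Obj (src P)" for x
      using that by (auto simp: is_functor_def category_def hom_def)
    then show ?thesis using f g by (auto simp: mk_def Cat_def act_def compose_def)
  qed
  then have "mk P R (\<lambda>m. act G (act F m)) = Comp K G F" using c by (simp add: mk_def)
  then show "Comp K G F \<in> hom K P R" using h by simp
qed

lemma Ident_K:
  assumes P: "P \<in> Obj K"
  shows "Ident K P \<in> hom K P P" "\<And>f. f \<in> Ar (view P) \<Longrightarrow> act (Ident K P) f = f"
proof -
  have e: "Ident K P = (P, Ident Cat (src P), P)" by (simp add: slice_def Cat_def)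
  show "act (Ident K P) f = f" if "f \<in> Ar (view P)" for f
    unfolding e using that by (simp add: act_def Cat_def view_def)
  have "Ident K P = mk P P (\<lambda>f. f)"
  proof -
    have "category (src P)" using P by (auto simp: Obj_K small_functor_def small_category_def)
    then show ?thesis unfolding e by (auto simp: mk_def Cat_def category_def hom_def fun_eq_iff)
  qed
  then show "Ident K P \<in> hom K P P" using mk_hom[OF P P omor_id] by simp
qed

lemma Dom_K [simp]: "F \<in> Mor K \<Longrightarrow> Dom K F \<in> Obj K" and Cod_K [simp]: "F \<in> Mor K \<Longrightarrow> Cod K F \<in> Obj K"
  using Mor_hom homD by blast+

lemma category_K: "category K"
  unfolding category_def
proof (intro conjI ballI impI)
  fix F assume F: "F \<in> Mor K"
  note h = Mor_hom[OF F] and id = Ident_K[OF Dom_K[OF F]] Ident_K[OF Cod_K[OF F]]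
  show "Dom K F \<in> Obj K" "Cod K F \<in> Obj K" using F by simp_all
  show "Comp K F (Ident K (Dom K F)) = F"
    using Comp_K[OF id(1) h] id(2) by (intro hom_eqI[OF _ h]) auto
  show "Comp K (Ident K (Cod K F)) F = F"
    using Comp_K[OF h id(3)] id(4) act_in[OF h] by (intro hom_eqI[OF _ h]) auto
  fix G assume G: "G \<in> Mor K" and GF: "Dom K G = Cod K F"
  have g: "G \<in> hom K (Cod K F) (Cod K G)" using Mor_hom[OF G] GF by simp
  show "Comp K G F \<in> hom K (Dom K F) (Cod K G)" by (rule Comp_K(1)[OF h g])
  fix H assume H: "H \<in> Mor K" and HG: "Dom K H = Cod K G"
  have hh: "H \<in> hom K (Cod K G) (Cod K H)" using Mor_hom[OF H] HG by simp
  note gf = Comp_K[OF h g] and hg = Comp_K[OF g hh]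
  note l = Comp_K[OF gf(1) hh] and r = Comp_K[OF h hg(1)]
  show "Comp K H (Comp K G F) = Comp K (Comp K H G) F"
    using l(2) r(2) gf(2) hg(2) act_in[OF h] by (intro hom_eqI[OF l(1) r(1)]) auto
qed (use Ident_K in auto)

lemma small_hom: "sml (hom K P Q)"
proof (cases "P \<in> Obj K \<and> Q \<in> Obj K")
  case True
  let ?f = "\<lambda>F. restrict (act F) (Ar (view P))"
  have "inj_on ?f (hom K P Q)"
    by (rule inj_onI) (metis hom_eqI restrict_apply')
  moreover have "?f ` hom K P Q \<subseteq> (Ar (view P) \<rightarrow>\<^sub>E Ar (view Q))" using act_in by auto
  moreover have "sml (Ar (view P) \<rightarrow>\<^sub>E Ar (view Q))" using True small_view by (intro small_PiE) auto
  ultimately show ?thesis by (rule small_inj)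
next
  case False
  then have "hom K P Q = {}" by (auto simp: hom_K)
  then show ?thesis by (simp add: small_finite)
qed

text \<open>The gateway into \<open>K\<close> for everything built on an auxiliary type: the
  structure is copied along an injection into \<open>'u\<close>. The sets of arrows and objects of
  the copy are recorded because later copies must lie inside a prescribed set
  \<open>B\<close>.\<close>

lemma realise:
  fixes X :: "('m, 'u) overcat" and \<iota> :: "'m \<Rightarrow> 'u"
  assumes X: "over C X" and sX: "sml (Ar X)" and inj: "inj_on \<iota> (Ar X)"
  obtains P where "P \<in> Obj K" "Mor (src P) = \<iota> ` Ar X" "Obj (src P) \<subseteq> \<iota> ` Ar X"
    "omor X (view P) \<iota>" "bij_betw \<iota> (Ar X) (Ar (view P))"
proof -
  let ?j = "inv_into (Ar X) \<iota>"
  have j: "?j (\<iota> f) = f" if "f \<in> Ar X" for f using inj that by simp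
  \<comment> \<open>The objects are the codes of the identities, hence \<open>Ident\<close> is the
    identity function on them.\<close>
  define A where "A = \<lparr>Obj = \<iota> ` dm X ` Ar X, Mor = \<iota> ` Ar X,
    Dom = restrict (\<lambda>f. \<iota> (dm X (?j f))) (\<iota> ` Ar X), Cod = restrict (\<lambda>f. \<iota> (cd X (?j f))) (\<iota> ` Ar X),
    Ident = restrict id (\<iota> ` dm X ` Ar X),
    Comp = (\<lambda>g f. if f \<in> \<iota> ` Ar X \<and> g \<in> \<iota> ` Ar X \<and> dm X (?j g) = cd X (?j f)
       then \<iota> (cm X (?j g) (?j f)) else undefined)\<rparr>"
  define P where "P = \<lparr>src = A, tgt = C,
    omap = restrict (\<lambda>x. Dom C (pr X (?j x))) (Obj A), amap = restrict (\<lambda>f. pr X (?j f)) (Mor A)\<rparr>"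
  note o = overD[OF X] and oc = over_compD[OF X]
  have inj': "\<iota> f = \<iota> g \<longleftrightarrow> f = g" if "f \<in> Ar X" "g \<in> Ar X" for f g using inj that by (meson inj_on_eq_iff)
  have dmdm: "dm X ` Ar X \<subseteq> Ar X" using o by auto
  have cd_dm: "cd X f \<in> dm X ` Ar X" if "f \<in> Ar X" for f using o(5,2)[OF that] by (metis imageI)
  have Obj_A: "Obj A = \<iota> ` dm X ` Ar X" and Mor_A: "Mor A = \<iota> ` Ar X" by (simp_all add: A_def)
  have Dom_A: "Dom A (\<iota> f) = \<iota> (dm X f)" and Cod_A: "Cod A (\<iota> f) = \<iota> (cd X f)" if "f \<in> Ar X" for f
    using that j by (simp_all add: A_def)
  have Id_A: "Ident A (\<iota> (dm X f)) = \<iota> (dm X f)" "Ident A (\<iota> (cd X f)) = \<iota> (cd X f)" if "f \<in> Ar X" for f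
    using that cd_dm by (simp_all add: A_def)
  have Comp_A: "Comp A (\<iota> g) (\<iota> f) = \<iota> (cm X g f)" if "f \<in> Ar X" "g \<in> Ar X" "dm X g = cd X f" for f g
    using that j by (simp add: A_def)
  have "category A"
    unfolding category_def hom_def Obj_A Mor_A
    by (auto simp: Dom_A Cod_A Id_A Comp_A inj' o oc cd_dm over_assoc[OF X])
  then have sA: "small_category A"
    unfolding small_category_def using sX
    by (auto simp: A_def small_TYPE small_image inj' o j image_comp)
  have amap_P: "amap P (\<iota> f) = pr X f" if "f \<in> Ar X" for f using that j by (simp add: P_def Mor_A)
  have omap_P: "omap P (\<iota> (dm X f)) = Dom C (pr X f)" "omap P (\<iota> (cd X f)) = Cod C (pr X f)" if "f \<in> Ar X" for f
    using that j cd_dm o by (simp_all add: P_def Obj_A)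
  have "is_functor A C (omap P) (amap P)"
    unfolding is_functor_def hom_def Obj_A Mor_A
    by (auto simp: Dom_A Cod_A Id_A Comp_A inj' o oc cd_dm amap_P omap_P)
  then have P: "P \<in> Obj K" unfolding Obj_K small_functor_def using sA C by (simp add: P_def)
  have sP: "src P = A" by (simp add: P_def)
  have "omor X (view P) \<iota>"
    unfolding omor_def view_def using o oc
    by (auto simp: sP Mor_A Dom_A Cod_A Id_A Comp_A inj' amap_P)
  moreover have "bij_betw \<iota> (Ar X) (Ar (view P))" using inj by (simp add: bij_betw_def view_def sP Mor_A)
  moreover have "Obj (src P) \<subseteq> \<iota> ` Ar X" using dmdm by (auto simp: sP Obj_A)
  ultimately show thesis using that P by (simp add: sP Mor_A)
qed

end

section \<open>Products, subcategories and limits\<close>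

definition closed :: "('m, 'c) overcat \<Rightarrow> 'm set \<Rightarrow> bool" where
  "closed X N \<longleftrightarrow> N \<subseteq> Ar X \<and> (\<forall>f \<in> N. dm X f \<in> N \<and> cd X f \<in> N) \<and>
     (\<forall>f \<in> N. \<forall>g \<in> N. dm X g = cd X f \<longrightarrow> cm X g f \<in> N)"

lemma closedD:
  assumes "closed X N"
  shows "N \<subseteq> Ar X" "f \<in> N \<Longrightarrow> dm X f \<in> N" "f \<in> N \<Longrightarrow> cd X f \<in> N"
    "f \<in> N \<Longrightarrow> g \<in> N \<Longrightarrow> dm X g = cd X f \<Longrightarrow> cm X g f \<in> N"
  using assms by (auto simp: closed_def)

lemma over_restrict:
  assumes X: "over C X" and N: "closed X N"
  shows "over C (X\<lparr>Ar := N\<rparr>)"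
proof -
  have sub: "f \<in> Ar X" if "f \<in> N" for f using N that by (auto simp: closed_def)
  then show ?thesis
    unfolding over_def using closedD[OF N] overD[OF X] over_compD[OF X] over_assoc[OF X]
    by (auto dest!: sub)
qed

lemma omor_restrict_inclusion: "closed X N \<Longrightarrow> omor (X\<lparr>Ar := N\<rparr>) X (\<lambda>f. f)"
  by (auto simp: omor_def closed_def)

lemma omor_into_restrict:
  assumes "omor Y X \<phi>" "\<phi> ` Ar Y \<subseteq> N"
  shows "omor Y (X\<lparr>Ar := N\<rparr>) \<phi>"
  using assms by (auto simp: omor_def)

text \<open>Stated for a family of pairs, so that one application cuts out the limit of a whole
  diagram; a single pair is the case of a one-element index type.\<close>

lemma closed_equaliser:
  assumes X: "over C X"
    and f: "\<And>t. t \<in> T \<Longrightarrow> omor X (Y t) (f t)" and g: "\<And>t. t \<in> T \<Longrightarrow> omor X (Y t) (g t)"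
  shows "closed X {x \<in> Ar X. \<forall>t\<in>T. f t x = g t x}"
  unfolding closed_def using overD[OF X] over_compD[OF X] omorD(2,3)[OF f] omorD(2,3)[OF g]
    omor_comp[OF f] omor_comp[OF g]
  by auto

text \<open>Injectivity is essential: in general the images of two arrows can be composable although
  the arrows are not, and the image is then not closed under composition.\<close>

lemma closed_image:
  assumes X: "over C X" and \<phi>: "omor X Y \<phi>" and inj: "inj_on \<phi> (Ar X)"
  shows "closed Y (\<phi> ` Ar X)"
  unfolding closed_def
proof (intro conjI ballI impI)
  show "\<phi> ` Ar X \<subseteq> Ar Y" using omorD(1)[OF \<phi>] by auto
next
  fix f assume "f \<in> \<phi> ` Ar X"
  then show "dm Y f \<in> \<phi> ` Ar X" "cd Y f \<in> \<phi> ` Ar X"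
    using omorD(2,3)[OF \<phi>] overD(1,2)[OF X] by (auto simp: image_iff) metis+
next
  fix f g assume "f \<in> \<phi> ` Ar X" "g \<in> \<phi> ` Ar X" and e: "dm Y g = cd Y f"
  then obtain x y where xy: "x \<in> Ar X" "y \<in> Ar X" "f = \<phi> x" "g = \<phi> y" by auto
  then have "\<phi> (dm X y) = \<phi> (cd X x)" using e omorD(2,3)[OF \<phi>] by simp
  then have "dm X y = cd X x" using inj xy overD(1,2)[OF X] by (auto dest: inj_onD)
  then show "cm Y g f \<in> \<phi> ` Ar X"
    using xy omor_comp[OF \<phi>] over_compD(1)[OF X] by (auto simp: image_iff) metis
qed

text \<open>Products in the slice are fibre products over the base. The base component is kept
  separately so that the empty product is the base itself, the terminal object.\<close>

definition over_prod :: "('o, 'c) cat \<Rightarrow> 'i set \<Rightarrow> ('i \<Rightarrow> ('m, 'c) overcat) \<Rightarrow> ('c \<times> ('i \<Rightarrow> 'm), 'c) overcat" where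
  "over_prod C I X = \<lparr>Ar = {(m, \<phi>). m \<in> Mor C \<and> \<phi> \<in> PiE I (\<lambda>i. Ar (X i)) \<and> (\<forall>i\<in>I. pr (X i) (\<phi> i) = m)},
     dm = (\<lambda>(m, \<phi>). (Ident C (Dom C m), \<lambda>i\<in>I. dm (X i) (\<phi> i))),
     cd = (\<lambda>(m, \<phi>). (Ident C (Cod C m), \<lambda>i\<in>I. cd (X i) (\<phi> i))),
     cm = (\<lambda>(m, \<phi>) (n, \<psi>). (Comp C m n, \<lambda>i\<in>I. cm (X i) (\<phi> i) (\<psi> i))),
     pr = fst\<rparr>"

section \<open>Limits in the slice category\<close>

context small_base
begin

abbreviation M where "M P \<equiv> Ar (view P)"

lemma over_over_prod:
  assumes X: "\<And>i. i \<in> I \<Longrightarrow> over C (X i)"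
  shows "over C (over_prod C I X)"
proof -
  note o = overD[OF X] and oc = over_compD[OF X]
  have ext: "(\<lambda>i\<in>I. f i) = \<phi> \<longleftrightarrow> (\<forall>i\<in>I. f i = \<phi> i)" if "\<phi> \<in> extensional I" for f \<phi>
    using that by (auto simp: fun_eq_iff extensional_def)
  have rest: "(\<lambda>i\<in>I. f i) = (\<lambda>i\<in>I. g i) \<longleftrightarrow> (\<forall>i\<in>I. f i = g i)" for f g :: "'a \<Rightarrow> 'b"
    by (auto simp: fun_eq_iff)
  have id: "Ident C x = Ident C y \<longleftrightarrow> x = y" if "x \<in> Obj C" "y \<in> Obj C" for x y
    using that C_Ident(2) by metis
  show ?thesis
    unfolding over_def over_prod_def
    by (auto simp: PiE_iff o oc rest ext id C_assoc over_assoc[OF X])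
qed

text \<open>The uniqueness half of the universal property is replaced by joint injectivity of the
  projections on arrows, the form that pointwise arguments need. Equality of base components is
  demanded as well to cover the empty product.\<close>

definition product_cone where
  "product_cone I D Z \<pi> \<longleftrightarrow> Z \<in> Obj K \<and> (\<forall>i\<in>I. \<pi> i \<in> hom K Z (D i)) \<and>
     (\<forall>Y F. Y \<in> Obj K \<longrightarrow> (\<forall>i\<in>I. F i \<in> hom K Y (D i)) \<longrightarrow>
       (\<exists>G \<in> hom K Y Z. \<forall>i\<in>I. Comp K (\<pi> i) G = F i)) \<and>
     (\<forall>x \<in> M Z. \<forall>y \<in> M Z. pr (view Z) x = pr (view Z) y \<longrightarrow>
       (\<forall>i\<in>I. act (\<pi> i) x = act (\<pi> i) y) \<longrightarrow> x = y)"

lemma product_coneD: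
  assumes "product_cone I D Z \<pi>"
  shows "Z \<in> Obj K" "\<And>i. i \<in> I \<Longrightarrow> \<pi> i \<in> hom K Z (D i)"
    "\<And>Y F. Y \<in> Obj K \<Longrightarrow> (\<And>i. i \<in> I \<Longrightarrow> F i \<in> hom K Y (D i)) \<Longrightarrow>
       \<exists>G \<in> hom K Y Z. \<forall>i\<in>I. Comp K (\<pi> i) G = F i"
    "\<And>x y. x \<in> M Z \<Longrightarrow> y \<in> M Z \<Longrightarrow> pr (view Z) x = pr (view Z) y \<Longrightarrow>
       (\<And>i. i \<in> I \<Longrightarrow> act (\<pi> i) x = act (\<pi> i) y) \<Longrightarrow> x = y"
  using assms unfolding product_cone_def by blast+

lemma realise_sub:
  assumes P: "P \<in> Obj K" and N: "closed (view P) N" and inj: "inj_on (\<iota> :: 'u \<Rightarrow> 'u) N"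
  obtains S i where "i \<in> hom K S P" "inj_on (act i) (M S)" "act i ` M S = N"
    "Mor (src S) \<subseteq> \<iota> ` N" "Obj (src S) \<subseteq> \<iota> ` N"
proof -
  let ?X = "view P\<lparr>Ar := N\<rparr>"
  have X: "over C ?X" by (rule over_restrict[OF over_view[OF P] N])
  have "N \<subseteq> M P" using N by (simp add: closed_def)
  then have sN: "sml (Ar ?X)" using small_subset[OF _ small_view[OF P]] by simp
  from inj have inj': "inj_on \<iota> (Ar ?X)" by simp
  obtain S where S: "S \<in> Obj K" "Mor (src S) = \<iota> ` Ar ?X" "Obj (src S) \<subseteq> \<iota> ` Ar ?X"
    "omor ?X (view S) \<iota>" "bij_betw \<iota> (Ar ?X) (M S)"
    by (rule realise[OF X sN inj'])
  let ?j = "inv_into N \<iota>"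
  have j: "omor (view S) ?X ?j" using omor_inverse[OF X S(4,5)] by simp
  have b: "bij_betw ?j (M S) N" using bij_betw_inv_into[OF S(5)] by simp
  have om: "omor (view S) (view P) ?j"
    using omor_compose[OF over_view[OF S(1)] j omor_restrict_inclusion[OF N]] by simp
  let ?i = "mk S P ?j"
  show thesis
  proof
    show "?i \<in> hom K S P" by (rule mk_hom[OF S(1) P om])
    show "inj_on (act ?i) (M S)" using b by (auto simp: bij_betw_def inj_on_def)
    show "act ?i ` M S = N" using b by (auto simp: bij_betw_def)
  qed (use S in auto)
qed

lemma sub_exists:
  assumes "P \<in> Obj K" "closed (view P) N"
  obtains S i where "i \<in> hom K S P" "inj_on (act i) (M S)" "act i ` M S = N"
  by (rule realise_sub[OF assms inj_on_id]) (rule that)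

text \<open>A functor injective on arrows is an isomorphism onto its image, so a functor landing in
  the image can be composed with the inverse.\<close>

lemma factor_through_sub:
  assumes i: "i \<in> hom K S P" "inj_on (act i) (M S)" and F: "F \<in> hom K Q P"
    and im: "act F ` M Q \<subseteq> act i ` M S"
  obtains G where "G \<in> hom K Q S" "Comp K i G = F" 
proof -
  note ob = homD[OF i(1)] homD[OF F]
  let ?N = "act i ` M S"
  have N: "closed (view P) ?N" by (rule closed_image[OF over_view[OF ob(1)] act_omor[OF i(1)] i(2)])
  have 1: "omor (view S) (view P\<lparr>Ar := ?N\<rparr>) (act i)"
    by (rule omor_into_restrict[OF act_omor[OF i(1)]]) simp
  have 2: "bij_betw (act i) (M S) (Ar (view P\<lparr>Ar := ?N\<rparr>))" using i(2) by (simp add: bij_betw_def)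
  let ?j = "inv_into (M S) (act i)"
  have 3: "omor (view P\<lparr>Ar := ?N\<rparr>) (view S) ?j" by (rule omor_inverse[OF over_view[OF ob(1)] 1 2])
  have 4: "omor (view Q) (view S) (\<lambda>f. ?j (act F f))"
    by (rule omor_compose[OF over_view[OF ob(3)] omor_into_restrict[OF act_omor[OF F] im] 3])
  let ?G = "mk Q S (\<lambda>f. ?j (act F f))"
  have G: "?G \<in> hom K Q S" by (rule mk_hom[OF ob(3,1) 4])
  moreover have "Comp K i ?G = F"
  proof (rule hom_eqI[OF Comp_K(1)[OF G i(1)] F])
    fix m assume "m \<in> M Q"
    then show "act (Comp K i ?G) m = act F m"
      using Comp_K(2)[OF G i(1)] im by (auto simp: f_inv_into_f)
  qed
  ultimately show thesis by (rule that)
qed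

lemma products:
  assumes I: "sml I" and D: "\<And>i. i \<in> I \<Longrightarrow> D i \<in> Obj K"
  shows "\<exists>Z \<pi>. product_cone I D Z \<pi>"
proof -
  let ?X = "over_prod C I (\<lambda>i. view (D i))"
  have X: "over C ?X" using D over_view by (intro over_over_prod) auto
  have "sml (Mor C \<times> PiE I (\<lambda>i. M (D i)))" by (intro small_Times small_C small_PiE I small_view D)
  moreover have "Ar ?X \<subseteq> Mor C \<times> PiE I (\<lambda>i. M (D i))" by (auto simp: over_prod_def)
  ultimately have sX: "sml (Ar ?X)" by (meson small_subset)
  obtain \<iota> :: "'u \<times> ('a \<Rightarrow> 'u) \<Rightarrow> 'u" where inj: "inj_on \<iota> (Ar ?X)" using sX by (rule small_embed)
  obtain Z where Z: "Z \<in> Obj K" "omor ?X (view Z) \<iota>" "bij_betw \<iota> (Ar ?X) (M Z)"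
    by (rule realise[OF X sX inj])
  let ?j = "inv_into (Ar ?X) \<iota>"
  have j: "omor (view Z) ?X ?j" by (rule omor_inverse[OF X Z(2,3)])
  have bj: "bij_betw ?j (M Z) (Ar ?X)" by (rule bij_betw_inv_into[OF Z(3)])
  have p: "omor ?X (view (D i)) (\<lambda>(m, \<phi>). \<phi> i)" if "i \<in> I" for i
    using that by (auto simp: omor_def over_prod_def PiE_mem)
  have pj: "omor (view Z) (view (D i)) (\<lambda>x. snd (?j x) i)" if "i \<in> I" for i
    using omor_compose[OF over_view[OF Z(1)] j p[OF that]] by (simp add: case_prod_beta)
  define \<pi> where "\<pi> i = mk Z (D i) (\<lambda>x. snd (?j x) i)" for i
  have \<pi>: "\<pi> i \<in> hom K Z (D i)" if "i \<in> I" for i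
    unfolding \<pi>_def by (rule mk_hom[OF Z(1) D[OF that] pj[OF that]])
  have act_\<pi>: "act (\<pi> i) x = snd (?j x) i" if "x \<in> M Z" for i x
    unfolding \<pi>_def using that by simp
  have "product_cone I D Z \<pi>"
    unfolding product_cone_def
  proof (intro conjI allI impI ballI Z(1) \<pi>)
    fix Y F assume Y: "Y \<in> Obj K" and "\<forall>i\<in>I. F i \<in> hom K Y (D i)"
    then have F: "\<And>i. i \<in> I \<Longrightarrow> F i \<in> hom K Y (D i)" by blast
    let ?g = "\<lambda>y. (pr (view Y) y, \<lambda>i\<in>I. act (F i) y)"
    note Fo = omorD[OF act_omor[OF F]] and Fc = omor_comp[OF act_omor[OF F]]
    have g: "omor (view Y) ?X ?g"
      unfolding omor_def
      using Fo Fc overD[OF over_view[OF Y]] over_compD[OF over_view[OF Y]]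
      by (auto simp: over_prod_def fun_eq_iff)
    have \<iota>g: "omor (view Y) (view Z) (\<lambda>y. \<iota> (?g y))" by (rule omor_compose[OF over_view[OF Y] g Z(2)])
    let ?G = "mk Y Z (\<lambda>y. \<iota> (?g y))"
    have G: "?G \<in> hom K Y Z" by (rule mk_hom[OF Y Z(1) \<iota>g])
    moreover have "Comp K (\<pi> i) ?G = F i" if i: "i \<in> I" for i
    proof (rule hom_eqI[OF Comp_K(1)[OF G \<pi>[OF i]] F[OF i]])
      fix y assume y: "y \<in> M Y"
      have "?j (\<iota> (?g y)) = ?g y" using omorD(1)[OF g y] inj by simp
      then show "act (Comp K (\<pi> i) ?G) y = act (F i) y"
        using Comp_K(2)[OF G \<pi>[OF i] y] y i act_\<pi>[OF omorD(1)[OF \<iota>g y]] by simp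
    qed
    ultimately show "\<exists>G \<in> hom K Y Z. \<forall>i\<in>I. Comp K (\<pi> i) G = F i" by blast
  next
    fix x y assume x: "x \<in> M Z" and y: "y \<in> M Z" and e: "pr (view Z) x = pr (view Z) y"
      and a: "\<forall>i\<in>I. act (\<pi> i) x = act (\<pi> i) y"
    have xx: "?j x \<in> Ar ?X" "?j y \<in> Ar ?X" using omorD(1)[OF j] x y by auto
    have "fst (?j x) = fst (?j y)" using omorD(4)[OF j] x y e by (simp add: over_prod_def)
    moreover have "snd (?j x) = snd (?j y)"
    proof (rule PiE_ext)
      show "snd (?j x) \<in> PiE I (\<lambda>i. M (D i))" "snd (?j y) \<in> PiE I (\<lambda>i. M (D i))"
        using xx by (auto simp: over_prod_def)
    qed (use a act_\<pi> x y in auto)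
    ultimately have "?j x = ?j y" by (rule prod_eqI)
    then show "x = y" using bj x y by (auto simp: bij_betw_def dest: inj_onD)
  qed
  then show ?thesis by blast
qed

text \<open>The limit is the subcategory of the product over all objects on which every arrow of the
  diagram is respected. As completeness is cocompleteness of \<open>op_cat K\<close>, the arrow
  \<open>Dm u\<close> runs from \<open>Do (Cod J u)\<close> to \<open>Do (Dom J u)\<close>.\<close>

lemma complete_K: "complete U K"
  unfolding complete_def cocomplete_def
proof (intro allI impI)
  fix J :: "('u, 'u) cat" and Do Dm
  assume *: "small_category J \<and> is_functor J (op_cat K) Do Dm"
  have sJ: "sml (Obj J)" using * by (auto simp: small_category_def small_TYPE)
  have J: "Dom J u \<in> Obj J" "Cod J u \<in> Obj J" if "u \<in> Mor J" for u
    using * that by (auto simp: small_category_def category_def)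
  have D: "Do j \<in> Obj K" if "j \<in> Obj J" for j using * that by (auto simp: is_functor_def op_cat_def)
  have Dm: "Dm u \<in> hom K (Do (Cod J u)) (Do (Dom J u))" if "u \<in> Mor J" for u
    using * that by (auto simp: is_functor_def op_cat_def hom_def)
  obtain Z \<pi> where "product_cone (Obj J) Do Z \<pi>" using products[OF sJ, of Do] D by blast
  note Z = product_coneD(1)[OF this] and \<pi> = product_coneD(2)[OF this]
    and univ = product_coneD(3)[OF this] and ext = product_coneD(4)[OF this]
  define N where "N = {x \<in> M Z. \<forall>u\<in>Mor J. act (Comp K (Dm u) (\<pi> (Cod J u))) x = act (\<pi> (Dom J u)) x}"
  have N: "closed (view Z) N"
    unfolding N_def
    by (rule closed_equaliser[OF over_view[OF Z], of _ "\<lambda>u. view (Do (Dom J u))"])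
      (use act_omor Comp_K(1) \<pi> Dm J in blast)+
  obtain S i where i: "i \<in> hom K S Z" "inj_on (act i) (M S)" "act i ` M S = N"
    by (rule sub_exists[OF Z N])
  define l where "l j = Comp K (\<pi> j) i" for j
  have l: "l j \<in> hom K S (Do j)" if "j \<in> Obj J" for j
    unfolding l_def by (rule Comp_K(1)[OF i(1) \<pi>[OF that]])
  have act_l: "act (l j) x = act (\<pi> j) (act i x)" if "j \<in> Obj J" "x \<in> M S" for j x
    unfolding l_def by (rule Comp_K(2)[OF i(1) \<pi>[OF that(1)] that(2)])
  have "Comp K (Dm u) (l (Cod J u)) = l (Dom J u)" if u: "u \<in> Mor J" for u
  proof (rule hom_eqI[OF Comp_K(1)[OF l[OF J(2)[OF u]] Dm[OF u]] l[OF J(1)[OF u]]])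
    fix x assume x: "x \<in> M S"
    then have "act i x \<in> N" using i(3) by blast
    then have "act (Comp K (Dm u) (\<pi> (Cod J u))) (act i x) = act (\<pi> (Dom J u)) (act i x)" "act i x \<in> M Z"
      using u by (auto simp: N_def)
    then show "act (Comp K (Dm u) (l (Cod J u))) x = act (l (Dom J u)) x"
      using Comp_K(2)[OF l[OF J(2)[OF u]] Dm[OF u] x] act_l J[OF u] x
        Comp_K(2)[OF \<pi>[OF J(2)[OF u]] Dm[OF u]] by simp
  qed
  then have cone: "cocone J (op_cat K) Do Dm S l"
    using l homD[OF i(1)] by (auto simp: cocone_def op_cat_def hom_def)
  have "\<exists>!h. h \<in> hom (op_cat K) S Y \<and> (\<forall>j \<in> Obj J. Comp (op_cat K) h (l j) = m j)"
    if c: "cocone J (op_cat K) Do Dm Y m" for Y m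
  proof -
    have Y: "Y \<in> Obj K" and m: "m j \<in> hom K Y (Do j)" if "j \<in> Obj J" for j
      using c that by (auto simp: cocone_def op_cat_def hom_def)
    have Y: "Y \<in> Obj K" using c by (auto simp: cocone_def op_cat_def)
    have mm: "Comp K (Dm u) (m (Cod J u)) = m (Dom J u)" if "u \<in> Mor J" for u
      using c that by (auto simp: cocone_def op_cat_def)
    obtain G where G: "G \<in> hom K Y Z" "\<forall>j\<in>Obj J. Comp K (\<pi> j) G = m j" using univ[OF Y m] by blast
    have aG: "act (\<pi> j) (act G y) = act (m j) y" if "j \<in> Obj J" "y \<in> M Y" for j y
      using Comp_K(2)[OF G(1) \<pi>[OF that(1)] that(2)] G(2) that by simp
    have "act G y \<in> N" if y: "y \<in> M Y" for y
    proof -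
      have a: "act G y \<in> M Z" by (rule act_in[OF G(1) y])
      have "act (Comp K (Dm u) (\<pi> (Cod J u))) (act G y) = act (\<pi> (Dom J u)) (act G y)" if u: "u \<in> Mor J" for u
        using Comp_K(2)[OF \<pi>[OF J(2)[OF u]] Dm[OF u] a] Comp_K(2)[OF m[OF J(2)[OF u]] Dm[OF u] y]
          aG[OF J(1)[OF u] y] aG[OF J(2)[OF u] y] mm[OF u] by simp
      then show ?thesis using a by (simp add: N_def)
    qed
    then have "act G ` M Y \<subseteq> act i ` M S" using i(3) by blast
    then obtain h where h: "h \<in> hom K Y S" "Comp K i h = G"
      by (rule factor_through_sub[OF i(1,2) G(1)])
    have ah: "act i (act h y) = act G y" if "y \<in> M Y" for y
      using Comp_K(2)[OF h(1) i(1) that] h(2) by simp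
    show ?thesis
    proof (rule ex1I[of _ h])
      have "Comp K (l j) h = m j" if j: "j \<in> Obj J" for j
        using Comp_K[OF h(1) l[OF j]] act_l[OF j] act_in[OF h(1)] aG[OF j] ah
        by (intro hom_eqI[OF _ m[OF j]]) auto
      then show "h \<in> hom (op_cat K) S Y \<and> (\<forall>j \<in> Obj J. Comp (op_cat K) h (l j) = m j)"
        using h by (auto simp: op_cat_def hom_def)
    next
      fix k assume "k \<in> hom (op_cat K) S Y \<and> (\<forall>j \<in> Obj J. Comp (op_cat K) k (l j) = m j)"
      then have k: "k \<in> hom K Y S" "\<And>j. j \<in> Obj J \<Longrightarrow> Comp K (l j) k = m j"
        by (auto simp: op_cat_def hom_def)
      show "k = h"
      proof (rule hom_eqI[OF k(1) h(1)])
        fix y assume y: "y \<in> M Y"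
        have ky: "act k y \<in> M S" "act h y \<in> M S" using act_in k(1) h(1) y by auto
        have "act i (act k y) = act i (act h y)"
        proof (rule ext)
          show "act i (act k y) \<in> M Z" "act i (act h y) \<in> M Z" using act_in[OF i(1)] ky by auto
          show "pr (view Z) (act i (act k y)) = pr (view Z) (act i (act h y))"
            using omorD(4)[OF act_omor[OF i(1)]] ky omorD(4)[OF act_omor[OF h(1)] y]
              omorD(4)[OF act_omor[OF k(1)] y] by simp
          fix j assume j: "j \<in> Obj J"
          have "act (l j) (act k y) = act (m j) y" using Comp_K(2)[OF k(1) l[OF j] y] k(2)[OF j] by simp
          then show "act (\<pi> j) (act i (act k y)) = act (\<pi> j) (act i (act h y))"
            using act_l[OF j] ky aG[OF j y] ah[OF y] by simp
        qed
        then show "act k y = act h y" using i(2) ky by (auto dest: inj_onD)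
      qed
    qed
  qed
  then show "\<exists>x l. colimit_cocone J (op_cat K) Do Dm x l" using cone unfolding colimit_cocone_def by blast
qed

end

section \<open>Bounded subcategories and colimits\<close>

definition generated :: "('m, 'c) overcat \<Rightarrow> 'm set \<Rightarrow> 'm set" where
  "generated X A = \<Inter>{N. closed X N \<and> A \<subseteq> N}"

lemma closed_Ar:
  assumes "over C X"
  shows "closed X (Ar X)"
  unfolding closed_def using overD(1,2)[OF assms] over_compD(1)[OF assms] by simp

lemma closed_Inter:
  assumes "\<And>N. N \<in> \<N> \<Longrightarrow> closed X N" "\<N> \<noteq> {}"
  shows "closed X (\<Inter>\<N>)"
proof -
  obtain N where "N \<in> \<N>" using assms(2) by blast
  then have "\<Inter>\<N> \<subseteq> Ar X" using closedD(1)[OF assms(1)] by blast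
  then show ?thesis unfolding closed_def using closedD(2-)[OF assms(1)] by simp
qed

lemma generated:
  assumes "over C X" "A \<subseteq> Ar X"
  shows "closed X (generated X A)" "A \<subseteq> generated X A"
    "closed X N \<Longrightarrow> A \<subseteq> N \<Longrightarrow> generated X A \<subseteq> N"
proof -
  have "Ar X \<in> {N. closed X N \<and> A \<subseteq> N}" using assms closed_Ar by auto
  then have "{N. closed X N \<and> A \<subseteq> N} \<noteq> {}" by blast
  then show "closed X (generated X A)" unfolding generated_def by (intro closed_Inter) auto
qed (auto simp: generated_def)

lemma bounded_closed:
  assumes X: "over C X" and B: "infinite B" and A: "A \<subseteq> Ar X" "|A| \<le>o |B|"
  obtains N where "closed X N" "A \<subseteq> N" "|N| \<le>o |B|"
proof -
  \<comment> \<open>Domains, codomains and composites are packed into one binary operation, to suit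
    \<open>bounded_closure\<close>.\<close>
  let ?G = "\<lambda>f g. {dm X f, cd X f} \<union> (if dm X g = cd X f then {cm X g f} else {})"
  have G: "?G f g \<subseteq> Ar X \<and> |?G f g| \<le>o |B|" if "f \<in> Ar X" "g \<in> Ar X" for f g
  proof
    show "?G f g \<subseteq> Ar X" using that overD(1,2)[OF X] over_compD(1)[OF X] by auto
    show "|?G f g| \<le>o |B|" by (rule bounded_finite[OF B]) simp
  qed
  obtain N where N: "A \<subseteq> N" "N \<subseteq> Ar X" "|N| \<le>o |B|" "\<And>f g. f \<in> N \<Longrightarrow> g \<in> N \<Longrightarrow> ?G f g \<subseteq> N"
    by (rule bounded_closure[OF B A, of ?G]) (use G in blast)+
  have "closed X N" unfolding closed_def
  proof (intro conjI ballI impI)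
    fix f assume f: "f \<in> N"
    show "dm X f \<in> N" "cd X f \<in> N" using N(4)[OF f f] by auto
    fix g assume g: "g \<in> N" "dm X g = cd X f"
    show "cm X g f \<in> N" using N(4)[OF f g(1)] g(2) by auto
  qed (rule N(2))
  then show thesis using N that by blast
qed

lemma bounded_generated:
  assumes X: "over C X" and B: "infinite B" and A: "A \<subseteq> Ar X" "|A| \<le>o |B|"
  shows "|generated X A| \<le>o |B|"
proof -
  obtain N where N: "closed X N" "A \<subseteq> N" "|N| \<le>o |B|" by (rule bounded_closed[OF assms])
  show ?thesis by (rule bounded_subset[OF generated(3)[OF X A(1) N(1,2)] N(3)])
qed

lemma extensional_graph_eq:
  assumes "f \<in> extensional A" "g \<in> extensional A" "(\<lambda>x. (x, f x)) ` A = (\<lambda>x. (x, g x)) ` A"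
  shows "f = g"
proof (rule extensionalityI[OF assms(1,2)])
  fix x assume "x \<in> A"
  then have "(x, f x) \<in> (\<lambda>x. (x, g x)) ` A" unfolding assms(3)[symmetric] by blast
  then show "f x = g x" by auto
qed

section \<open>Representatives of bounded objects, and colimits\<close>

context small_base
begin

lemma K_assoc:
  assumes "F \<in> hom K P Q" "G \<in> hom K Q R" "H \<in> hom K R T"
  shows "Comp K H (Comp K G F) = Comp K (Comp K H G) F"
  using assms category_K unfolding category_def by (auto simp: hom_def)

lemma K_unit: "F \<in> hom K P Q \<Longrightarrow> Comp K F (Ident K P) = F" "F \<in> hom K P Q \<Longrightarrow> Comp K (Ident K Q) F = F"
  using category_K unfolding category_def by (auto simp: hom_def)

lemma iso_of_bij:
  assumes i: "i \<in> hom K Q P" "bij_betw (act i) (M Q) (M P)"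
  obtains j where "j \<in> hom K P Q" "Comp K j i = Ident K Q" "Comp K i j = Ident K P"
proof -
  note PQ = homD[OF i(1)]
  have inj: "inj_on (act i) (M Q)" using i(2) by (simp add: bij_betw_def)
  have "act (Ident K P) ` M P \<subseteq> act i ` M Q" using i(2) Ident_K(2)[OF PQ(2)] by (auto simp: bij_betw_def)
  then obtain j where j: "j \<in> hom K P Q" "Comp K i j = Ident K P"
    by (rule factor_through_sub[OF i(1) inj Ident_K(1)[OF PQ(2)]])
  have "Comp K j i = Ident K Q"
  proof (rule hom_eqI[OF Comp_K(1)[OF i(1) j(1)] Ident_K(1)[OF PQ(1)]])
    fix x assume x: "x \<in> M Q"
    have a: "act i x \<in> M P" "act j (act i x) \<in> M Q" using act_in i(1) j(1) x by blast+
    have "act i (act j (act i x)) = act i x"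
      using Comp_K(2)[OF j(1) i(1) a(1)] j(2) Ident_K(2)[OF PQ(2) a(1)] by simp
    then have "act j (act i x) = x" using inj a(2) x by (auto dest: inj_onD)
    then show "act (Comp K j i) x = act (Ident K Q) x"
      using Comp_K(2)[OF i(1) j(1) x] Ident_K(2)[OF PQ(1) x] by simp
  qed
  then show thesis using j that by blast
qed

text \<open>The objects with at most |B| arrows do not form a small set, but these do, and each of
  the former is isomorphic to one of them by \<open>copy_carried_by\<close>.\<close>

definition carried_by :: "'u set \<Rightarrow> 'u cat_functor set" where
  "carried_by B = {P \<in> Obj K. Mor (src P) \<subseteq> B \<and> Obj (src P) \<subseteq> B}"

lemma carried_by_Obj: "P \<in> carried_by B \<Longrightarrow> P \<in> Obj K"
  by (simp add: carried_by_def)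

lemma carried_by_bounded: "P \<in> carried_by B \<Longrightarrow> |M P| \<le>o |B|"
  by (auto simp: carried_by_def view_def card_of_mono1)

text \<open>An object is determined by the graphs of its structure maps, thanks to their being
  undefined outside their domains; each graph is a subset of a small set made from \<open>B\<close>
  and \<open>C\<close>.\<close>

lemma small_carried_by:
  assumes B: "sml B"
  shows "sml (carried_by B)"
proof (rule small_inj)
  define comps where "comps A = {(g, f, Comp A g f) | g f. f \<in> Mor A \<and> g \<in> Mor A \<and> Dom A g = Cod A f}"
    for A :: "('u, 'u) cat"
  define code where "code P = (let A = src P in (Obj A, Mor A, (\<lambda>f. (f, Dom A f)) ` Mor A,
    (\<lambda>f. (f, Cod A f)) ` Mor A, (\<lambda>x. (x, Ident A x)) ` Obj A, comps A,
    (\<lambda>x. (x, omap P x)) ` Obj A, (\<lambda>f. (f, amap P f)) ` Mor A))" for P :: "'u cat_functor"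
  show "inj_on code (carried_by B)"
  proof (rule inj_onI)
    fix P Q assume P: "P \<in> carried_by B" and Q: "Q \<in> carried_by B" and e: "code P = code Q"
    have p: "small_category (src P)" "tgt P = C" "omap P \<in> extensional (Obj (src P))"
      "amap P \<in> extensional (Mor (src P))" using carried_by_Obj[OF P] by (auto simp: Obj_K small_functor_def)
    have q: "small_category (src Q)" "tgt Q = C" "omap Q \<in> extensional (Obj (src Q))"
      "amap Q \<in> extensional (Mor (src Q))" using carried_by_Obj[OF Q] by (auto simp: Obj_K small_functor_def)
    have O: "Obj (src P) = Obj (src Q)" and Mo: "Mor (src P) = Mor (src Q)"
      and cc: "comps (src P) = comps (src Q)"
      using e by (simp_all add: code_def Let_def)
    have D: "Dom (src P) = Dom (src Q)" and Co: "Cod (src P) = Cod (src Q)" 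
      and I: "Ident (src P) = Ident (src Q)"
      using e p(1) q(1) O Mo unfolding code_def Let_def small_category_def
      by (auto intro: extensional_graph_eq)
    have Cm: "Comp (src P) = Comp (src Q)"
    proof (intro ext)
      fix g f
      show "Comp (src P) g f = Comp (src Q) g f"
      proof (cases "f \<in> Mor (src P) \<and> g \<in> Mor (src P) \<and> Dom (src P) g = Cod (src P) f")
        case True
        then have "(g, f, Comp (src P) g f) \<in> comps (src P)" by (simp add: comps_def)
        then have "(g, f, Comp (src P) g f) \<in> comps (src Q)" by (simp add: cc)
        then show ?thesis by (auto simp: comps_def)
      next
        case False
        moreover from False have "\<not> (f \<in> Mor (src Q) \<and> g \<in> Mor (src Q) \<and> Dom (src Q) g = Cod (src Q) f)"
          by (simp add: Mo D Co)
        ultimately show ?thesis using p(1) q(1) unfolding small_category_def by simp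
      qed
    qed
    have s: "src P = src Q" using O Mo D Co I Cm by simp
    have "omap P = omap Q" "amap P = amap Q"
      using e p(3,4) q(3,4) s by (auto simp: code_def Let_def intro: extensional_graph_eq)
    then show "P = Q" using s p(2) q(2) by simp
  qed
  let ?T = "Pow B \<times> Pow B \<times> Pow (B \<times> B) \<times> Pow (B \<times> B) \<times> Pow (B \<times> B) \<times> Pow (B \<times> B \<times> B) \<times>
    Pow (B \<times> Obj C) \<times> Pow (B \<times> Mor C)"
  show "code ` carried_by B \<subseteq> ?T"
  proof
    fix c assume "c \<in> code ` carried_by B"
    then obtain P where P: "P \<in> carried_by B" and c: "c = code P" by blast
    define A where "A = src P"
    have "small_category A" "is_functor A C (omap P) (amap P)"
      using carried_by_Obj[OF P] by (auto simp: Obj_K small_functor_def A_def)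
    moreover have "Mor A \<subseteq> B" "Obj A \<subseteq> B" using P by (auto simp: carried_by_def A_def)
    ultimately show "c \<in> ?T"
      unfolding c code_def Let_def A_def[symmetric] comps_def small_category_def category_def is_functor_def hom_def
      by auto
  qed
  show "sml ?T" by (intro small_Times small_Pow B small_C)
qed

lemma sub_carried_by:
  assumes "P \<in> Obj K" "closed (view P) N" "|N| \<le>o |B :: 'u set|"
  obtains S i where "S \<in> carried_by B" "i \<in> hom K S P" "inj_on (act i) (M S)" "act i ` M S = N"
proof -
  obtain \<iota> :: "'u \<Rightarrow> 'u" where \<iota>: "inj_on \<iota> N" "\<iota> ` N \<subseteq> B" using assms(3) card_of_ordLeq[of N B] by blast
  obtain S i where Si: "i \<in> hom K S P" "inj_on (act i) (M S)" "act i ` M S = N"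
    "Mor (src S) \<subseteq> \<iota> ` N" "Obj (src S) \<subseteq> \<iota> ` N"
    by (rule realise_sub[OF assms(1,2) \<iota>(1)])
  then have "S \<in> carried_by B" using \<iota>(2) homD(1)[OF Si(1)] unfolding carried_by_def by blast
  then show thesis using that Si(1-3) by blast
qed

lemma copy_carried_by:
  assumes "P \<in> Obj K" "|M P| \<le>o |B :: 'u set|"
  obtains S i j where "S \<in> carried_by B" "i \<in> hom K S P" "j \<in> hom K P S"
    "Comp K j i = Ident K S" "Comp K i j = Ident K P"
proof -
  obtain S i where Si: "S \<in> carried_by B" "i \<in> hom K S P" "inj_on (act i) (M S)" "act i ` M S = M P"
    by (rule sub_carried_by[OF assms(1) closed_Ar[OF over_view[OF assms(1)]] assms(2)])
  then have "bij_betw (act i) (M S) (M P)" by (simp add: bij_betw_def)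
  then show thesis using iso_of_bij[OF Si(2)] that[OF Si(1,2)] by blast
qed

text \<open>The arrows on which \<open>F\<close> and \<open>G\<close> agree form a subcategory. Its
  image under the injective \<open>i\<close> is a subcategory containing \<open>A\<close>, hence
  everything that \<open>A\<close> generates.\<close>

lemma agree_on_generated:
  assumes i: "i \<in> hom K S P" "inj_on (act i) (M S)" "act i ` M S = generated (view P) A" and A: "A \<subseteq> M P"
    and F: "F \<in> hom K S Y" and G: "G \<in> hom K S Y"
    and eq: "\<And>x. x \<in> M S \<Longrightarrow> act i x \<in> A \<Longrightarrow> act F x = act G x"
  shows "F = G"
proof (rule hom_eqI[OF F G])
  fix x assume x: "x \<in> M S"
  note ob = homD[OF i(1)]
  let ?E = "{x \<in> M S. \<forall>t\<in>UNIV :: unit set. act F x = act G x}"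
  have E: "closed (view S) ?E"
    by (rule closed_equaliser[OF over_view[OF ob(1)]]) (rule act_omor[OF F] act_omor[OF G])+
  have "omor (view S\<lparr>Ar := ?E\<rparr>) (view P) (act i)"
    using omor_compose[OF over_restrict[OF over_view[OF ob(1)] E] omor_restrict_inclusion[OF E] act_omor[OF i(1)]] .
  moreover have "inj_on (act i) (Ar (view S\<lparr>Ar := ?E\<rparr>))" using i(2) by (auto simp: inj_on_def)
  ultimately have "closed (view P) (act i ` Ar (view S\<lparr>Ar := ?E\<rparr>))"
    by (rule closed_image[OF over_restrict[OF over_view[OF ob(1)] E]])
  moreover have "A \<subseteq> act i ` Ar (view S\<lparr>Ar := ?E\<rparr>)"
  proof
    fix a assume a: "a \<in> A"
    then have "a \<in> act i ` M S" using i(3) generated(2)[OF over_view[OF ob(2)] A] by auto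
    then obtain y where "y \<in> M S" "act i y = a" by blast
    then show "a \<in> act i ` Ar (view S\<lparr>Ar := ?E\<rparr>)" using eq a by auto
  qed
  ultimately have "act i ` M S \<subseteq> act i ` ?E"
    using generated(3)[OF over_view[OF ob(2)] A] i(3) by simp
  then have "act i x \<in> act i ` ?E" using x by blast
  then show "act F x = act G x" using i(2) x by (auto dest: inj_onD)
qed

lemma mono_of_inj:
  assumes i: "i \<in> hom K S P" "inj_on (act i) (M S)" and F: "F \<in> hom K Q S" and G: "G \<in> hom K Q S"
    and eq: "Comp K i F = Comp K i G"
  shows "F = G"
proof (rule hom_eqI[OF F G])
  fix m assume m: "m \<in> M Q"
  have "act i (act F m) = act i (act G m)"
    using Comp_K(2)[OF F i(1) m] Comp_K(2)[OF G i(1) m] eq by simp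
  then show "act F m = act G m" using i(2) act_in[OF F m] act_in[OF G m] by (auto dest: inj_onD)
qed

text \<open>Functors injective on arrows are monomorphisms, so the factored legs inherit the cocone
  equations from \<open>m\<close>.\<close>

lemma cocone_through_sub:
  assumes J: "small_category J" "is_functor J K Do Dm"
    and k: "k \<in> hom K V Y" "inj_on (act k) (M V)" and c: "cocone J K Do Dm Y m"
    and im: "\<And>j. j \<in> Obj J \<Longrightarrow> act (m j) ` M (Do j) \<subseteq> act k ` M V"
  obtains n where "cocone J K Do Dm V n" "\<And>j. j \<in> Obj J \<Longrightarrow> Comp K k (n j) = m j"
proof -
  have m: "m j \<in> hom K (Do j) Y" if "j \<in> Obj J" for j using c that by (simp add: cocone_def)
  have "\<exists>n \<in> hom K (Do j) V. Comp K k n = m j" if j: "j \<in> Obj J" for j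
    using factor_through_sub[OF k m[OF j] im[OF j]] by blast
  then obtain n where n: "\<And>j. j \<in> Obj J \<Longrightarrow> n j \<in> hom K (Do j) V"
    and kn: "\<And>j. j \<in> Obj J \<Longrightarrow> Comp K k (n j) = m j" by metis
  have "Comp K (n (Cod J u)) (Dm u) = n (Dom J u)" if u: "u \<in> Mor J" for u
  proof -
    have ob: "Dom J u \<in> Obj J" "Cod J u \<in> Obj J"
      using J(1) u unfolding small_category_def category_def by blast+
    have Dm: "Dm u \<in> hom K (Do (Dom J u)) (Do (Cod J u))" using J(2) u unfolding is_functor_def by blast
    show ?thesis
    proof (rule mono_of_inj[OF k Comp_K(1)[OF Dm n[OF ob(2)]] n[OF ob(1)]])
      show "Comp K k (Comp K (n (Cod J u)) (Dm u)) = Comp K k (n (Dom J u))"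
        using K_assoc[OF Dm n[OF ob(2)] k(1)] kn ob c u by (simp add: cocone_def)
    qed
  qed
  then have "cocone J K Do Dm V n" using n homD(1)[OF k(1)] by (simp add: cocone_def)
  then show thesis using that kn by blast
qed

text \<open>
  In the product of all cocones whose apex is carried by a fixed large enough set, the images of the
  diagram generate the colimit: the part of a cocone generated by the diagram is isomorphic to one of
  the factors.
\<close>

lemma cocomplete_K: "cocomplete U K"
  unfolding cocomplete_def
proof (intro allI impI)
  fix J :: "('u, 'u) cat" and Do Dm
  assume *: "small_category J \<and> is_functor J K Do Dm"
  have sJ: "sml (Obj J)" using * by (auto simp: small_category_def small_TYPE)
  have J: "Dom J u \<in> Obj J" "Cod J u \<in> Obj J" if "u \<in> Mor J" for u
    using * that by (auto simp: small_category_def category_def)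
  have D: "Do j \<in> Obj K" if "j \<in> Obj J" for j using * that by (auto simp: is_functor_def)
  have Dm: "Dm u \<in> hom K (Do (Dom J u)) (Do (Cod J u))" if "u \<in> Mor J" for u
    using * that by (auto simp: is_functor_def)
  have sD: "sml (\<Union>j\<in>Obj J. {j} \<times> M (Do j))"
    by (intro small_UN sJ small_Times small_finite small_view D) auto
  \<comment> \<open>\<open>B\<close> bounds the arrows of the whole diagram, and therefore the
    subcategory generated by their images under any cocone.\<close>
  obtain B :: "'u set" where B: "infinite B" "sml B" "|\<Union>j\<in>Obj J. {j} \<times> M (Do j)| \<le>o |B|"
    by (rule infinite_bound_exists[OF sD])
  \<comment> \<open>The families are extensional over \<open>Obj J\<close>, which makes
    \<open>T\<close> a subset of a small set.\<close>
  define T where "T = {(y, m). y \<in> carried_by B \<and> m \<in> PiE (Obj J) (\<lambda>j. hom K (Do j) y) \<and> cocone J K Do Dm y m}"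
  have "T \<subseteq> Sigma (carried_by B) (\<lambda>y. PiE (Obj J) (\<lambda>j. hom K (Do j) y))" by (auto simp: T_def)
  moreover have "sml (Sigma (carried_by B) (\<lambda>y. PiE (Obj J) (\<lambda>j. hom K (Do j) y)))"
    by (intro small_Sigma small_carried_by B(2) small_PiE sJ small_hom)
  ultimately have sT: "sml T" by (rule small_subset)
  have TO: "fst t \<in> Obj K" if "t \<in> T" for t using that carried_by_Obj by (auto simp: T_def)
  obtain Z \<pi> where "product_cone T fst Z \<pi>" using products[OF sT, of fst] TO by blast
  note Z = product_coneD(1)[OF this] and \<pi> = product_coneD(2)[OF this]
    and univ = product_coneD(3)[OF this] and zext = product_coneD(4)[OF this]
  have Tm: "snd t j \<in> hom K (Do j) (fst t)" if "t \<in> T" "j \<in> Obj J" for t j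
    using that by (auto simp: T_def)
  have "\<exists>G \<in> hom K (Do j) Z. \<forall>t\<in>T. Comp K (\<pi> t) G = snd t j" if "j \<in> Obj J" for j
    using univ[OF D[OF that], of "\<lambda>t. snd t j"] Tm that by blast
  then obtain G where G: "\<And>j. j \<in> Obj J \<Longrightarrow> G j \<in> hom K (Do j) Z"
    and \<pi>G: "\<And>j t. j \<in> Obj J \<Longrightarrow> t \<in> T \<Longrightarrow> Comp K (\<pi> t) (G j) = snd t j" by metis
  have a\<pi>G: "act (\<pi> t) (act (G j) x) = act (snd t j) x" if "j \<in> Obj J" "t \<in> T" "x \<in> M (Do j)" for j t x
    using Comp_K(2)[OF G[OF that(1)] \<pi>[OF that(2)] that(3)] \<pi>G[OF that(1,2)] by simp
  have Gcoc: "Comp K (G (Cod J u)) (Dm u) = G (Dom J u)" if u: "u \<in> Mor J" for u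
  proof (rule hom_eqI[OF Comp_K(1)[OF Dm[OF u] G[OF J(2)[OF u]]] G[OF J(1)[OF u]]])
    fix x assume x: "x \<in> M (Do (Dom J u))"
    note c = Comp_K[OF Dm[OF u] G[OF J(2)[OF u]]]
    have dx: "act (Dm u) x \<in> M (Do (Cod J u))" by (rule act_in[OF Dm[OF u] x])
    show "act (Comp K (G (Cod J u)) (Dm u)) x = act (G (Dom J u)) x"
    proof (rule zext)
      show "act (Comp K (G (Cod J u)) (Dm u)) x \<in> M Z" "act (G (Dom J u)) x \<in> M Z"
        using act_in[OF c(1) x] act_in[OF G[OF J(1)[OF u]] x] by auto
      show "pr (view Z) (act (Comp K (G (Cod J u)) (Dm u)) x) = pr (view Z) (act (G (Dom J u)) x)"
        using omorD(4)[OF act_omor[OF c(1)] x] omorD(4)[OF act_omor[OF G[OF J(1)[OF u]]] x] by simp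
      fix t assume t: "t \<in> T"
      have "Comp K (snd t (Cod J u)) (Dm u) = snd t (Dom J u)" using t u by (auto simp: T_def cocone_def)
      then have "act (snd t (Cod J u)) (act (Dm u) x) = act (snd t (Dom J u)) x"
        using Comp_K(2)[OF Dm[OF u] Tm[OF t J(2)[OF u]] x] by simp
      then show "act (\<pi> t) (act (Comp K (G (Cod J u)) (Dm u)) x) = act (\<pi> t) (act (G (Dom J u)) x)"
        using c(2)[OF x] a\<pi>G[OF J(2)[OF u] t dx] a\<pi>G[OF J(1)[OF u] t x] by simp
    qed
  qed
  define A where "A = (\<Union>j\<in>Obj J. act (G j) ` M (Do j))"
  have A: "A \<subseteq> M Z" using act_in[OF G] by (auto simp: A_def)
  note gen = generated[OF over_view[OF Z] A]
  obtain S i where i: "i \<in> hom K S Z" "inj_on (act i) (M S)" "act i ` M S = generated (view Z) A"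
    by (rule sub_exists[OF Z gen(1)])
  have Gc: "cocone J K Do Dm Z G" using G Gcoc Z by (simp add: cocone_def)
  have Gi: "act (G j) ` M (Do j) \<subseteq> act i ` M S" if j: "j \<in> Obj J" for j
  proof -
    have "act (G j) ` M (Do j) \<subseteq> A" using j by (auto simp: A_def)
    then show ?thesis using i(3) gen(2) by simp
  qed
  obtain l where cone: "cocone J K Do Dm S l" and il: "\<And>j. j \<in> Obj J \<Longrightarrow> Comp K i (l j) = G j"
    using cocone_through_sub[OF conjunct1[OF *] conjunct2[OF *] i(1,2) Gc Gi] by metis
  have l: "l j \<in> hom K (Do j) S" if "j \<in> Obj J" for j using cone that by (simp add: cocone_def)
  have ail: "act i (act (l j) x) = act (G j) x" if "j \<in> Obj J" "x \<in> M (Do j)" for j x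
    using Comp_K(2)[OF l[OF that(1)] i(1) that(2)] il[OF that(1)] by simp
  have "\<exists>!h. h \<in> hom K S Y \<and> (\<forall>j \<in> Obj J. Comp K h (l j) = m j)" if c: "cocone J K Do Dm Y m" for Y m
  proof -
    have Y: "Y \<in> Obj K" using c by (auto simp: cocone_def)
    have m: "m j \<in> hom K (Do j) Y" if "j \<in> Obj J" for j using c that by (auto simp: cocone_def)
    define A' where "A' = (\<Union>j\<in>Obj J. act (m j) ` M (Do j))"
    have A': "A' \<subseteq> M Y" using act_in[OF m] by (auto simp: A'_def)
    have "A' = (\<lambda>(j, x). act (m j) x) ` (\<Union>j\<in>Obj J. {j} \<times> M (Do j))" by (auto simp: A'_def image_iff)
    then have "|A'| \<le>o |B|" using bounded_image[OF B(3)] by simp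
    then have "|generated (view Y) A'| \<le>o |B|" by (rule bounded_generated[OF over_view[OF Y] B(1) A'])
    note gen' = generated[OF over_view[OF Y] A']
    obtain V k where k: "V \<in> carried_by B" "k \<in> hom K V Y" "inj_on (act k) (M V)" "act k ` M V = generated (view Y) A'"
      by (rule sub_carried_by[OF Y gen'(1) \<open>|generated (view Y) A'| \<le>o |B|\<close>])
    have mk: "act (m j) ` M (Do j) \<subseteq> act k ` M V" if j: "j \<in> Obj J" for j
    proof -
      have "act (m j) ` M (Do j) \<subseteq> A'" using j by (auto simp: A'_def)
      then show ?thesis using k(4) gen'(2) by simp
    qed
    obtain n where nc: "cocone J K Do Dm V n" and kn: "\<And>j. j \<in> Obj J \<Longrightarrow> Comp K k (n j) = m j"
      using cocone_through_sub[OF conjunct1[OF *] conjunct2[OF *] k(2,3) c mk] by metis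
    have n: "n j \<in> hom K (Do j) V" if "j \<in> Obj J" for j using nc that by (simp add: cocone_def)
    have akn: "act k (act (n j) x) = act (m j) x" if "j \<in> Obj J" "x \<in> M (Do j)" for j x
      using Comp_K(2)[OF n[OF that(1)] k(2) that(2)] kn[OF that(1)] by simp
    \<comment> \<open>The index of the factor that represents the given cocone, corestricted to the
      part of \<open>Y\<close> that it generates. Projection to this factor followed by
      \<open>k\<close> is the comparison map.\<close>
    define t where "t = (V, restrict n (Obj J))"
    have t: "t \<in> T" using k(1) nc J by (auto simp: t_def T_def cocone_def)
    have \<pi>t: "\<pi> t \<in> hom K Z V" using \<pi>[OF t] by (simp add: t_def)
    let ?h = "Comp K k (Comp K (\<pi> t) i)"
    note c1 = Comp_K[OF i(1) \<pi>t]
    note c2 = Comp_K[OF c1(1) k(2)]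
    have h: "Comp K ?h (l j) = m j" if j: "j \<in> Obj J" for j
    proof (rule hom_eqI[OF Comp_K(1)[OF l[OF j] c2(1)] m[OF j]])
      fix x assume x: "x \<in> M (Do j)"
      have lx: "act (l j) x \<in> M S" by (rule act_in[OF l[OF j] x])
      have "act (Comp K ?h (l j)) x = act k (act (\<pi> t) (act i (act (l j) x)))"
        using Comp_K(2)[OF l[OF j] c2(1) x] c2(2)[OF lx] c1(2)[OF lx] by simp
      also have "\<dots> = act (m j) x"
        using ail[OF j x] a\<pi>G[OF j t x] akn[OF j x] j by (simp add: t_def)
      finally show "act (Comp K ?h (l j)) x = act (m j) x" .
    qed
    show ?thesis
    proof (rule ex1I[of _ ?h])
      show "?h \<in> hom K S Y \<and> (\<forall>j \<in> Obj J. Comp K ?h (l j) = m j)" using c2(1) h by blast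
      fix h' assume h': "h' \<in> hom K S Y \<and> (\<forall>j \<in> Obj J. Comp K h' (l j) = m j)"
      show "h' = ?h"
      proof (rule agree_on_generated[OF i A _ c2(1)])
        show "h' \<in> hom K S Y" using h' by blast
        fix x assume x: "x \<in> M S" "act i x \<in> A"
        then obtain j y where j: "j \<in> Obj J" "y \<in> M (Do j)" "act i x = act (G j) y" by (auto simp: A_def)
        then have "act i x = act i (act (l j) y)" using ail by simp
        then have xe: "x = act (l j) y" using i(2) x(1) act_in[OF l[OF j(1)] j(2)] by (auto dest: inj_onD)
        have "act h' (act (l j) y) = act (m j) y"
          using Comp_K(2)[OF l[OF j(1)] _ j(2), of h' Y] h' j(1) by simp
        moreover have "act ?h (act (l j) y) = act (m j) y"
          using Comp_K(2)[OF l[OF j(1)] c2(1) j(2)] h[OF j(1)] by simp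
        ultimately show "act h' x = act ?h x" by (simp add: xe)
      qed
    qed
  qed
  then show "\<exists>x l. colimit_cocone J K Do Dm x l" using cone unfolding colimit_cocone_def by blast
qed

end

section \<open>Directed colimits\<close>

locale directed_system =
  fixes C :: "('o, 'c) cat" and I :: "'i set" and le :: "'i \<Rightarrow> 'i \<Rightarrow> bool"
    and X :: "'i \<Rightarrow> ('m, 'c) overcat" and tr :: "'i \<Rightarrow> 'i \<Rightarrow> 'm \<Rightarrow> 'm"
  assumes le_in: "le i j \<Longrightarrow> i \<in> I \<and> j \<in> I"
    and le_refl: "i \<in> I \<Longrightarrow> le i i"
    and le_trans: "le i j \<Longrightarrow> le j k \<Longrightarrow> le i k"
    and le_directed: "i \<in> I \<Longrightarrow> j \<in> I \<Longrightarrow> \<exists>k. le i k \<and> le j k"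
    and over_X: "i \<in> I \<Longrightarrow> over C (X i)"
    and tr_omor: "le i j \<Longrightarrow> omor (X i) (X j) (tr i j)"
    and tr_refl: "i \<in> I \<Longrightarrow> x \<in> Ar (X i) \<Longrightarrow> tr i i x = x"
    and tr_trans: "le i j \<Longrightarrow> le j k \<Longrightarrow> x \<in> Ar (X i) \<Longrightarrow> tr j k (tr i j x) = tr i k x"
begin

lemma tr_in: "le i j \<Longrightarrow> x \<in> Ar (X i) \<Longrightarrow> tr i j x \<in> Ar (X j)"
  using omorD(1)[OF tr_omor] .

definition pts where "pts = (SIGMA i:I. Ar (X i))"

definition eqv where "eqv p q \<longleftrightarrow> (\<exists>k. le (fst p) k \<and> le (fst q) k \<and> tr (fst p) k (snd p) = tr (fst q) k (snd q))"

lemma eqv_later: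
  assumes "p \<in> pts" "q \<in> pts" "tr (fst p) k (snd p) = tr (fst q) k (snd q)" "le (fst p) k" "le (fst q) k" "le k m"
  shows "tr (fst p) m (snd p) = tr (fst q) m (snd q)"
  using assms tr_trans[of "fst p" k m "snd p"] tr_trans[of "fst q" k m "snd q"] by (auto simp: pts_def)

lemma eqv_refl: "p \<in> pts \<Longrightarrow> eqv p p"
  unfolding eqv_def pts_def using le_refl by (intro exI[of _ "fst p"]) auto

lemma eqv_sym: "eqv p q \<Longrightarrow> eqv q p"
  unfolding eqv_def by metis

lemma eqv_trans:
  assumes "p \<in> pts" "q \<in> pts" "r \<in> pts" "eqv p q" "eqv q r"
  shows "eqv p r"
proof -
  obtain k where k: "le (fst p) k" "le (fst q) k" "tr (fst p) k (snd p) = tr (fst q) k (snd q)"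
    using assms(4) by (auto simp: eqv_def)
  obtain l where l: "le (fst q) l" "le (fst r) l" "tr (fst q) l (snd q) = tr (fst r) l (snd r)"
    using assms(5) by (auto simp: eqv_def)
  obtain m where m: "le k m" "le l m" using le_directed le_in k(1) l(1) by blast
  have "tr (fst p) m (snd p) = tr (fst r) m (snd r)"
    using eqv_later[OF assms(1,2) k(3,1,2) m(1)] eqv_later[OF assms(2,3) l(3,1,2) m(2)] by simp
  then show ?thesis unfolding eqv_def using le_trans k l m by blast
qed

text \<open>Germs are chosen representatives instead of equivalence classes, so the arrows of the
  colimit remain pairs of a stage and an arrow at that stage.\<close>

definition rep where "rep p = (SOME q. q \<in> pts \<and> eqv p q)"

lemma rep: "p \<in> pts \<Longrightarrow> rep p \<in> pts \<and> eqv p (rep p)"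
  unfolding rep_def by (rule someI[of _ p]) (simp add: eqv_refl)

lemma rep_eq_iff:
  assumes "p \<in> pts" "q \<in> pts"
  shows "rep p = rep q \<longleftrightarrow> eqv p q"
proof
  assume "rep p = rep q"
  then show "eqv p q" using rep assms eqv_trans eqv_sym by metis
next
  assume e: "eqv p q"
  have "(r \<in> pts \<and> eqv p r) = (r \<in> pts \<and> eqv q r)" for r
    using e assms eqv_trans eqv_sym by blast
  then show "rep p = rep q" unfolding rep_def by simp
qed

text \<open>Two representatives are composed at some stage where their transports are composable;
  \<open>germ_cm\<close> shows that the choice of stage does not matter.\<close>

definition colim where
  "colim = \<lparr>Ar = rep ` pts, dm = (\<lambda>(i, x). rep (i, dm (X i) x)), cd = (\<lambda>(i, x). rep (i, cd (X i) x)),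
     cm = (\<lambda>(j, y) (i, x). let k = SOME k. le i k \<and> le j k \<and> dm (X k) (tr j k y) = cd (X k) (tr i k x)
       in rep (k, cm (X k) (tr j k y) (tr i k x))),
     pr = (\<lambda>(i, x). pr (X i) x)\<rparr>"

abbreviation germ where "germ i x \<equiv> rep (i, x)"

lemma germ_eq_iff:
  "i \<in> I \<Longrightarrow> j \<in> I \<Longrightarrow> x \<in> Ar (X i) \<Longrightarrow> y \<in> Ar (X j) \<Longrightarrow>
    germ i x = germ j y \<longleftrightarrow> (\<exists>k. le i k \<and> le j k \<and> tr i k x = tr j k y)"
  using rep_eq_iff[of "(i, x)" "(j, y)"] by (simp add: pts_def eqv_def)

lemma germ_tr: 
  assumes "le i k" "x \<in> Ar (X i)"
  shows "germ k (tr i k x) = germ i x"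
proof -
  have "k \<in> I" "i \<in> I" "tr i k x \<in> Ar (X k)" using assms le_in tr_in by auto
  moreover have "tr k k (tr i k x) = tr i k x" using calculation tr_refl by simp
  ultimately show ?thesis using assms le_refl by (subst germ_eq_iff) auto
qed

lemma germ_in: "i \<in> I \<Longrightarrow> x \<in> Ar (X i) \<Longrightarrow> germ i x \<in> Ar colim"
  by (simp add: colim_def pts_def)

lemma germ_cases:
  assumes "p \<in> Ar colim"
  obtains i x where "i \<in> I" "x \<in> Ar (X i)" "p = germ i x"
  using assms by (auto simp: colim_def pts_def)

lemma germ_dm:
  assumes "i \<in> I" "x \<in> Ar (X i)"
  shows "dm colim (germ i x) = germ i (dm (X i) x)" "cd colim (germ i x) = germ i (cd (X i) x)"
    "pr colim (germ i x) = pr (X i) x"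
proof -
  obtain j y where jy: "germ i x = (j, y)" by (cases "germ i x")
  have p: "(i, x) \<in> pts" using assms by (simp add: pts_def)
  have q: "j \<in> I" "y \<in> Ar (X j)" "eqv (i, x) (j, y)" using rep[OF p] by (auto simp: jy pts_def)
  then obtain k where k: "le i k" "le j k" "tr i k x = tr j k y" by (auto simp: eqv_def)
  note t = omorD[OF tr_omor[OF k(1)] assms(2)] omorD[OF tr_omor[OF k(2)] q(2)]
  note d = overD(1,2)[OF over_X[OF assms(1)] assms(2)] overD(1,2)[OF over_X[OF q(1)] q(2)]
  have "germ j (dm (X j) y) = germ i (dm (X i) x)" "germ j (cd (X j) y) = germ i (cd (X i) x)"
    using t k d assms q by (auto simp: germ_eq_iff)
  then show "dm colim (germ i x) = germ i (dm (X i) x)" "cd colim (germ i x) = germ i (cd (X i) x)"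
    unfolding jy by (simp_all add: colim_def)
  show "pr colim (germ i x) = pr (X i) x" unfolding jy using t k by (simp add: colim_def)
qed

text \<open>The composite was formed at an arbitrary stage \<open>n\<close> from arbitrary
  representatives. It is compared with the composite at \<open>k\<close> at a stage beyond both
  \<open>n\<close> and a stage \<open>e\<close> where the representatives have become equal to
  \<open>x\<close> and \<open>y\<close>.\<close>

lemma germ_cm:
  assumes k: "k \<in> I" and x: "x \<in> Ar (X k)" and y: "y \<in> Ar (X k)" and c: "dm (X k) y = cd (X k) x"
  shows "cm colim (germ k y) (germ k x) = germ k (cm (X k) y x)"
proof -
  obtain i x1 where ix: "germ k x = (i, x1)" by (cases "germ k x")
  obtain j y1 where jy: "germ k y = (j, y1)" by (cases "germ k y")
  have p: "(k, x) \<in> pts" "(k, y) \<in> pts" using assms by (auto simp: pts_def)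
  have i: "i \<in> I" "x1 \<in> Ar (X i)" "eqv (k, x) (i, x1)" using rep[OF p(1)] by (auto simp: ix pts_def)
  have j: "j \<in> I" "y1 \<in> Ar (X j)" "eqv (k, y) (j, y1)" using rep[OF p(2)] by (auto simp: jy pts_def)
  have pp: "(i, x1) \<in> pts" "(j, y1) \<in> pts" using i j by (auto simp: pts_def)
  obtain a where a: "le k a" "le i a" "tr k a x = tr i a x1" using i(3) by (auto simp: eqv_def)
  obtain b where b: "le k b" "le j b" "tr k b y = tr j b y1" using j(3) by (auto simp: eqv_def)
  obtain e where e: "le a e" "le b e" using a b le_directed le_in by blast
  have later: "tr k m x = tr i m x1" "tr k m y = tr j m y1" "le k m" "le i m" "le j m" if "le e m" for m
  proof -
    have am: "le a m" "le b m" using e that le_trans by blast+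
    show "tr k m x = tr i m x1" using eqv_later[OF p(1) pp(1) _ _ _ am(1)] a by simp
    show "tr k m y = tr j m y1" using eqv_later[OF p(2) pp(2) _ _ _ am(2)] b by simp
    show "le k m" "le i m" "le j m" using a b am le_trans by blast+
  qed
  have eI: "le e e" using e le_in le_refl by blast
  define P where "P k' \<longleftrightarrow> le i k' \<and> le j k' \<and> dm (X k') (tr j k' y1) = cd (X k') (tr i k' x1)" for k'
  have "P e"
    unfolding P_def using later[OF eI] omorD(2,3)[OF tr_omor[of k e]] x y c by metis
  then have Ps: "P (SOME k'. P k')" by (rule someI)
  define n where "n = (SOME k'. P k')"
  have n: "le i n" "le j n" "dm (X n) (tr j n y1) = cd (X n) (tr i n x1)"
    using Ps by (auto simp: n_def P_def)
  have cmn: "cm colim (germ k y) (germ k x) = germ n (cm (X n) (tr j n y1) (tr i n x1))"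
    unfolding ix jy by (simp add: colim_def n_def P_def Let_def)
  obtain m where m: "le n m" "le e m" using le_directed[of n e] le_in n(1) eI by blast
  have tn: "tr j n y1 \<in> Ar (X n)" "tr i n x1 \<in> Ar (X n)" using tr_in n i j by auto
  have "tr n m (cm (X n) (tr j n y1) (tr i n x1)) = cm (X m) (tr j m y1) (tr i m x1)"
    using omor_comp[OF tr_omor[OF m(1)] tn(2,1) n(3)] tr_trans n m i j by simp
  also have "\<dots> = tr k m (cm (X k) y x)"
    using omor_comp[OF tr_omor[of k m] x y c] later[OF m(2)] by simp
  finally have "tr n m (cm (X n) (tr j n y1) (tr i n x1)) = tr k m (cm (X k) y x)" .
  moreover have "n \<in> I" "cm (X n) (tr j n y1) (tr i n x1) \<in> Ar (X n)" "cm (X k) y x \<in> Ar (X k)"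
    using n le_in over_compD(1)[OF over_X _ _ n(3)] tn over_compD(1)[OF over_X[OF k] x y c] by blast+
  ultimately show ?thesis unfolding cmn using k m later(3)[OF m(2)] by (auto simp: germ_eq_iff)
qed

lemma common_stage:
  assumes "i \<in> I" "x \<in> Ar (X i)" "j \<in> I" "y \<in> Ar (X j)" "dm colim (germ j y) = cd colim (germ i x)"
  obtains k where "le i k" "le j k" "dm (X k) (tr j k y) = cd (X k) (tr i k x)"
proof -
  have "germ j (dm (X j) y) = germ i (cd (X i) x)" using assms germ_dm by simp
  then obtain k where k: "le i k" "le j k" "tr j k (dm (X j) y) = tr i k (cd (X i) x)"
    using germ_eq_iff[of j i] assms overD(1,2)[OF over_X] by metis
  then show thesis using that omorD(2,3)[OF tr_omor] assms by simp
qed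

lemma composable_cases:
  assumes "p \<in> Ar colim" "q \<in> Ar colim" "dm colim q = cd colim p"
  obtains k x y where "k \<in> I" "x \<in> Ar (X k)" "y \<in> Ar (X k)" "p = germ k x" "q = germ k y" "dm (X k) y = cd (X k) x"
proof -
  obtain i x where i: "i \<in> I" "x \<in> Ar (X i)" "p = germ i x" using germ_cases[OF assms(1)] .
  obtain j y where j: "j \<in> I" "y \<in> Ar (X j)" "q = germ j y" using germ_cases[OF assms(2)] .
  obtain k where k: "le i k" "le j k" "dm (X k) (tr j k y) = cd (X k) (tr i k x)"
    using common_stage[OF i(1,2) j(1,2)] assms(3) i j by auto
  show thesis
    by (rule that[of k "tr i k x" "tr j k y"]) (use k i j tr_in le_in germ_tr in auto)
qed

lemma over_colim: "over C colim"
  unfolding over_def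
proof (intro conjI ballI impI)
  fix f assume "f \<in> Ar colim"
  then obtain i x where i: "i \<in> I" "x \<in> Ar (X i)" and f: "f = germ i x" by (rule germ_cases)
  note o = overD[OF over_X[OF i(1)] i(2)]
  show "dm colim f \<in> Ar colim" "cd colim f \<in> Ar colim" "dm colim (dm colim f) = dm colim f"
    "cd colim (dm colim f) = dm colim f" "dm colim (cd colim f) = cd colim f"
    "cd colim (cd colim f) = cd colim f" "pr colim f \<in> Mor C"
    "pr colim (dm colim f) = Ident C (Dom C (pr colim f))" "pr colim (cd colim f) = Ident C (Cod C (pr colim f))"
    using i o by (simp_all add: f germ_dm germ_in)
  show "cm colim f (dm colim f) = f" "cm colim (cd colim f) f = f"
    using i o germ_cm[OF i(1), of "dm (X i) x" x] germ_cm[OF i(1), of x "cd (X i) x"] by (simp_all add: f germ_dm)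
next
  fix f g assume "f \<in> Ar colim" "g \<in> Ar colim" "dm colim g = cd colim f"
  then obtain k x y where k: "k \<in> I" "x \<in> Ar (X k)" "y \<in> Ar (X k)" "f = germ k x" "g = germ k y"
    "dm (X k) y = cd (X k) x" by (rule composable_cases)
  note c = over_compD[OF over_X[OF k(1)] k(2,3,6)]
  show "cm colim g f \<in> Ar colim" "dm colim (cm colim g f) = dm colim f"
    "cd colim (cm colim g f) = cd colim g" "pr colim (cm colim g f) = Comp C (pr colim g) (pr colim f)"
    using k c by (simp_all add: germ_cm germ_in germ_dm)
next
  fix f g h assume f: "f \<in> Ar colim" and g: "g \<in> Ar colim" and h: "h \<in> Ar colim"
    and gf: "dm colim g = cd colim f" and hg: "dm colim h = cd colim g"
  obtain k x y where k: "k \<in> I" "x \<in> Ar (X k)" "y \<in> Ar (X k)" "f = germ k x" "g = germ k y"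
    "dm (X k) y = cd (X k) x" by (rule composable_cases[OF f g gf])
  obtain j z where j: "j \<in> I" "z \<in> Ar (X j)" "h = germ j z" using germ_cases[OF h] .
  obtain m where m: "le k m" "le j m" "dm (X m) (tr j m z) = cd (X m) (tr k m y)"
    using common_stage[OF k(1,3) j(1,2)] hg k j by auto
  let ?x = "tr k m x" and ?y = "tr k m y" and ?z = "tr j m z"
  have a: "m \<in> I" "?x \<in> Ar (X m)" "?y \<in> Ar (X m)" "?z \<in> Ar (X m)" using m k j le_in tr_in by auto
  have e: "f = germ m ?x" "g = germ m ?y" "h = germ m ?z" using m k j germ_tr by auto
  have yx: "dm (X m) ?y = cd (X m) ?x" using omorD(2,3)[OF tr_omor[OF m(1)]] k by metis
  note o = over_X[OF a(1)]
  show "cm colim h (cm colim g f) = cm colim (cm colim h g) f"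
    unfolding e using a yx m(3) over_compD[OF o a(2,3) yx] over_compD[OF o a(3,4) m(3)]
      over_assoc[OF o a(2,3,4) yx m(3)] by (simp add: germ_cm)
qed

lemma germ_omor: "i \<in> I \<Longrightarrow> omor (X i) colim (germ i)"
  unfolding omor_def using germ_dm germ_in germ_cm by auto

end

text \<open>The assumption \<open>bound\<close> is \<open>\<kappa>\<close>-directedness for the
  successor \<open>\<kappa>\<close> of |B|, and \<open>thin\<close> makes the transition maps
  independent of the arrows chosen for them.\<close>

locale directed_diagram = small_base U C for U :: "'u itself" and C :: "('u, 'u) cat" +
  fixes J :: "('u, 'u) cat" and Do Dm and B :: "'u set"
  assumes J: "small_category J" and D: "is_functor J (slice Cat C) Do Dm"
    and thin: "u \<in> Mor J \<Longrightarrow> v \<in> Mor J \<Longrightarrow> Dom J u = Dom J v \<Longrightarrow> Cod J u = Cod J v \<Longrightarrow> u = v"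
    and B: "infinite B"
    and bound: "S \<subseteq> Obj J \<Longrightarrow> |S| \<le>o |B| \<Longrightarrow> \<exists>b\<in>Obj J. \<forall>s\<in>S. hom J s b \<noteq> {}"
begin

lemma J_cat: "category J" using J by (simp add: small_category_def)

lemma J_comp: 
  assumes "u \<in> hom J i j" "v \<in> hom J j k"
  shows "Comp J v u \<in> hom J i k"
proof -
  have *: "u \<in> Mor J" "v \<in> Mor J" "Dom J v = Cod J u" "Dom J u = i" "Cod J v = k"
    using assms by (auto simp: hom_def)
  then have "Comp J v u \<in> hom J (Dom J u) (Cod J v)" using J_cat unfolding category_def by blast
  then show ?thesis using * by simp
qed

lemma J_obj: "u \<in> Mor J \<Longrightarrow> Dom J u \<in> Obj J" "u \<in> Mor J \<Longrightarrow> Cod J u \<in> Obj J"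
  using J_cat unfolding category_def by blast+

lemma small_J: "sml (Obj J)"
  using J by (simp add: small_category_def small_TYPE)

definition le where "le i k \<longleftrightarrow> i \<in> Obj J \<and> k \<in> Obj J \<and> hom J i k \<noteq> {}"

definition arr where "arr i k = (SOME u. u \<in> hom J i k)"

definition tr where "tr i k = act (Dm (arr i k))"

lemma arr: "le i k \<Longrightarrow> arr i k \<in> hom J i k"
  unfolding le_def arr_def by (meson ex_in_conv someI_ex)

lemma arr_eq: "u \<in> hom J i k \<Longrightarrow> arr i k = u"
  using arr[of i k] J_obj[of u] thin[of "arr i k" u] unfolding le_def by (auto simp: hom_def)

lemma Do: "j \<in> Obj J \<Longrightarrow> Do j \<in> Obj K"
  using D by (auto simp: is_functor_def)

lemma Dm: "u \<in> hom J i k \<Longrightarrow> Dm u \<in> hom K (Do i) (Do k)"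
  using D by (auto simp: is_functor_def hom_def[of J])

lemma Dm_arr: "le i k \<Longrightarrow> Dm (arr i k) \<in> hom K (Do i) (Do k)"
  by (rule Dm[OF arr])

sublocale sys: directed_system C "Obj J" le "\<lambda>j. view (Do j)" tr
proof
  show "i \<in> Obj J \<and> j \<in> Obj J" if "le i j" for i j using that by (simp add: le_def)
  have id: "Ident J i \<in> hom J i i" if "i \<in> Obj J" for i using J_cat that by (auto simp: category_def)
  show "le i i" if "i \<in> Obj J" for i using id that by (auto simp: le_def)
  have comp: "Comp J (arr j k) (arr i j) \<in> hom J i k" if "le i j" "le j k" for i j k
    by (rule J_comp[OF arr[OF that(1)] arr[OF that(2)]])
  show le_trans: "le i k" if "le i j" "le j k" for i j k
    using comp[OF that] that by (auto simp: le_def)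
  show "\<exists>k. le i k \<and> le j k" if "i \<in> Obj J" "j \<in> Obj J" for i j
    using bound[of "{i, j}"] bounded_finite[OF B, of "{i, j}"] that by (auto simp: le_def)
  show "over C (view (Do i))" if "i \<in> Obj J" for i by (rule over_view[OF Do[OF that]])
  show "omor (view (Do i)) (view (Do j)) (tr i j)" if "le i j" for i j
    unfolding tr_def by (rule act_omor[OF Dm_arr[OF that]])
  show "tr i i x = x" if "i \<in> Obj J" "x \<in> M (Do i)" for i x
    using arr_eq[OF id[OF that(1)]] D that Ident_K(2)[OF Do[OF that(1)] that(2)]
    by (simp add: tr_def is_functor_def)
  show "tr j k (tr i j x) = tr i k x" if "le i j" "le j k" "x \<in> M (Do i)" for i j k x
  proof -
    have "Dm (arr i k) = Comp K (Dm (arr j k)) (Dm (arr i j))"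
      using arr_eq[OF comp[OF that(1,2)]] D arr[OF that(1)] arr[OF that(2)]
      by (simp add: is_functor_def hom_def)
    then show ?thesis using Comp_K(2)[OF Dm_arr[OF that(1)] Dm_arr[OF that(2)] that(3)] by (simp add: tr_def)
  qed
qed

section \<open>Comparison of a given colimit with the concrete one\<close>

context
  fixes x l
  assumes colimit: "colimit_cocone J K Do Dm x l"
begin

lemma leg: "j \<in> Obj J \<Longrightarrow> l j \<in> hom K (Do j) x" and apex: "x \<in> Obj K"
  using colimit by (auto simp: colimit_cocone_def cocone_def)

lemma leg_tr:
  assumes "le i k" "f \<in> M (Do i)"
  shows "act (l k) (tr i k f) = act (l i) f"
proof -
  have "arr i k \<in> Mor J" "Dom J (arr i k) = i" "Cod J (arr i k) = k" using arr[OF assms(1)] by (auto simp: hom_def)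
  then have "Comp K (l k) (Dm (arr i k)) = l i" using colimit by (auto simp: colimit_cocone_def cocone_def)
  then show ?thesis
    using Comp_K(2)[OF Dm_arr[OF assms(1)] leg assms(2)] assms(1) by (simp add: tr_def le_def)
qed

text \<open>
  The concrete colimit \<open>sys.colim\<close> is a cocone that identifies arrows only if a later stage does.
\<close>

lemma colimit_separated:
  assumes i: "i \<in> Obj J" "f \<in> M (Do i)" and j: "j \<in> Obj J" "g \<in> M (Do j)"
    and eq: "act (l i) f = act (l j) g"
  shows "\<exists>k. le i k \<and> le j k \<and> tr i k f = tr j k g"
proof -
  have sP: "sml sys.pts"
    unfolding sys.pts_def by (rule small_Sigma[OF small_J small_view[OF Do]])
  have sA: "sml (Ar sys.colim)" using small_image[OF sP] by (simp add: sys.colim_def)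
  obtain \<iota> :: "'u \<times> 'u \<Rightarrow> 'u" where \<iota>: "inj_on \<iota> (Ar sys.colim)" using sA by (rule small_embed)
  obtain Y where Y: "Y \<in> Obj K" "omor sys.colim (view Y) \<iota>" by (rule realise[OF sys.over_colim sA \<iota>])
  define m where "m j = mk (Do j) Y (\<lambda>f. \<iota> (sys.germ j f))" for j
  have m: "m j \<in> hom K (Do j) Y" if "j \<in> Obj J" for j
    unfolding m_def
    by (rule mk_hom[OF Do[OF that] Y(1) omor_compose[OF over_view[OF Do[OF that]] sys.germ_omor[OF that] Y(2)]])
  have am: "act (m j) f = \<iota> (sys.germ j f)" if "f \<in> M (Do j)" for j f using that by (simp add: m_def)
  have "cocone J K Do Dm Y m"
    unfolding cocone_def
  proof (intro conjI ballI Y(1) m)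
    fix u assume u: "u \<in> Mor J"
    let ?i = "Dom J u" and ?k = "Cod J u"
    have uh: "u \<in> hom J ?i ?k" using u by (simp add: hom_def)
    have ik: "le ?i ?k" using J_obj[OF u] uh by (auto simp: le_def)
    have ob: "?i \<in> Obj J" "?k \<in> Obj J" using ik by (auto simp: le_def)
    show "Comp K (m ?k) (Dm u) = m ?i"
    proof (rule hom_eqI[OF Comp_K(1)[OF Dm[OF uh] m[OF ob(2)]] m[OF ob(1)]])
      fix f assume f: "f \<in> M (Do ?i)"
      have "act (Dm u) f = tr ?i ?k f" using arr_eq[OF uh] by (simp add: tr_def)
      then show "act (Comp K (m ?k) (Dm u)) f = act (m ?i) f"
        using Comp_K(2)[OF Dm[OF uh] m[OF ob(2)] f] am[OF f] am[OF sys.tr_in[OF ik f]] sys.germ_tr[OF ik f]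
        by simp
    qed
  qed
  then obtain h where h: "h \<in> hom K x Y" "\<And>j. j \<in> Obj J \<Longrightarrow> Comp K h (l j) = m j"
    using colimit unfolding colimit_cocone_def by blast
  have "act (m i) f = act (m j) g"
    using Comp_K(2)[OF leg[OF i(1)] h(1) i(2)] Comp_K(2)[OF leg[OF j(1)] h(1) j(2)] h(2) i(1) j(1) eq by simp
  then have "sys.germ i f = sys.germ j g"
    using am i j \<iota> sys.germ_in by (auto dest: inj_onD)
  then show ?thesis using sys.germ_eq_iff i j by simp
qed

text \<open>The images of the legs form a subcategory; composites stay inside because arrows
  composable in \<open>x\<close> come from arrows composable at a common stage. The colimit cocone
  factors through it, and the uniqueness clause gives its inclusion a right inverse, so it is
  everything.\<close>

lemma colimit_covered:
  assumes "f \<in> M x"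
  shows "\<exists>j\<in>Obj J. f \<in> act (l j) ` M (Do j)"
proof -
  let ?N = "\<Union>j\<in>Obj J. act (l j) ` M (Do j)"
  have N: "closed (view x) ?N"
    unfolding closed_def
  proof (intro conjI ballI impI)
    show "?N \<subseteq> M x" using act_in[OF leg] by auto
  next
    fix f assume "f \<in> ?N"
    then obtain j y where j: "j \<in> Obj J" "y \<in> M (Do j)" "f = act (l j) y" by auto
    note o = omorD(2,3)[OF act_omor[OF leg[OF j(1)]] j(2)] overD(1,2)[OF over_view[OF Do[OF j(1)]] j(2)]
    have "dm (view x) f = act (l j) (dm (view (Do j)) y)" "cd (view x) f = act (l j) (cd (view (Do j)) y)"
      using o j by simp_all
    then show "dm (view x) f \<in> ?N" "cd (view x) f \<in> ?N"
      using j(1) imageI[OF o(3), of "act (l j)"] imageI[OF o(4), of "act (l j)"] by (simp_all only:) blast+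
  next
    fix f g assume "f \<in> ?N" "g \<in> ?N" and gf: "dm (view x) g = cd (view x) f"
    then obtain i y j z where i: "i \<in> Obj J" "y \<in> M (Do i)" "f = act (l i) y"
      and j: "j \<in> Obj J" "z \<in> M (Do j)" "g = act (l j) z" by auto
    note oi = omorD(2,3)[OF act_omor[OF leg[OF i(1)]] i(2)] overD(1,2)[OF over_view[OF Do[OF i(1)]] i(2)]
    note oj = omorD(2,3)[OF act_omor[OF leg[OF j(1)]] j(2)] overD(1,2)[OF over_view[OF Do[OF j(1)]] j(2)]
    have "act (l j) (dm (view (Do j)) z) = act (l i) (cd (view (Do i)) y)" using gf i j oi oj by simp
    then obtain k where k: "le j k" "le i k" "tr j k (dm (view (Do j)) z) = tr i k (cd (view (Do i)) y)"
      using colimit_separated[OF j(1) oj(3) i(1) oi(4)] by blast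
    then have c: "dm (view (Do k)) (tr j k z) = cd (view (Do k)) (tr i k y)"
      using omorD(2)[OF sys.tr_omor[OF k(1)] j(2)] omorD(3)[OF sys.tr_omor[OF k(2)] i(2)] by simp
    have kO: "k \<in> Obj J" using k(1) by (simp add: le_def)
    note zk = sys.tr_in[OF k(1) j(2)] and yk = sys.tr_in[OF k(2) i(2)]
    have "cm (view x) g f = act (l k) (cm (view (Do k)) (tr j k z) (tr i k y))"
      using omor_comp[OF act_omor[OF leg[OF kO]] yk zk c] leg_tr[OF k(1) j(2)] leg_tr[OF k(2) i(2)] i j by simp
    then show "cm (view x) g f \<in> ?N"
      using over_compD(1)[OF over_view[OF Do[OF kO]] yk zk c] kO by blast
  qed
  obtain S i where i: "i \<in> hom K S x" "inj_on (act i) (M S)" "act i ` M S = ?N" by (rule sub_exists[OF apex N])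
  have xl: "cocone J K Do Dm x l" using colimit by (simp add: colimit_cocone_def)
  have li: "act (l j) ` M (Do j) \<subseteq> act i ` M S" if j: "j \<in> Obj J" for j unfolding i(3) using j by auto
  obtain n where "cocone J K Do Dm S n" and iN: "\<And>j. j \<in> Obj J \<Longrightarrow> Comp K i (n j) = l j"
    using cocone_through_sub[OF J D i(1,2) xl li] by metis
  then obtain h where h: "h \<in> hom K x S" "\<And>j. j \<in> Obj J \<Longrightarrow> Comp K h (l j) = n j"
    using colimit unfolding colimit_cocone_def by blast
  have "Comp K i h \<in> hom K x x" "\<forall>j\<in>Obj J. Comp K (Comp K i h) (l j) = l j"
    using Comp_K(1)[OF h(1) i(1)] K_assoc[OF leg h(1) i(1)] h(2) iN by auto
  moreover have "Ident K x \<in> hom K x x" "\<forall>j\<in>Obj J. Comp K (Ident K x) (l j) = l j"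
    using Ident_K(1)[OF apex] K_unit(2)[OF leg] by auto
  moreover have "\<exists>!h. h \<in> hom K x x \<and> (\<forall>j\<in>Obj J. Comp K h (l j) = l j)"
    using colimit unfolding colimit_cocone_def by blast
  ultimately have e: "Comp K i h = Ident K x" by blast
  have "act i (act h f) = f" using Comp_K(2)[OF h(1) i(1) assms] e Ident_K(2)[OF apex assms] by simp
  then have "f \<in> act i ` M S" using act_in[OF h(1) assms] by force
  then show ?thesis unfolding i(3) by simp
qed

lemma stage_bound:
  assumes "|A| \<le>o |B|" "\<And>a. a \<in> A \<Longrightarrow> s a \<in> Obj J"
  obtains b where "b \<in> Obj J" "\<And>a. a \<in> A \<Longrightarrow> le (s a) b"
proof -
  have "s ` A \<subseteq> Obj J" "|s ` A| \<le>o |B|" using assms bounded_image by auto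
  then obtain b where "b \<in> Obj J" "\<forall>s\<in>s ` A. hom J s b \<noteq> {}" using bound by blast
  then show thesis using that assms(2) by (auto simp: le_def)
qed

text \<open>Preimages of the at most |B| arrows of \<open>a\<close> are moved to a common stage.
  They need not form a functor there, but each equation required for this holds at some later stage,
  and there are at most |B| equations.\<close>

lemma colimit_factor:
  assumes a: "|M a| \<le>o |B|" and F: "F \<in> hom K a x"
  shows "\<exists>j\<in>Obj J. \<exists>G\<in>hom K a (Do j). Comp K (l j) G = F"
proof -
  note aO = homD(1)[OF F]
  note oF = omorD[OF act_omor[OF F]] and oa = overD[OF over_view[OF aO]]
  have "\<forall>f\<in>M a. \<exists>j y. j \<in> Obj J \<and> y \<in> M (Do j) \<and> act (l j) y = act F f"
  proof
    fix f assume "f \<in> M a"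
    then obtain j where "j \<in> Obj J" "act F f \<in> act (l j) ` M (Do j)"
      using colimit_covered[OF act_in[OF F]] by blast
    then show "\<exists>j y. j \<in> Obj J \<and> y \<in> M (Do j) \<and> act (l j) y = act F f" by force
  qed
  then obtain s y where s: "\<And>f. f \<in> M a \<Longrightarrow> s f \<in> Obj J" and y: "\<And>f. f \<in> M a \<Longrightarrow> y f \<in> M (Do (s f))"
    and ly: "\<And>f. f \<in> M a \<Longrightarrow> act (l (s f)) (y f) = act F f" by metis
  obtain b where b: "b \<in> Obj J" "\<And>f. f \<in> M a \<Longrightarrow> le (s f) b" by (rule stage_bound[OF a, of s]) (use s in auto)
  define z where "z f = tr (s f) b (y f)" for f
  have z: "z f \<in> M (Do b)" "act (l b) (z f) = act F f" if "f \<in> M a" for f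
    using sys.tr_in[OF b(2)] leg_tr[OF b(2)] that y ly by (auto simp: z_def)
  have later: "\<exists>k. le b k \<and> tr b k p = tr b k q"
    if "p \<in> M (Do b)" "q \<in> M (Do b)" "act (l b) p = act (l b) q" "b \<in> Obj J" for b p q
    using colimit_separated[of b p b q] that by blast
  note ob = overD[OF over_view[OF Do[OF b(1)]]] and lb = omorD[OF act_omor[OF leg[OF b(1)]]]
  have "\<forall>f\<in>M a. \<exists>k. le b k \<and> tr b k (z (dm (view a) f)) = tr b k (dm (view (Do b)) (z f))"
    using later[OF _ _ _ b(1)] z ob(1) lb(2) oa(1) oF(2) by auto
  then obtain s1 where s1: "\<And>f. f \<in> M a \<Longrightarrow> le b (s1 f) \<and>
    tr b (s1 f) (z (dm (view a) f)) = tr b (s1 f) (dm (view (Do b)) (z f))" by metis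
  have "\<forall>f\<in>M a. \<exists>k. le b k \<and> tr b k (z (cd (view a) f)) = tr b k (cd (view (Do b)) (z f))"
    using later[OF _ _ _ b(1)] z ob(2) lb(3) oa(2) oF(3) by auto
  then obtain s2 where s2: "\<And>f. f \<in> M a \<Longrightarrow> le b (s2 f) \<and>
    tr b (s2 f) (z (cd (view a) f)) = tr b (s2 f) (cd (view (Do b)) (z f))" by metis
  have "s1 f \<in> Obj J" "s2 f \<in> Obj J" if "f \<in> M a" for f using s1[OF that] s2[OF that] by (auto simp: le_def)
  then obtain c1 c2 where c1: "c1 \<in> Obj J" "\<And>f. f \<in> M a \<Longrightarrow> le (s1 f) c1"
    and c2: "c2 \<in> Obj J" "\<And>f. f \<in> M a \<Longrightarrow> le (s2 f) c2"
    using stage_bound[OF a, of s1] stage_bound[OF a, of s2] by metis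
  obtain c where cc: "le c1 c" "le c2 c" using sys.le_directed c1(1) c2(1) by blast
  have c: "c \<in> Obj J" using cc by (simp add: le_def)
  have c12: "le (s1 f) c" "le (s2 f) c" if "f \<in> M a" for f
    using c1(2) c2(2) cc sys.le_trans that by blast+
  show ?thesis
  \<comment> \<open>That \<open>c\<close> lies above \<open>b\<close> is read off from the stage of
    some arrow of \<open>a\<close>, so the empty category is treated apart.\<close>
  proof (cases "M a = {}")
    case True
    have "omor (view a) (view (Do b)) (\<lambda>f. f)" using True by (simp add: omor_def)
    note G = mk_hom[OF aO Do[OF b(1)] this]
    have "Comp K (l b) (mk a (Do b) (\<lambda>f. f)) = F"
      by (rule hom_eqI[OF Comp_K(1)[OF G leg[OF b(1)]] F]) (use True in simp)
    then show ?thesis using G b(1) by blast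
  next
    case False
    then have bc: "le b c" using s1 c12 sys.le_trans by blast
    define w where "w f = tr b c (z f)" for f
    note tc = omorD[OF sys.tr_omor[OF bc]]
    have w: "w f \<in> M (Do c)" "act (l c) (w f) = act F f" "pr (view (Do c)) (w f) = pr (view a) f" if f: "f \<in> M a" for f
    proof -
      show 1: "w f \<in> M (Do c)" "act (l c) (w f) = act F f"
        using z[OF f] sys.tr_in[OF bc] leg_tr[OF bc] by (auto simp: w_def)
      show "pr (view (Do c)) (w f) = pr (view a) f"
        using omorD(4)[OF act_omor[OF leg[OF c]] 1(1)] 1(2) oF(4)[OF f] by simp
    qed
    have wd: "w (dm (view a) f) = dm (view (Do c)) (w f)" if f: "f \<in> M a" for f
    proof -
      have zf: "z f \<in> M (Do b)" "z (dm (view a) f) \<in> M (Do b)" using z oa(1) f by auto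
      have "tr b c (z (dm (view a) f)) = tr (s1 f) c (tr b (s1 f) (z (dm (view a) f)))"
        using sys.tr_trans[of b "s1 f" c, OF _ _ zf(2)] s1[OF f] c12[OF f] by metis
      also have "\<dots> = tr (s1 f) c (tr b (s1 f) (dm (view (Do b)) (z f)))" using s1 f by simp
      also have "\<dots> = tr b c (dm (view (Do b)) (z f))"
        using sys.tr_trans[of b "s1 f" c] s1 c12 ob(1)[OF zf(1)] f by simp
      finally show ?thesis using tc(2)[OF zf(1)] by (simp add: w_def)
    qed
    have wc: "w (cd (view a) f) = cd (view (Do c)) (w f)" if f: "f \<in> M a" for f
    proof -
      have zf: "z f \<in> M (Do b)" "z (cd (view a) f) \<in> M (Do b)" using z oa(2) f by auto
      have "tr b c (z (cd (view a) f)) = tr (s2 f) c (tr b (s2 f) (z (cd (view a) f)))"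
        using sys.tr_trans[of b "s2 f" c, OF _ _ zf(2)] s2[OF f] c12[OF f] by metis
      also have "\<dots> = tr (s2 f) c (tr b (s2 f) (cd (view (Do b)) (z f)))" using s2 f by simp
      also have "\<dots> = tr b c (cd (view (Do b)) (z f))"
        using sys.tr_trans[of b "s2 f" c] s2 c12 ob(2)[OF zf(1)] f by simp
      finally show ?thesis using tc(3)[OF zf(1)] by (simp add: w_def)
    qed
    \<comment> \<open>Compositions come after domains and codomains: only at stage \<open>c\<close>,
      where \<open>w\<close> respects both, do the composites of \<open>w g\<close> and
      \<open>w f\<close> make sense.\<close>
    define Q where "Q = {(g, f). g \<in> M a \<and> f \<in> M a \<and> dm (view a) g = cd (view a) f}"
    have "\<exists>k. le c k \<and> tr c k (w (cm (view a) g f)) = tr c k (cm (view (Do c)) (w g) (w f))" if "(g, f) \<in> Q" for g f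
    proof (rule later[OF _ _ _ c])
      have gf: "f \<in> M a" "g \<in> M a" "dm (view a) g = cd (view a) f" using that by (auto simp: Q_def)
      note ca = over_compD(1)[OF over_view[OF aO] gf]
      have d: "dm (view (Do c)) (w g) = cd (view (Do c)) (w f)" using wd wc gf by metis
      show "w (cm (view a) g f) \<in> M (Do c)" using w ca by blast
      show "cm (view (Do c)) (w g) (w f) \<in> M (Do c)"
        using over_compD(1)[OF over_view[OF Do[OF c]] _ _ d] w gf by blast
      show "act (l c) (w (cm (view a) g f)) = act (l c) (cm (view (Do c)) (w g) (w f))"
        using omor_comp[OF act_omor[OF leg[OF c]] _ _ d] w gf ca omor_comp[OF act_omor[OF F] gf] by simp
    qed
    then have "\<forall>p\<in>Q. \<exists>k. le c k \<and> tr c k (w (cm (view a) (fst p) (snd p))) =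
        tr c k (cm (view (Do c)) (w (fst p)) (w (snd p)))" by auto
    then obtain s3 where s3: "\<And>p. p \<in> Q \<Longrightarrow> le c (s3 p) \<and> tr c (s3 p) (w (cm (view a) (fst p) (snd p))) =
        tr c (s3 p) (cm (view (Do c)) (w (fst p)) (w (snd p)))" by metis
    have Qb: "|Q| \<le>o |B|" by (rule bounded_subset[OF _ bounded_Times[OF B a a]]) (auto simp: Q_def)
    have "\<And>p. p \<in> Q \<Longrightarrow> s3 p \<in> Obj J" using s3 by (auto simp: le_def)
    then obtain e where e: "e \<in> Obj J" "\<And>p. p \<in> Q \<Longrightarrow> le (s3 p) e" using stage_bound[OF Qb] by blast
    obtain f0 where f0: "f0 \<in> M a" using False by blast
    have "(f0, dm (view a) f0) \<in> Q" using f0 oa by (simp add: Q_def)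
    then have ce: "le c e" using s3 e(2) sys.le_trans by blast
    note te = omorD[OF sys.tr_omor[OF ce]]
    have om: "omor (view a) (view (Do e)) (\<lambda>f. tr c e (w f))"
      unfolding omor_def
    proof (intro conjI ballI impI)
      fix f assume f: "f \<in> M a"
      show "tr c e (w f) \<in> M (Do e)" "tr c e (w (dm (view a) f)) = dm (view (Do e)) (tr c e (w f))"
        "tr c e (w (cd (view a) f)) = cd (view (Do e)) (tr c e (w f))" "pr (view (Do e)) (tr c e (w f)) = pr (view a) f"
        using te[OF w(1)[OF f]] wd[OF f] wc[OF f] w(3)[OF f] by simp_all
    next
      fix f g assume gf: "f \<in> M a" "g \<in> M a" "dm (view a) g = cd (view a) f"
      then have q: "(g, f) \<in> Q" by (simp add: Q_def)
      have d: "dm (view (Do c)) (w g) = cd (view (Do c)) (w f)" using wd wc gf by metis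
      have cw: "cm (view (Do c)) (w g) (w f) \<in> M (Do c)"
        using over_compD(1)[OF over_view[OF Do[OF c]] _ _ d] w gf by blast
      have wgf: "w (cm (view a) g f) \<in> M (Do c)" using w over_compD(1)[OF over_view[OF aO] gf] by blast
      have "tr c e (w (cm (view a) g f)) = tr c e (cm (view (Do c)) (w g) (w f))"
        using sys.tr_trans[of c "s3 (g, f)" e] s3[OF q] e(2)[OF q] cw wgf by (metis fst_conv snd_conv)
      then show "tr c e (w (cm (view a) g f)) = cm (view (Do e)) (tr c e (w g)) (tr c e (w f))"
        using omor_comp[OF sys.tr_omor[OF ce] w(1)[OF gf(1)] w(1)[OF gf(2)] d] by simp
    qed
    note G = mk_hom[OF aO Do[OF e(1)] om]
    have "Comp K (l e) (mk a (Do e) (\<lambda>f. tr c e (w f))) = F"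
      by (rule hom_eqI[OF Comp_K(1)[OF G leg[OF e(1)]] F])
        (use Comp_K(2)[OF G leg[OF e(1)]] leg_tr[OF ce] w in auto)
    then show ?thesis using G e(1) by blast
  qed
qed

text \<open>Every arrow of \<open>a\<close> has a stage at which its two images coincide, by
  \<open>colimit_separated\<close>, and these at most |B| stages have an upper bound.\<close>

lemma colimit_factor_unique:
  assumes a: "|M a| \<le>o |B|" and i: "i \<in> Obj J" "F \<in> hom K a (Do i)" and j: "j \<in> Obj J" "G \<in> hom K a (Do j)"
    and eq: "Comp K (l i) F = Comp K (l j) G"
  shows "\<exists>k u v. u \<in> hom J i k \<and> v \<in> hom J j k \<and> Comp K (Dm u) F = Comp K (Dm v) G"
proof -
  have "\<forall>f\<in>M a. \<exists>k. le i k \<and> le j k \<and> tr i k (act F f) = tr j k (act G f)"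
    using colimit_separated[OF i(1) act_in[OF i(2)] j(1) act_in[OF j(2)]]
      Comp_K(2)[OF i(2) leg[OF i(1)]] Comp_K(2)[OF j(2) leg[OF j(1)]] eq by simp
  then obtain s where s: "\<And>f. f \<in> M a \<Longrightarrow> le i (s f) \<and> le j (s f) \<and> tr i (s f) (act F f) = tr j (s f) (act G f)"
    by metis
  then have "\<And>f. f \<in> M a \<Longrightarrow> s f \<in> Obj J" by (auto simp: le_def)
  then obtain b where b: "b \<in> Obj J" "\<And>f. f \<in> M a \<Longrightarrow> le (s f) b" using stage_bound[OF a] by blast
  \<comment> \<open>Secures a stage above \<open>i\<close> and \<open>j\<close> also when
    \<open>a\<close> has no arrows.\<close>
  obtain k' where k': "le i k'" "le j k'" using sys.le_directed i j by blast
  obtain k where k: "le k' k" "le b k" using sys.le_directed b k' sys.le_in by blast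
  have ik: "le i k" "le j k" using k k' sys.le_trans by blast+
  have "tr i k (act F f) = tr j k (act G f)" if f: "f \<in> M a" for f
  proof -
    have "le (s f) k" using b(2)[OF f] k sys.le_trans by blast
    then show ?thesis using s[OF f] sys.tr_trans[of i "s f" k] sys.tr_trans[of j "s f" k]
        act_in[OF i(2) f] act_in[OF j(2) f] by metis
  qed
  then have "Comp K (Dm (arr i k)) F = Comp K (Dm (arr j k)) G"
    using Comp_K[OF i(2) Dm_arr[OF ik(1)]] Comp_K[OF j(2) Dm_arr[OF ik(2)]]
    by (intro hom_eqI[of _ a "Do k"]) (auto simp: tr_def)
  then show ?thesis using arr ik by blast
qed

text \<open>By \<open>colimit_factor\<close> and \<open>colimit_factor_unique\<close>, the set of
  morphisms from \<open>a\<close> to \<open>x\<close> is the directed colimit of the sets of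
  morphisms from \<open>a\<close> to the \<open>Do j\<close>. The induced function is defined
  through chosen factorisations and is independent of them by \<open>wd\<close>.\<close>

lemma hom_preserves:
  assumes a: "|M a| \<le>o |B|"
  shows "hom_preserves_colimit K a J Do Dm x l"
  unfolding hom_preserves_colimit_def
proof (intro allI impI)
  fix X :: "'u set" and \<phi>
  assume *: "small TYPE('u) X \<and> (\<forall>j \<in> Obj J. \<phi> j \<in> hom K a (Do j) \<rightarrow> X) \<and>
    (\<forall>u \<in> Mor J. \<forall>g \<in> hom K a (Do (Dom J u)). \<phi> (Cod J u) (Comp K (Dm u) g) = \<phi> (Dom J u) g)"
  have \<phi>u: "\<phi> k (Comp K (Dm u) g) = \<phi> i g" if "u \<in> hom J i k" "g \<in> hom K a (Do i)" for u i k g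
    using * that by (auto simp: hom_def[of J])
  have wd: "\<phi> i F = \<phi> j G" if i: "i \<in> Obj J" "F \<in> hom K a (Do i)" and j: "j \<in> Obj J" "G \<in> hom K a (Do j)"
    and e: "Comp K (l i) F = Comp K (l j) G" for i j F G
  proof -
    obtain k u v where "u \<in> hom J i k" "v \<in> hom J j k" "Comp K (Dm u) F = Comp K (Dm v) G"
      using colimit_factor_unique[OF a i j e] by blast
    then show ?thesis using \<phi>u i j by metis
  qed
  have "\<forall>F\<in>hom K a x. \<exists>p. fst p \<in> Obj J \<and> snd p \<in> hom K a (Do (fst p)) \<and> Comp K (l (fst p)) (snd p) = F"
    using colimit_factor[OF a] by force
  then obtain p where p: "\<And>F. F \<in> hom K a x \<Longrightarrow> fst (p F) \<in> Obj J \<and> snd (p F) \<in> hom K a (Do (fst (p F))) \<and>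
      Comp K (l (fst (p F))) (snd (p F)) = F" by metis
  let ?\<psi> = "restrict (\<lambda>F. \<phi> (fst (p F)) (snd (p F))) (hom K a x)"
  show "\<exists>!\<psi>. \<psi> \<in> hom K a x \<rightarrow>\<^sub>E X \<and> (\<forall>j \<in> Obj J. \<forall>g \<in> hom K a (Do j). \<psi> (Comp K (l j) g) = \<phi> j g)"
  proof (rule ex1I[of _ ?\<psi>])
    have "\<phi> (fst (p F)) (snd (p F)) \<in> X" if "F \<in> hom K a x" for F using p[OF that] * by blast
    then have "?\<psi> \<in> hom K a x \<rightarrow>\<^sub>E X" by (simp add: PiE_iff)
    moreover have "?\<psi> (Comp K (l j) g) = \<phi> j g" if j: "j \<in> Obj J" "g \<in> hom K a (Do j)" for j g
    proof -
      have h: "Comp K (l j) g \<in> hom K a x" by (rule Comp_K(1)[OF j(2) leg[OF j(1)]])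
      let ?q = "p (Comp K (l j) g)"
      have "\<phi> (fst ?q) (snd ?q) = \<phi> j g" using wd[of "fst ?q" "snd ?q" j g] p[OF h] j by blast
      then show ?thesis using h by (simp only: restrict_apply')
    qed
    ultimately show "?\<psi> \<in> hom K a x \<rightarrow>\<^sub>E X \<and> (\<forall>j \<in> Obj J. \<forall>g \<in> hom K a (Do j). ?\<psi> (Comp K (l j) g) = \<phi> j g)" by blast
    fix \<psi> assume \<psi>: "\<psi> \<in> hom K a x \<rightarrow>\<^sub>E X \<and> (\<forall>j \<in> Obj J. \<forall>g \<in> hom K a (Do j). \<psi> (Comp K (l j) g) = \<phi> j g)"
    show "\<psi> = ?\<psi>"
    proof (rule extensionalityI[of _ "hom K a x"])
      fix F assume F: "F \<in> hom K a x"
      have "\<psi> (Comp K (l (fst (p F))) (snd (p F))) = \<phi> (fst (p F)) (snd (p F))" using \<psi> p[OF F] by blast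
      then have "\<psi> F = \<phi> (fst (p F)) (snd (p F))" using p[OF F] by (simp only:)
      then show "\<psi> F = ?\<psi> F" using F by (simp only: restrict_apply')
    qed (use \<psi> in \<open>auto simp: PiE_def\<close>)
  qed
qed

end

end

context small_base
begin

lemma bounded_presentable:
  fixes \<kappa> :: "'u rel"
  assumes B: "infinite B" and \<kappa>: "\<forall>A :: 'u set. |A| <o \<kappa> \<longleftrightarrow> |A| \<le>o |B|"
    and a: "a \<in> Obj K" "|M a| \<le>o |B :: 'u set|"
  shows "presentable \<kappa> K a"
  unfolding presentable_def
proof (intro conjI allI impI a(1))
  fix J :: "('u, 'u) cat" and Do Dm x l
  assume *: "directed_poset \<kappa> J \<and> is_functor J K Do Dm \<and> colimit_cocone J K Do Dm x l"
  interpret directed_diagram U C J Do Dm B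
  proof
    show "small_category J" "is_functor J K Do Dm" "infinite B" using * B by (auto simp: directed_poset_def)
    show "u = v" if "u \<in> Mor J" "v \<in> Mor J" "Dom J u = Dom J v" "Cod J u = Cod J v" for u v
    proof -
      have "category J" using * by (simp add: directed_poset_def small_category_def)
      then have "Dom J u \<in> Obj J" "Cod J u \<in> Obj J" using that(1) unfolding category_def by blast+
      moreover have "\<forall>i\<in>Obj J. \<forall>j\<in>Obj J. \<forall>u\<in>hom J i j. \<forall>v\<in>hom J i j. u = v"
        using * by (simp add: directed_poset_def)
      moreover have "u \<in> hom J (Dom J u) (Cod J u)" "v \<in> hom J (Dom J u) (Cod J u)"
        using that by (auto simp: hom_def)
      ultimately show ?thesis by blast
    qed
    show "\<exists>b\<in>Obj J. \<forall>s\<in>S. hom J s b \<noteq> {}" if "S \<subseteq> Obj J" "|S| \<le>o |B|" for S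
      using * that \<kappa> by (auto simp: directed_poset_def)
  qed
  show "hom_preserves_colimit K a J Do Dm x l" using hom_preserves * a by blast
qed

section \<open>Local presentability\<close>

text \<open>The diagram shapes in \<open>locally_presentable\<close> have objects and arrows in
  \<open>'u\<close>, so a small poset of sets needs codes there: \<open>e\<close> for its members
  and \<open>a\<close> for the inclusions, the latter coded as pairs and hence decodable.\<close>

lemma inclusion_poset_category:
  assumes T: "sml (T :: 'a set set)"
  obtains J :: "('u, 'u) cat" and e :: "'a set \<Rightarrow> 'u" and a :: "'a set \<Rightarrow> 'a set \<Rightarrow> 'u" where
    "small_category J" "inj_on e T" "Obj J = e ` T"
    "\<And>u. u \<in> Mor J \<Longrightarrow> \<exists>N\<in>T. \<exists>N'\<in>T. N \<subseteq> N' \<and> u = a N N' \<and> Dom J u = e N \<and> Cod J u = e N'"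
    "\<And>N N'. N \<in> T \<Longrightarrow> N' \<in> T \<Longrightarrow> N \<subseteq> N' \<Longrightarrow> a N N' \<in> hom J (e N) (e N')"
    "\<And>N. N \<in> T \<Longrightarrow> Ident J (e N) = a N N"
    "\<And>N N' N''. N \<in> T \<Longrightarrow> N' \<in> T \<Longrightarrow> N'' \<in> T \<Longrightarrow> N \<subseteq> N' \<Longrightarrow> N' \<subseteq> N'' \<Longrightarrow>
       Comp J (a N' N'') (a N N') = a N N''"
    "\<And>N N' L L'. N \<in> T \<Longrightarrow> N' \<in> T \<Longrightarrow> L \<in> T \<Longrightarrow> L' \<in> T \<Longrightarrow> a N N' = a L L' \<longleftrightarrow> N = L \<and> N' = L'"
proof -
  obtain e :: "'a set \<Rightarrow> 'u" where e: "inj_on e T" using T by (rule small_embed)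
  obtain p :: "'a set \<times> 'a set \<Rightarrow> 'u" where p: "inj_on p (T \<times> T)" using small_Times[OF T T] by (rule small_embed)
  define a where "a N N' = p (N, N')" for N N'
  define le where "le = {(N, N'). N \<in> T \<and> N' \<in> T \<and> N \<subseteq> N'}"
  have sub: "le \<subseteq> T \<times> T" by (auto simp: le_def)
  let ?d = "inv_into (T \<times> T) p" and ?e = "inv_into T e"
  have d: "?d (a N N') = (N, N')" if "N \<in> T" "N' \<in> T" for N N' using p that by (simp add: a_def)
  have ee: "?e (e N) = N" if "N \<in> T" for N using e that by simp
  have e_iff: "e N = e N' \<longleftrightarrow> N = N'" if "N \<in> T" "N' \<in> T" for N N' using e that by (auto dest: inj_onD)
  define J where "J = \<lparr>Obj = e ` T, Mor = p ` le,
    Dom = restrict (\<lambda>u. e (fst (?d u))) (p ` le), Cod = restrict (\<lambda>u. e (snd (?d u))) (p ` le),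
    Ident = restrict (\<lambda>x. a (?e x) (?e x)) (e ` T),
    Comp = (\<lambda>v u. if u \<in> p ` le \<and> v \<in> p ` le \<and> fst (?d v) = snd (?d u) then a (fst (?d u)) (snd (?d v)) else undefined)\<rparr>"
  have Mor_J: "u \<in> Mor J \<longleftrightarrow> (\<exists>N\<in>T. \<exists>N'\<in>T. N \<subseteq> N' \<and> u = a N N')" for u
    by (auto simp: J_def le_def a_def)
  have a_in: "a N N' \<in> p ` le" if "N \<in> T" "N' \<in> T" "N \<subseteq> N'" for N N' using that by (auto simp: le_def a_def)
  have DC: "Dom J (a N N') = e N" "Cod J (a N N') = e N'" if "N \<in> T" "N' \<in> T" "N \<subseteq> N'" for N N'
    using that d a_in[OF that] by (simp_all add: J_def)
  have Id: "Ident J (e N) = a N N" if "N \<in> T" for N using that ee by (simp add: J_def)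
  have Cm: "Comp J (a N' N'') (a N N') = a N N''"
    if "N \<in> T" "N' \<in> T" "N'' \<in> T" "N \<subseteq> N'" "N' \<subseteq> N''" for N N' N''
    using that d a_in by (simp add: J_def)
  have O: "Obj J = e ` T" by (simp add: J_def)
  have cJ: "category J"
    unfolding category_def hom_def O
    by (auto simp: Mor_J DC Id Cm e_iff) (metis Mor_J DC Cm subset_trans order_refl)+
  have sle: "sml (p ` le)" by (rule small_image[OF small_subset[OF sub small_Times[OF T T]]])
  have und: "\<And>u v. \<not> (u \<in> Mor J \<and> v \<in> Mor J \<and> Dom J v = Cod J u) \<Longrightarrow> Comp J v u = undefined"
  proof -
    fix u v assume n: "\<not> (u \<in> Mor J \<and> v \<in> Mor J \<and> Dom J v = Cod J u)"
    have "\<not> (u \<in> p ` le \<and> v \<in> p ` le \<and> fst (?d v) = snd (?d u))"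
    proof
      assume "u \<in> p ` le \<and> v \<in> p ` le \<and> fst (?d v) = snd (?d u)"
      then have "u \<in> Mor J \<and> v \<in> Mor J \<and> Dom J v = Cod J u" by (simp add: J_def)
      then show False using n by blast
    qed
    then show "Comp J v u = undefined" unfolding J_def by auto
  qed
  have ext: "Dom J \<in> extensional (Mor J)" "Cod J \<in> extensional (Mor J)" "Ident J \<in> extensional (Obj J)"
    "Mor J = p ` le" by (simp_all add: J_def)
  have "small_category J"
    unfolding small_category_def small_TYPE
    by (intro conjI allI impI cJ ext und) (simp_all add: sle small_image T O ext(4))
  moreover have "a N N' = a L L' \<longleftrightarrow> N = L \<and> N' = L'"
    if "N \<in> T" "N' \<in> T" "L \<in> T" "L' \<in> T" for N N' L L'
    using d[OF that(1,2)] d[OF that(3,4)] by (metis Pair_inject)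
  moreover have "a N N' \<in> hom J (e N) (e N')" if "N \<in> T" "N' \<in> T" "N \<subseteq> N'" for N N'
    using that DC Mor_J by (auto simp: hom_def)
  moreover have "\<exists>N\<in>T. \<exists>N'\<in>T. N \<subseteq> N' \<and> u = a N N' \<and> Dom J u = e N \<and> Cod J u = e N'" if "u \<in> Mor J" for u
    using that DC unfolding Mor_J by blast
  ultimately show thesis using that[of J e a] e O Id Cm by blast
qed

text \<open>Every category is the union of its subcategories with at most |B| arrows. At most |B| of
  these lie in another one, the subcategory generated by their union. Any two arrows lie in a common
  one, so compatible functors on the pieces glue.\<close>

lemma directed_union_of_bounded:
  fixes \<kappa> :: "'u rel" and B :: "'u set"
  assumes B: "infinite B" and \<kappa>: "\<forall>A :: 'u set. |A| <o \<kappa> \<longleftrightarrow> |A| \<le>o |B|" and P: "P \<in> Obj K"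
  shows "\<exists>(J :: ('u, 'u) cat) Do Dm l. directed_poset \<kappa> J \<and> is_functor J K Do Dm \<and>
    (\<forall>j \<in> Obj J. Do j \<in> carried_by B) \<and> colimit_cocone J K Do Dm P l"
proof -
  note oP = over_view[OF P]
  define T where "T = {N. closed (view P) N \<and> |N| \<le>o |B|}"
  have TM: "N \<subseteq> M P" "closed (view P) N" "|N| \<le>o |B|" if "N \<in> T" for N
    using that by (auto simp: T_def closed_def)
  have "T \<subseteq> Pow (M P)" using TM(1) by blast
  then have sT: "sml T" by (rule small_subset[OF _ small_Pow[OF small_view[OF P]]])
  have gen_T: "generated (view P) A \<in> T" "A \<subseteq> generated (view P) A" if "A \<subseteq> M P" "|A| \<le>o |B|" for A
    using generated[OF oP that(1)] bounded_generated[OF oP B that] by (auto simp: T_def)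
  obtain J :: "('u, 'u) cat" and e :: "'u set \<Rightarrow> 'u" and a :: "'u set \<Rightarrow> 'u set \<Rightarrow> 'u" where
    J: "small_category J" and e: "inj_on e T" and O: "Obj J = e ` T"
    and MorJ: "\<And>u. u \<in> Mor J \<Longrightarrow> \<exists>N\<in>T. \<exists>N'\<in>T. N \<subseteq> N' \<and> u = a N N' \<and> Dom J u = e N \<and> Cod J u = e N'"
    and a: "\<And>N N'. N \<in> T \<Longrightarrow> N' \<in> T \<Longrightarrow> N \<subseteq> N' \<Longrightarrow> a N N' \<in> hom J (e N) (e N')"
    and Id: "\<And>N. N \<in> T \<Longrightarrow> Ident J (e N) = a N N"
    and Cm: "\<And>N N' N''. N \<in> T \<Longrightarrow> N' \<in> T \<Longrightarrow> N'' \<in> T \<Longrightarrow> N \<subseteq> N' \<Longrightarrow> N' \<subseteq> N'' \<Longrightarrow>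
       Comp J (a N' N'') (a N N') = a N N''"
    and a_iff: "\<And>N N' L L'. N \<in> T \<Longrightarrow> N' \<in> T \<Longrightarrow> L \<in> T \<Longrightarrow> L' \<in> T \<Longrightarrow> a N N' = a L L' \<longleftrightarrow> N = L \<and> N' = L'"
    by (rule inclusion_poset_category[OF sT]) blast
  have e_iff: "e N = e N' \<longleftrightarrow> N = N'" if "N \<in> T" "N' \<in> T" for N N' using e that by (auto dest: inj_onD)
  have "\<forall>N\<in>T. \<exists>p. fst p \<in> carried_by B \<and> snd p \<in> hom K (fst p) P \<and> inj_on (act (snd p)) (M (fst p)) \<and> act (snd p) ` M (fst p) = N"
  proof
    fix N assume N: "N \<in> T"
    obtain S i where "S \<in> carried_by B" "i \<in> hom K S P" "inj_on (act i) (M S)" "act i ` M S = N"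
      by (rule sub_carried_by[OF P TM(2,3)[OF N]])
    then show "\<exists>p. fst p \<in> carried_by B \<and> snd p \<in> hom K (fst p) P \<and> inj_on (act (snd p)) (M (fst p)) \<and> act (snd p) ` M (fst p) = N"
      by (intro exI[of _ "(S, i)"]) simp
  qed
  from bchoice[OF this] obtain p where p: "\<forall>N\<in>T. fst (p N) \<in> carried_by B \<and> snd (p N) \<in> hom K (fst (p N)) P \<and>
    inj_on (act (snd (p N))) (M (fst (p N))) \<and> act (snd (p N)) ` M (fst (p N)) = N" by blast
  define S where "S N = fst (p N)" for N
  define i where "i N = snd (p N)" for N
  have S: "S N \<in> carried_by B" and i: "i N \<in> hom K (S N) P" "inj_on (act (i N)) (M (S N))" "act (i N) ` M (S N) = N"
    if "N \<in> T" for N using p that by (auto simp: S_def i_def)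
  have "\<exists>q \<in> hom K (S N) (S N'). Comp K (i N') q = i N" if "N \<in> T" "N' \<in> T" "N \<subseteq> N'" for N N'
  proof -
    have "act (i N) ` M (S N) \<subseteq> act (i N') ` M (S N')" using i(3) that by simp
    then show ?thesis using factor_through_sub[OF i(1,2)[OF that(2)] i(1)[OF that(1)]] by blast
  qed
  then obtain q where q: "\<And>N N'. N \<in> T \<Longrightarrow> N' \<in> T \<Longrightarrow> N \<subseteq> N' \<Longrightarrow> q N N' \<in> hom K (S N) (S N')"
    and iq: "\<And>N N'. N \<in> T \<Longrightarrow> N' \<in> T \<Longrightarrow> N \<subseteq> N' \<Longrightarrow> Comp K (i N') (q N N') = i N" by metis
  define Do where "Do x = S (inv_into T e x)" for x
  define d where "d = inv_into (T \<times> T) (\<lambda>(N, N'). a N N')"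
  have da: "d (a N N') = (N, N')" if "N \<in> T" "N' \<in> T" for N N'
  proof -
    have "inj_on (\<lambda>(N, N'). a N N') (T \<times> T)" using a_iff by (auto simp: inj_on_def)
    from inv_into_f_f[OF this, of "(N, N')"] that show ?thesis by (simp add: d_def)
  qed
  define Dm where "Dm u = q (fst (d u)) (snd (d u))" for u
  define l where "l x = i (inv_into T e x)" for x
  have Do: "Do (e N) = S N" and le: "l (e N) = i N" if "N \<in> T" for N using e that by (simp_all add: Do_def l_def)
  have Dma: "Dm (a N N') = q N N'" if "N \<in> T" "N' \<in> T" for N N' using da[OF that] by (simp add: Dm_def)
  have fnc: "is_functor J K Do Dm"
    unfolding is_functor_def
  proof (intro conjI ballI impI)
    fix x assume "x \<in> Obj J"
    then obtain N where N: "N \<in> T" "x = e N" using O by blast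
    note SO = carried_by_Obj[OF S[OF N(1)]]
    show "Do x \<in> Obj K" using N Do SO by simp
    have "q N N = Ident K (S N)"
      using mono_of_inj[OF i(1,2)[OF N(1)] q[OF N(1) N(1)] Ident_K(1)[OF SO]] iq[OF N(1) N(1)]
        K_unit(1)[OF i(1)[OF N(1)]] by simp
    then show "Dm (Ident J x) = Ident K (Do x)" using N Id Dma Do by simp
  next
    fix u assume "u \<in> Mor J"
    then obtain N N' where N: "N \<in> T" "N' \<in> T" "N \<subseteq> N'" and u: "u = a N N'" "Dom J u = e N" "Cod J u = e N'"
      using MorJ by blast
    show "Dm u \<in> hom K (Do (Dom J u)) (Do (Cod J u))"
      unfolding u(2,3) using q[OF N] N u(1) Dma Do by simp
    fix v assume v: "v \<in> Mor J" and vu: "Dom J v = Cod J u"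
    obtain L L' where L: "L \<in> T" "L' \<in> T" "L \<subseteq> L'" and v: "v = a L L'" "Dom J v = e L" "Cod J v = e L'"
      using MorJ[OF v] by blast
    have "L = N'" using vu u v e_iff L N by simp
    then have L: "L = N'" "N' \<in> T" "L' \<in> T" "N' \<subseteq> L'" using L by auto
    have NL: "N \<subseteq> L'" using N L by blast
    have "q N L' = Comp K (q N' L') (q N N')"
    proof (rule mono_of_inj[OF i(1,2)[OF L(3)] q[OF N(1) L(3) NL] Comp_K(1)[OF q[OF N] q[OF L(2,3,4)]]])
      show "Comp K (i L') (q N L') = Comp K (i L') (Comp K (q N' L') (q N N'))"
        using K_assoc[OF q[OF N] q[OF L(2,3,4)] i(1)[OF L(3)]] iq[OF N] iq[OF L(2,3,4)] iq[OF N(1) L(3) NL] by simp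
    qed
    then show "Dm (Comp J v u) = Comp K (Dm v) (Dm u)"
      unfolding u(1) v(1) L(1) Cm[OF N(1,2) L(3) N(3) L(4)] using Dma N L by simp
  qed
  have dp: "directed_poset \<kappa> J"
    unfolding directed_poset_def
  proof (intro conjI ballI impI allI J)
    fix x y u v assume "u \<in> hom J x y" "v \<in> hom J x y"
    then obtain N N' L L' where "N \<in> T" "N' \<in> T" "L \<in> T" "L' \<in> T" "u = a N N'" "v = a L L'" "e N = e L" "e N' = e L'"
      using MorJ[of u] MorJ[of v] unfolding hom_def by fastforce
    then show "u = v" using e_iff by simp
  next
    fix x y assume "hom J x y \<noteq> {} \<and> hom J y x \<noteq> {}"
    then obtain u v where u: "u \<in> Mor J" "Dom J u = x" "Cod J u = y" and v: "v \<in> Mor J" "Dom J v = y" "Cod J v = x"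
      by (auto simp: hom_def)
    obtain N N' where N: "N \<in> T" "N' \<in> T" "N \<subseteq> N'" "x = e N" "y = e N'" using MorJ[OF u(1)] u(2,3) by auto
    obtain L L' where L: "L \<in> T" "L' \<in> T" "L \<subseteq> L'" "y = e L" "x = e L'" using MorJ[OF v(1)] v(2,3) by auto
    have "L = N'" "L' = N" using e_iff[OF L(1) N(2)] e_iff[OF L(2) N(1)] N L by auto
    then have "N = N'" using N(3) L(3) by blast
    then show "x = y" using N by simp
  next
    fix V assume V: "V \<subseteq> Obj J \<and> |V| <o \<kappa>"
    then have VB: "|V| \<le>o |B|" using \<kappa> by blast
    let ?N = "\<Union>x\<in>V. inv_into T e x"
    have inT: "inv_into T e x \<in> T" if "x \<in> V" for x using V that O e by (auto intro: inv_into_into)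
    have "?N \<subseteq> M P" using inT TM(1) by blast
    moreover have "|?N| \<le>o |B|" using bounded_UN[OF B VB] inT TM(3) by blast
    ultimately have g: "generated (view P) ?N \<in> T" "?N \<subseteq> generated (view P) ?N" using gen_T by blast+
    show "\<exists>b\<in>Obj J. \<forall>s\<in>V. hom J s b \<noteq> {}"
    proof (intro bexI ballI)
      show "e (generated (view P) ?N) \<in> Obj J" using g O by blast
      fix s assume s: "s \<in> V"
      have "e (inv_into T e s) = s" using V s O by (auto intro: f_inv_into_f)
      moreover have "inv_into T e s \<subseteq> generated (view P) ?N" using g(2) s by blast
      ultimately show "hom J s (e (generated (view P) ?N)) \<noteq> {}" using a[OF inT[OF s] g(1)] by auto
    qed
  qed
  have DoS: "\<forall>j \<in> Obj J. Do j \<in> carried_by B" using O Do S by auto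
  have cone: "cocone J K Do Dm P l"
    unfolding cocone_def
  proof (intro conjI ballI P)
    fix j assume "j \<in> Obj J"
    then show "l j \<in> hom K (Do j) P" using O Do le i(1) by auto
  next
    fix u assume "u \<in> Mor J"
    then obtain N N' where N: "N \<in> T" "N' \<in> T" "N \<subseteq> N'" and u: "u = a N N'" "Dom J u = e N" "Cod J u = e N'"
      using MorJ by blast
    show "Comp K (l (Cod J u)) (Dm u) = l (Dom J u)"
      unfolding u(2,3) using iq[OF N] N u(1) Dma le by simp
  qed
  have "\<exists>!h. h \<in> hom K P y \<and> (\<forall>j \<in> Obj J. Comp K h (l j) = m j)" if c: "cocone J K Do Dm y m" for y m
  proof -
    have y: "y \<in> Obj K" using c by (simp add: cocone_def)
    have m: "m (e N) \<in> hom K (S N) y" if "N \<in> T" for N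
      using c that O Do by (auto simp: cocone_def)
    have mq: "Comp K (m (e N')) (q N N') = m (e N)" if N: "N \<in> T" "N' \<in> T" "N \<subseteq> N'" for N N'
    proof -
      have "a N N' \<in> Mor J" "Dom J (a N N') = e N" "Cod J (a N N') = e N'" using a[OF N] by (auto simp: hom_def)
      then show ?thesis using c Dma N unfolding cocone_def by fastforce
    qed
    \<comment> \<open>The leg of the cocone at \<open>N\<close>, read as a function on the set of
      arrows \<open>N\<close> itself.\<close>
    define v where "v N f = act (m (e N)) (inv_into (M (S N)) (act (i N)) f)" for N f
    have vi: "v N (act (i N) s) = act (m (e N)) s" if "N \<in> T" "s \<in> M (S N)" for N s
      using i(2)[OF that(1)] that(2) by (simp add: v_def)
    have v_omor: "omor (view P\<lparr>Ar := N\<rparr>) (view y) (v N)" if N: "N \<in> T" for N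
    proof -
      note SO = over_view[OF carried_by_Obj[OF S[OF N]]]
      have "omor (view (S N)) (view P\<lparr>Ar := N\<rparr>) (act (i N))"
        by (rule omor_into_restrict[OF act_omor[OF i(1)[OF N]]]) (use i(3) N in auto)
      moreover have "bij_betw (act (i N)) (M (S N)) (Ar (view P\<lparr>Ar := N\<rparr>))"
        using i(2,3) N by (simp add: bij_betw_def)
      ultimately have "omor (view P\<lparr>Ar := N\<rparr>) (view (S N)) (inv_into (M (S N)) (act (i N)))"
        by (rule omor_inverse[OF SO])
      from omor_compose[OF over_restrict[OF oP TM(2)[OF N]] this act_omor[OF m[OF N]]]
      show ?thesis by (simp add: v_def[abs_def])
    qed
    have v_mono: "v N' f = v N f" if N: "N \<in> T" "N' \<in> T" "N \<subseteq> N'" and f: "f \<in> N" for N N' f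
    proof -
      obtain s where s: "s \<in> M (S N)" "f = act (i N) s" using f i(3)[OF N(1)] by blast
      have qs: "act (q N N') s \<in> M (S N')" by (rule act_in[OF q[OF N] s(1)])
      have "act (i N') (act (q N N') s) = f"
        using Comp_K(2)[OF q[OF N] i(1)[OF N(2)] s(1)] iq[OF N] s(2) by simp
      then have "v N' f = act (m (e N')) (act (q N N') s)" using vi[OF N(2) qs] by simp
      also have "\<dots> = act (m (e N)) s" using Comp_K(2)[OF q[OF N] m[OF N(2)] s(1)] mq[OF N] by simp
      finally show ?thesis using vi[OF N(1) s(1)] s(2) by simp
    qed
    \<comment> \<open>Each arrow is evaluated in the smallest subcategory containing it;
      \<open>h_eq\<close> shows that every other member of \<open>T\<close> containing it gives the
      same value.\<close>
    define h where "h f = v (generated (view P) {f}) f" for f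
    have h_eq: "h f = v N f" if N: "N \<in> T" "f \<in> N" for N f
    proof -
      have fM: "{f} \<subseteq> M P" using TM(1)[OF N(1)] N(2) by blast
      have g: "generated (view P) {f} \<in> T" "f \<in> generated (view P) {f}" "generated (view P) {f} \<subseteq> N"
        using gen_T[OF fM bounded_finite[OF B]] generated(3)[OF oP fM TM(2)[OF N(1)]] N(2) by auto
      show ?thesis unfolding h_def by (rule v_mono[OF g(1) N(1) g(3,2), symmetric])
    qed
    have cover: "\<exists>N\<in>T. f \<in> N \<and> g \<in> N" if "f \<in> M P" "g \<in> M P" for f g
      using gen_T[of "{f, g}"] bounded_finite[OF B, of "{f, g}"] that by auto
    have h: "omor (view P) (view y) h"
      unfolding omor_def
    proof (intro conjI ballI impI)
      fix f assume f: "f \<in> M P"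
      obtain N where N: "N \<in> T" "f \<in> N" using cover[OF f f] by blast
      have cl: "dm (view P) f \<in> N" "cd (view P) f \<in> N" using closedD(2,3)[OF TM(2)[OF N(1)] N(2)] by auto
      show "h f \<in> M y" "h (dm (view P) f) = dm (view y) (h f)" "h (cd (view P) f) = cd (view y) (h f)"
        "pr (view y) (h f) = pr (view P) f"
        using omorD[OF v_omor[OF N(1)], of f] N cl h_eq by auto
    next
      fix f g assume fg: "f \<in> M P" "g \<in> M P" "dm (view P) g = cd (view P) f"
      obtain N where N: "N \<in> T" "f \<in> N" "g \<in> N" using cover[OF fg(1,2)] by blast
      have cl: "cm (view P) g f \<in> N" using closedD(4)[OF TM(2)[OF N(1)] N(2,3) fg(3)] .
      show "h (cm (view P) g f) = cm (view y) (h g) (h f)"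
        using omor_comp[OF v_omor[OF N(1)], of f g] N cl fg h_eq by auto
    qed
    have hK: "mk P y h \<in> hom K P y" by (rule mk_hom[OF P y h])
    show ?thesis
    proof (rule ex1I[of _ "mk P y h"])
      have "Comp K (mk P y h) (i N) = m (e N)" if N: "N \<in> T" for N
      proof (rule hom_eqI[OF Comp_K(1)[OF i(1)[OF N] hK] m[OF N]])
        fix s assume s: "s \<in> M (S N)"
        have iS: "act (i N) s \<in> N" "act (i N) s \<in> M P" using i(3)[OF N] s TM(1)[OF N] by auto
        then show "act (Comp K (mk P y h) (i N)) s = act (m (e N)) s"
          using Comp_K(2)[OF i(1)[OF N] hK s] h_eq[OF N iS(1)] vi[OF N s] by simp
      qed
      then show "mk P y h \<in> hom K P y \<and> (\<forall>j \<in> Obj J. Comp K (mk P y h) (l j) = m j)"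
        using hK O le by auto
    next
      fix k assume k: "k \<in> hom K P y \<and> (\<forall>j \<in> Obj J. Comp K k (l j) = m j)"
      show "k = mk P y h"
      proof (rule hom_eqI[OF _ hK])
        show kK: "k \<in> hom K P y" using k by blast
        fix f assume f: "f \<in> M P"
        obtain N where N: "N \<in> T" "f \<in> N" using cover[OF f f] by blast
        obtain s where s: "s \<in> M (S N)" "f = act (i N) s" using N i(3)[OF N(1)] by blast
        have "Comp K k (i N) = m (e N)" using k O N(1) le by auto
        then have "act k f = act (m (e N)) s" using Comp_K(2)[OF i(1)[OF N(1)] kK s(1)] s(2) by simp
        then show "act k f = act (mk P y h) f" using f h_eq[OF N] vi[OF N(1) s(1)] s(2) by simp
      qed
    qed
  qed
  then have "colimit_cocone J K Do Dm P l" using cone unfolding colimit_cocone_def by blast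
  then show ?thesis using dp fnc DoS by blast
qed

lemma locally_presentable_K: "locally_presentable U K"
proof -
  obtain B :: "'u set" where B: "infinite B" "sml B"
    using infinite_bound_exists[OF small_nat] by blast
  obtain \<kappa> :: "'u rel" where \<kappa>: "small_regular_cardinal \<kappa>" "\<forall>A :: 'u set. |A| <o \<kappa> \<longleftrightarrow> |A| \<le>o |B|"
    using regular_cardinal_exists[OF universe B(1)] B(2) by (auto simp: small_TYPE)
  have "\<forall>s \<in> carried_by B. presentable \<kappa> K s"
    using bounded_presentable[OF B(1) \<kappa>(2)] carried_by_Obj carried_by_bounded by blast
  moreover have "\<forall>x \<in> Obj K. \<exists>(J :: ('u, 'u) cat) Do Dm l. directed_poset \<kappa> J \<and> is_functor J K Do Dm \<and>
    (\<forall>j \<in> Obj J. Do j \<in> carried_by B) \<and> colimit_cocone J K Do Dm x l"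
    using directed_union_of_bounded[OF B(1) \<kappa>(2)] by blast
  moreover have "locally_small U K" by (simp add: locally_small_def small_hom)
  ultimately show ?thesis
    unfolding locally_presentable_def using category_K cocomplete_K \<kappa>(1) small_carried_by[OF B(2)] by blast
qed

end

section \<open>The reflection into discrete fibrations\<close>

text \<open>An arrow \<open>e\<close> with \<open>cd X e = e\<close> is an identity and stands for
  an object; \<open>dfib_view\<close> confirms that this is the usual notion.\<close>

definition dfib :: "('o, 'c) cat \<Rightarrow> ('m, 'c) overcat \<Rightarrow> bool" where
  "dfib C X \<longleftrightarrow> (\<forall>e \<in> Ar X. cd X e = e \<longrightarrow> (\<forall>u \<in> Mor C. Ident C (Cod C u) = pr X e \<longrightarrow>
     (\<exists>!g. g \<in> Ar X \<and> cd X g = e \<and> pr X g = u)))"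

definition lift :: "('m, 'c) overcat \<Rightarrow> 'c \<Rightarrow> 'm \<Rightarrow> 'm" where
  "lift X u e = (THE g. g \<in> Ar X \<and> cd X g = e \<and> pr X g = u)"

text \<open>A discrete fibration is a presheaf on the base, whose restriction map along
  \<open>u\<close> takes an object over the codomain of \<open>u\<close> to the domain of the lift
  of \<open>u\<close>.\<close>

abbreviation restr :: "('m, 'c) overcat \<Rightarrow> 'c \<Rightarrow> 'm \<Rightarrow> 'm" where
  "restr X u e \<equiv> dm X (lift X u e)"

text \<open>
  The pairs \<open>(f, a)\<close> with \<open>f : c \<rightarrow> P a\<close> are the objects of the comma categories \<open>c/P\<close>, and \<open>conn\<close>
  relates those in the same connected component of \<open>c/P\<close>.
\<close>

definition El :: "('o, 'c) cat \<Rightarrow> ('m, 'c) overcat \<Rightarrow> ('c \<times> 'm) set" where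
  "El C X = {(f, a). f \<in> Mor C \<and> a \<in> Ar X \<and> cd X a = a \<and> pr X a = Ident C (Cod C f)}"

inductive conn :: "('o, 'c) cat \<Rightarrow> ('m, 'c) overcat \<Rightarrow> 'c \<times> 'm \<Rightarrow> 'c \<times> 'm \<Rightarrow> bool" for C X where
  conn_refl: "p \<in> El C X \<Longrightarrow> conn C X p p"
| conn_step: "g \<in> Ar X \<Longrightarrow> f \<in> Mor C \<Longrightarrow> Cod C f = Dom C (pr X g) \<Longrightarrow>
    conn C X (f, dm X g) (Comp C (pr X g) f, cd X g)"
| conn_sym: "conn C X p q \<Longrightarrow> conn C X q p"
| conn_trans: "conn C X p q \<Longrightarrow> conn C X q r \<Longrightarrow> conn C X p r"

context small_base
begin

lemma Ident_C_eq: "x \<in> Obj C \<Longrightarrow> y \<in> Obj C \<Longrightarrow> Ident C x = Ident C y \<longleftrightarrow> x = y"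
  using C_Ident(2) by metis

lemma dfib_view:
  assumes "P \<in> Obj K"
  shows "discrete_fibration P \<longleftrightarrow> dfib C (view P)"
proof -
  define A where "A = src P"
  have tC: "tgt P = C" and A: "category A" and fn: "is_functor A C (omap P) (amap P)"
    using assms by (auto simp: Obj_K small_functor_def small_category_def A_def)
  have i: "Ident A x \<in> Mor A" "Dom A (Ident A x) = x" "Cod A (Ident A x) = x" if "x \<in> Obj A" for x
    using A that by (auto simp: category_def hom_def)
  have inj: "Ident A x = Ident A y \<longleftrightarrow> x = y" if "x \<in> Obj A" "y \<in> Obj A" for x y
    using that i by metis
  have a: "Dom A f \<in> Obj A" "Cod A f \<in> Obj A" if "f \<in> Mor A" for f
    using A that by (auto simp: category_def)
  have p: "amap P (Ident A x) = Ident C (omap P x)" "omap P x \<in> Obj C" if "x \<in> Obj A" for x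
    using fn that by (auto simp: is_functor_def)
  let ?U = "\<lambda>u x. \<exists>!g. g \<in> Mor A \<and> Cod A g = x \<and> amap P g = u"
  have "dfib C (view P) \<longleftrightarrow> (\<forall>e \<in> Mor A. Ident A (Cod A e) = e \<longrightarrow> (\<forall>u \<in> Mor C. Ident C (Cod C u) = amap P e \<longrightarrow>
     (\<exists>!g. g \<in> Mor A \<and> Ident A (Cod A g) = e \<and> amap P g = u)))"
    by (simp add: dfib_def view_def A_def)
  also have "\<dots> \<longleftrightarrow> (\<forall>x \<in> Obj A. \<forall>u \<in> Mor C. Cod C u = omap P x \<longrightarrow> ?U u x)"
  proof
    assume *: "\<forall>e \<in> Mor A. Ident A (Cod A e) = e \<longrightarrow> (\<forall>u \<in> Mor C. Ident C (Cod C u) = amap P e \<longrightarrow>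
     (\<exists>!g. g \<in> Mor A \<and> Ident A (Cod A g) = e \<and> amap P g = u))"
    show "\<forall>x \<in> Obj A. \<forall>u \<in> Mor C. Cod C u = omap P x \<longrightarrow> ?U u x"
    proof (intro ballI impI)
      fix x u assume x: "x \<in> Obj A" and u: "u \<in> Mor C" "Cod C u = omap P x"
      have "\<exists>!g. g \<in> Mor A \<and> Ident A (Cod A g) = Ident A x \<and> amap P g = u"
        using * i[OF x] p[OF x] u by metis
      moreover have "(g \<in> Mor A \<and> Ident A (Cod A g) = Ident A x \<and> amap P g = u) =
        (g \<in> Mor A \<and> Cod A g = x \<and> amap P g = u)" for g using inj[OF _ x] a by blast
      ultimately show "?U u x" by simp
    qed
  next
    assume *: "\<forall>x \<in> Obj A. \<forall>u \<in> Mor C. Cod C u = omap P x \<longrightarrow> ?U u x"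
    show "\<forall>e \<in> Mor A. Ident A (Cod A e) = e \<longrightarrow> (\<forall>u \<in> Mor C. Ident C (Cod C u) = amap P e \<longrightarrow>
     (\<exists>!g. g \<in> Mor A \<and> Ident A (Cod A g) = e \<and> amap P g = u))"
    proof (intro ballI impI)
      fix e u assume e: "e \<in> Mor A" "Ident A (Cod A e) = e" and u: "u \<in> Mor C" "Ident C (Cod C u) = amap P e"
      let ?x = "Cod A e"
      have x: "?x \<in> Obj A" using a e by blast
      have "Ident C (Cod C u) = Ident C (omap P ?x)" using p(1)[OF x] e u by simp
      then have "Cod C u = omap P ?x" using Ident_C_eq p(2)[OF x] u by simp
      then have "?U u ?x" using * x u by blast
      moreover have "(g \<in> Mor A \<and> Ident A (Cod A g) = e \<and> amap P g = u) =
        (g \<in> Mor A \<and> Cod A g = ?x \<and> amap P g = u)" for g using inj[OF _ x] a e(2) by metis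
      ultimately show "\<exists>!g. g \<in> Mor A \<and> Ident A (Cod A g) = e \<and> amap P g = u" by simp
    qed
  qed
  also have "\<dots> \<longleftrightarrow> discrete_fibration P" by (simp add: discrete_fibration_def A_def tC)
  finally show ?thesis by blast
qed

section \<open>Points of the comma categories and their components\<close>

lemma ElI: "f \<in> Mor C \<Longrightarrow> a \<in> Ar X \<Longrightarrow> cd X a = a \<Longrightarrow> pr X a = Ident C (Cod C f) \<Longrightarrow> (f, a) \<in> El C X"
  by (simp add: El_def)

lemma ElD: 
  assumes "p \<in> El C X"
  shows "fst p \<in> Mor C" "snd p \<in> Ar X" "cd X (snd p) = snd p" "pr X (snd p) = Ident C (Cod C (fst p))"
    "Ident C (Cod C (fst p)) = pr X (snd p)"
  using assms by (auto simp: El_def)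

lemma El_id: "over C X \<Longrightarrow> a \<in> Ar X \<Longrightarrow> cd X a = a \<Longrightarrow> (pr X a, a) \<in> El C X"
  using overD(9,11)[of C X a] by (intro ElI) auto

lemma dm_identity: "over C X \<Longrightarrow> a \<in> Ar X \<Longrightarrow> cd X a = a \<Longrightarrow> dm X a = a"
  using overD(5)[of C X a] by simp

lemma El_precomp:
  assumes "p \<in> El C X" "u \<in> Mor C" "Cod C u = Dom C (fst p)"
  shows "(Comp C (fst p) u, snd p) \<in> El C X"
  using assms by (auto simp: El_def)

lemma El_omor: "omor X Y \<phi> \<Longrightarrow> p \<in> El C X \<Longrightarrow> (fst p, \<phi> (snd p)) \<in> El C Y"
  using omorD[of X Y \<phi> "snd p"] by (auto simp: El_def)

lemma conn_in:
  assumes X: "over C X" and "conn C X p q"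
  shows "p \<in> El C X \<and> q \<in> El C X \<and> Dom C (fst p) = Dom C (fst q)"
  using assms(2)
proof induction
  case (conn_step g f)
  then show ?case using overD[OF X, of g] by (auto simp: El_def)
qed auto

text \<open>Precomposition with \<open>u\<close> is a functor between comma categories. Hence the
  components form a presheaf on the base, which is the one underlying the reflection.\<close>

lemma conn_precomp:
  assumes X: "over C X" and "conn C X p q" "u \<in> Mor C" "Cod C u = Dom C (fst p)"
  shows "conn C X (Comp C (fst p) u, snd p) (Comp C (fst q) u, snd q)"
  using assms(2-)
proof induction
  case (conn_refl p)
  then show ?case using El_precomp conn.conn_refl by blast
next
  case (conn_step g f)
  have g: "pr X g \<in> Mor C" using overD(9)[OF X conn_step(1)] .
  have "conn C X (Comp C f u, dm X g) (Comp C (pr X g) (Comp C f u), cd X g)"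
    using conn_step by (intro conn.conn_step) auto
  then show ?case using conn_step g C_assoc by simp
next
  case (conn_sym p q)
  then show ?case using conn_in[OF X] conn.conn_sym by metis
next
  case (conn_trans p q r)
  then show ?case using conn_in[OF X conn_trans(1)] conn.conn_trans by metis
qed

lemma conn_omor:
  assumes X: "over C X" and \<phi>: "omor X Y \<phi>" and "conn C X p q"
  shows "conn C Y (fst p, \<phi> (snd p)) (fst q, \<phi> (snd q))"
  using assms(3)
proof induction
  case (conn_refl p)
  then show ?case using El_omor[OF \<phi>] conn.conn_refl by blast
next
  case (conn_step g f)
  then show ?case using conn.conn_step[of "\<phi> g" Y f C] omorD[OF \<phi> conn_step(1)] by simp
qed (auto intro: conn.conn_sym conn.conn_trans)

text \<open>A zigzag consists of finitely many arrows and survives in every subcategory containing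
  them. This finiteness is what allows zigzags to be adjoined without leaving the bound |B|.\<close>

lemma conn_finite:
  assumes X: "over C X" and "conn C X p q"
  shows "\<exists>F. finite F \<and> F \<subseteq> Ar X \<and> (\<forall>N. closed X N \<longrightarrow> F \<subseteq> N \<longrightarrow> conn C (X\<lparr>Ar := N\<rparr>) p q)"
  using assms(2)
proof induction
  case (conn_refl p)
  then show ?case by (intro exI[of _ "{snd p}"]) (auto simp: El_def intro!: conn.conn_refl)
next
  case (conn_step g f)
  have "conn C (X\<lparr>Ar := N\<rparr>) (f, dm X g) (Comp C (pr X g) f, cd X g)" if "g \<in> N" for N
    using conn.conn_step[of g "X\<lparr>Ar := N\<rparr>" f C] conn_step that by simp
  then show ?case using conn_step(1) by (intro exI[of _ "{g}"]) simp
next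
  case (conn_sym p q)
  then obtain F where "finite F" "F \<subseteq> Ar X" "\<forall>N. closed X N \<longrightarrow> F \<subseteq> N \<longrightarrow> conn C (X\<lparr>Ar := N\<rparr>) p q"
    by blast
  then show ?case by (intro exI[of _ F]) (simp add: conn.conn_sym)
next
  case (conn_trans p q r)
  then obtain F G where FG: "finite F" "F \<subseteq> Ar X" "finite G" "G \<subseteq> Ar X" and "\<forall>N. closed X N \<longrightarrow> F \<subseteq> N \<longrightarrow> conn C (X\<lparr>Ar := N\<rparr>) p q"
    "\<forall>N. closed X N \<longrightarrow> G \<subseteq> N \<longrightarrow> conn C (X\<lparr>Ar := N\<rparr>) q r" by blast
  then have "conn C (X\<lparr>Ar := N\<rparr>) p r" if "closed X N" "F \<union> G \<subseteq> N" for N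
    using that conn.conn_trans by (metis le_sup_iff)
  then show ?case using FG by (intro exI[of _ "F \<union> G"]) simp
qed

section \<open>Functors into discrete fibrations\<close>

lemma lift:
  assumes Q: "dfib C Q" and e: "e \<in> Ar Q" "cd Q e = e" and u: "u \<in> Mor C" "Ident C (Cod C u) = pr Q e"
  shows "lift Q u e \<in> Ar Q" "cd Q (lift Q u e) = e" "pr Q (lift Q u e) = u"
proof -
  have "\<exists>!g. g \<in> Ar Q \<and> cd Q g = e \<and> pr Q g = u" using Q e u unfolding dfib_def by blast
  from theI'[OF this] show "lift Q u e \<in> Ar Q" "cd Q (lift Q u e) = e" "pr Q (lift Q u e) = u"
    unfolding lift_def by blast+
qed

lemma lift_unique:
  assumes oQ: "over C Q" and Q: "dfib C Q" and g: "g \<in> Ar Q" "cd Q g = e" "pr Q g = u"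
  shows "lift Q u e = g"
proof -
  have "\<exists>!g. g \<in> Ar Q \<and> cd Q g = e \<and> pr Q g = u" 
    using Q overD[OF oQ g(1)] g unfolding dfib_def by metis
  then show ?thesis unfolding lift_def using g by (intro the1_equality) auto
qed

lemma restr:
  assumes oQ: "over C Q" and Q: "dfib C Q" and e: "e \<in> Ar Q" "cd Q e = e" and u: "u \<in> Mor C" "Ident C (Cod C u) = pr Q e"
  shows "restr Q u e \<in> Ar Q" "cd Q (restr Q u e) = restr Q u e" "pr Q (restr Q u e) = Ident C (Dom C u)"
  using lift[OF Q e u] overD[OF oQ lift(1)[OF Q e u]] by auto

lemma lift_id:
  assumes "over C Q" "dfib C Q" "e \<in> Ar Q" "cd Q e = e"
  shows "lift Q (pr Q e) e = e"
  using lift_unique[OF assms] by simp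

lemma restr_Comp:
  assumes oQ: "over C Q" and Q: "dfib C Q" and e: "e \<in> Ar Q" "cd Q e = e" and u: "u \<in> Mor C" "Ident C (Cod C u) = pr Q e"
    and v: "v \<in> Mor C" "Cod C v = Dom C u"
  shows "restr Q (Comp C u v) e = restr Q v (restr Q u e)"
proof -
  note l = lift[OF Q e u] and r = restr[OF oQ Q e u]
  have v': "Ident C (Cod C v) = pr Q (restr Q u e)" using v r by simp
  note m = lift[OF Q r(1,2) v(1) v']
  have c: "dm Q (lift Q u e) = cd Q (lift Q v (restr Q u e))" using m by simp
  note cc = over_compD[OF oQ m(1) l(1) c]
  have "lift Q (Comp C u v) e = cm Q (lift Q u e) (lift Q v (restr Q u e))"
    by (rule lift_unique[OF oQ Q]) (use cc l m in auto)
  then show ?thesis using cc by simp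
qed

text \<open>The image of \<open>g\<close> is a lift of \<open>pr X g\<close> that ends at the image
  of the codomain, hence the only one. So a functor into a discrete fibration is determined by its
  values on objects.\<close>

lemma omor_lift:
  assumes X: "over C X" and oQ: "over C Q" and Q: "dfib C Q" and \<phi>: "omor X Q \<phi>" and g: "g \<in> Ar X"
  shows "lift Q (pr X g) (\<phi> (cd X g)) = \<phi> g" "restr Q (pr X g) (\<phi> (cd X g)) = \<phi> (dm X g)"
proof -
  show 1: "lift Q (pr X g) (\<phi> (cd X g)) = \<phi> g"
    by (rule lift_unique[OF oQ Q]) (use omorD[OF \<phi> g] in auto)
  show "restr Q (pr X g) (\<phi> (cd X g)) = \<phi> (dm X g)" unfolding 1 using omorD(2)[OF \<phi> g] by simp
qed

lemma omor_restr:
  assumes oX: "over C X" and X: "dfib C X" and oQ: "over C Q" and Q: "dfib C Q" and \<phi>: "omor X Q \<phi>"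
    and e: "e \<in> Ar X" "cd X e = e" and u: "u \<in> Mor C" "Ident C (Cod C u) = pr X e"
  shows "restr Q u (\<phi> e) = \<phi> (restr X u e)"
  using omor_lift(2)[OF oX oQ Q \<phi> lift(1)[OF X e u]] lift(2,3)[OF X e u] by simp

lemma omor_dfib_unique:
  assumes X: "over C X" and oQ: "over C Q" and Q: "dfib C Q" and \<phi>: "omor X Q \<phi>" and \<psi>: "omor X Q \<psi>"
    and eq: "\<And>a. a \<in> Ar X \<Longrightarrow> cd X a = a \<Longrightarrow> \<phi> a = \<psi> a" and g: "g \<in> Ar X"
  shows "\<phi> g = \<psi> g"
  using omor_lift(1)[OF X oQ Q \<phi> g] omor_lift(1)[OF X oQ Q \<psi> g] eq[of "cd X g"] overD(2,6)[OF X g] by simp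

text \<open>Restricting the image of the codomain of \<open>g\<close> along \<open>pr X g\<close>
  gives the image of its domain. The element obtained by restriction is therefore constant along
  zigzags and depends on the component only.\<close>

lemma conn_restr:
  assumes X: "over C X" and oQ: "over C Q" and Q: "dfib C Q" and \<phi>: "omor X Q \<phi>" and "conn C X p q"
  shows "restr Q (fst p) (\<phi> (snd p)) = restr Q (fst q) (\<phi> (snd q))"
  using assms(5)
proof induction
  case (conn_step g f)
  note o = overD[OF X conn_step(1)] and h = omorD[OF \<phi> conn_step(1)]
  have c: "\<phi> (cd X g) \<in> Ar Q" "cd Q (\<phi> (cd X g)) = \<phi> (cd X g)" "Ident C (Cod C (pr X g)) = pr Q (\<phi> (cd X g))"
    using omorD[OF \<phi> o(2)] o by simp_all
  show ?case
    using restr_Comp[OF oQ Q c(1,2) o(9) c(3) conn_step(2,3)] omor_lift(2)[OF X oQ Q \<phi> conn_step(1)] by simp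
qed auto

text \<open>A converse to \<open>omor_lift\<close>: a function on objects that commutes with
  restriction extends to arrows by lifting, and composition is respected because lifts are
  unique.\<close>

lemma build_into_dfib:
  assumes X: "over C X" and oQ: "over C Q" and Q: "dfib C Q"
    and \<sigma>: "\<And>a. a \<in> Ar X \<Longrightarrow> cd X a = a \<Longrightarrow> \<sigma> a \<in> Ar Q \<and> cd Q (\<sigma> a) = \<sigma> a \<and> pr Q (\<sigma> a) = pr X a"
    and nat: "\<And>g. g \<in> Ar X \<Longrightarrow> restr Q (pr X g) (\<sigma> (cd X g)) = \<sigma> (dm X g)"
  obtains \<phi> where "omor X Q \<phi>" "\<And>a. a \<in> Ar X \<Longrightarrow> cd X a = a \<Longrightarrow> \<phi> a = \<sigma> a"
proof
  let ?\<phi> = "\<lambda>g. lift Q (pr X g) (\<sigma> (cd X g))"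
  have s: "\<sigma> (cd X g) \<in> Ar Q" "cd Q (\<sigma> (cd X g)) = \<sigma> (cd X g)" "Ident C (Cod C (pr X g)) = pr Q (\<sigma> (cd X g))"
    if "g \<in> Ar X" for g using \<sigma>[of "cd X g"] overD[OF X that] by auto
  note l = lift[OF Q s(1) s(2) overD(9)[OF X] s(3)]
  show id: "?\<phi> a = \<sigma> a" if "a \<in> Ar X" "cd X a = a" for a
    using \<sigma>[OF that] lift_id[OF oQ Q, of "\<sigma> a"] that by simp
  show "omor X Q ?\<phi>"
    unfolding omor_def
  proof (intro conjI ballI impI)
    fix g assume g: "g \<in> Ar X"
    note o = overD[OF X g]
    show "?\<phi> g \<in> Ar Q" "pr Q (?\<phi> g) = pr X g" using l[OF g g g g] by auto
    show "?\<phi> (dm X g) = dm Q (?\<phi> g)" using id[OF o(1,4)] nat[OF g] by simp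
    show "?\<phi> (cd X g) = cd Q (?\<phi> g)" using id[OF o(2,6)] l[OF g g g g] by simp
  next
    fix f g assume f: "f \<in> Ar X" and g: "g \<in> Ar X" and gf: "dm X g = cd X f"
    note c = over_compD[OF X f g gf] and lf = l[OF f f f f] and lg = l[OF g g g g]
    have d: "dm Q (?\<phi> g) = cd Q (?\<phi> f)" using nat[OF g] lf(2) gf by simp
    show "?\<phi> (cm X g f) = cm Q (?\<phi> g) (?\<phi> f)"
      by (rule lift_unique[OF oQ Q]) (use over_compD[OF oQ lf(1) lg(1) d] lf lg c in auto)
  qed
qed

section \<open>Construction and universal property of the reflection\<close>

definition conn_rep where "conn_rep X p = (SOME q. conn C X p q)"

lemma conn_rep: "p \<in> El C X \<Longrightarrow> conn C X p (conn_rep X p)"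
  unfolding conn_rep_def by (rule someI[of _ p]) (rule conn_refl)

lemma conn_rep_eq_iff:
  assumes "p \<in> El C X" "q \<in> El C X"
  shows "conn_rep X p = conn_rep X q \<longleftrightarrow> conn C X p q"
proof
  assume "conn_rep X p = conn_rep X q"
  then show "conn C X p q" using conn_rep assms conn_trans conn_sym by metis
next
  assume "conn C X p q"
  then have "conn C X p r = conn C X q r" for r using conn_trans conn_sym by blast
  then show "conn_rep X p = conn_rep X q" by (simp add: conn_rep_def)
qed

text \<open>
  The fibre of the reflection over \<open>c\<close> is the set of components of \<open>c/P\<close>; the arrow \<open>(u, p)\<close> is
  the unique lift of \<open>u\<close> with codomain \<open>p\<close>.
\<close>

definition Refl where
  "Refl X = \<lparr>Ar = {(u, p). u \<in> Mor C \<and> p \<in> conn_rep X ` El C X \<and> Cod C u = Dom C (fst p)},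
     dm = (\<lambda>(u, p). (Ident C (Dom C u), conn_rep X (Comp C (fst p) u, snd p))),
     cd = (\<lambda>(u, p). (Ident C (Cod C u), p)),
     cm = (\<lambda>(v, q) (u, p). (Comp C v u, q)), pr = fst\<rparr>"

text \<open>The component of the identity is the universal element at an object; an arrow goes to
  the lift of its image in the base that ends at the universal element of its codomain.\<close>

definition refl_unit where
  "refl_unit X g = (pr X g, conn_rep X (pr X (cd X g), cd X g))"

lemma conn_rep_conn_rep:
  assumes X: "over C X" and p: "p \<in> El C X"
  shows "conn_rep X p \<in> El C X" "conn_rep X (conn_rep X p) = conn_rep X p" "Dom C (fst (conn_rep X p)) = Dom C (fst p)"
proof -
  note c = conn_rep[OF p]
  show 1: "conn_rep X p \<in> El C X" "Dom C (fst (conn_rep X p)) = Dom C (fst p)" using conn_in[OF X c] by auto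
  show "conn_rep X (conn_rep X p) = conn_rep X p" using conn_rep_eq_iff[OF 1(1) p] conn_sym[OF c] by blast
qed

lemma conn_rep_precomp:
  assumes X: "over C X" and p: "p \<in> El C X" and u: "u \<in> Mor C" "Cod C u = Dom C (fst p)"
  shows "conn_rep X (Comp C (fst (conn_rep X p)) u, snd (conn_rep X p)) = conn_rep X (Comp C (fst p) u, snd p)"
proof -
  have "conn C X (Comp C (fst p) u, snd p) (Comp C (fst (conn_rep X p)) u, snd (conn_rep X p))"
    by (rule conn_precomp[OF X conn_rep[OF p] u])
  then show ?thesis using conn_rep_eq_iff conn_in[OF X] conn_sym by metis
qed

lemma Refl_cases:
  assumes X: "over C X" and "g \<in> Ar (Refl X)"
  obtains u p where "g = (u, p)" "u \<in> Mor C" "p \<in> El C X" "conn_rep X p = p" "Cod C u = Dom C (fst p)"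
proof -
  obtain u p where "g = (u, conn_rep X p)" "u \<in> Mor C" "p \<in> El C X" "Cod C u = Dom C (fst (conn_rep X p))"
    using assms(2) by (auto simp: Refl_def)
  then show thesis using that[of u "conn_rep X p"] conn_rep_conn_rep[OF X] by simp
qed

lemma Refl_in:
  assumes "over C X" "u \<in> Mor C" "p \<in> El C X" "Cod C u = Dom C (fst p)"
  shows "(u, conn_rep X p) \<in> Ar (Refl X)"
  using assms conn_rep_conn_rep[OF assms(1,3)] by (auto simp: Refl_def)

lemma over_Refl:
  assumes X: "over C X"
  shows "over C (Refl X)"
  unfolding over_def
proof (intro conjI ballI impI)
  fix f assume "f \<in> Ar (Refl X)"
  then obtain u p where f: "f = (u, p)" "u \<in> Mor C" "p \<in> El C X" "conn_rep X p = p" "Cod C u = Dom C (fst p)"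
    by (rule Refl_cases[OF X])
  let ?p = "(Comp C (fst p) u, snd p)"
  have p': "?p \<in> El C X" by (rule El_precomp[OF f(3,2,5)])
  note r = conn_rep_conn_rep[OF X p']
  have D: "Dom C (fst ?p) = Dom C u" using f ElD(1)[OF f(3)] by simp
  have du: "dm (Refl X) f = (Ident C (Dom C u), conn_rep X ?p)" "cd (Refl X) f = (Ident C (Cod C u), p)"
    by (simp_all add: Refl_def f)
  have e: "conn_rep X (Comp C (fst (conn_rep X ?p)) (Ident C (Dom C u)), snd (conn_rep X ?p)) = conn_rep X ?p"
    using r D ElD(1)[OF r(1)] by (metis C_unit(1) prod.collapse)
  have e2: "conn_rep X (Comp C (fst p) (Ident C (Cod C u)), snd p) = p"
    using f ElD(1)[OF f(3)] by (metis C_unit(1) prod.collapse)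
  show "dm (Refl X) f \<in> Ar (Refl X)" unfolding du using Refl_in[OF X _ p'] f D by simp
  show "cd (Refl X) f \<in> Ar (Refl X)" unfolding du using Refl_in[OF X _ f(3)] f ElD(1)[OF f(3)] by simp
  show "dm (Refl X) (dm (Refl X) f) = dm (Refl X) f" "cd (Refl X) (dm (Refl X) f) = dm (Refl X) f"
    "dm (Refl X) (cd (Refl X) f) = cd (Refl X) f" "cd (Refl X) (cd (Refl X) f) = cd (Refl X) f"
    unfolding du using f e e2 ElD(1)[OF f(3)] by (simp_all add: Refl_def)
  show "cm (Refl X) f (dm (Refl X) f) = f" "cm (Refl X) (cd (Refl X) f) f = f" "pr (Refl X) f \<in> Mor C"
    "pr (Refl X) (dm (Refl X) f) = Ident C (Dom C (pr (Refl X) f))"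
    "pr (Refl X) (cd (Refl X) f) = Ident C (Cod C (pr (Refl X) f))"
    unfolding du using f C_unit(2)[OF f(2)] by (simp_all add: Refl_def)
next
  fix f g assume "f \<in> Ar (Refl X)" "g \<in> Ar (Refl X)" and c: "dm (Refl X) g = cd (Refl X) f"
  then obtain u p v q where f: "f = (u, p)" "u \<in> Mor C" "p \<in> El C X" "conn_rep X p = p" "Cod C u = Dom C (fst p)"
    and g: "g = (v, q)" "v \<in> Mor C" "q \<in> El C X" "conn_rep X q = q" "Cod C v = Dom C (fst q)"
    using Refl_cases[OF X] by metis
  have c': "Ident C (Dom C v) = Ident C (Cod C u)" "conn_rep X (Comp C (fst q) v, snd q) = p"
    using c by (simp_all add: Refl_def f g)
  have vu: "Dom C v = Cod C u" using c'(1) Ident_C_eq[of "Dom C v" "Cod C u"] f(2) g(2) by simp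
  have q': "(Comp C (fst q) v, snd q) \<in> El C X" by (rule El_precomp[OF g(3,2,5)])
  have pu: "conn_rep X (Comp C (fst p) u, snd p) = conn_rep X (Comp C (fst q) (Comp C v u), snd q)"
    using conn_rep_precomp[OF X q' f(2)] c'(2) f g vu ElD(1)[OF g(3)] C_assoc by simp
  show "cm (Refl X) g f \<in> Ar (Refl X)" "dm (Refl X) (cm (Refl X) g f) = dm (Refl X) f"
    "cd (Refl X) (cm (Refl X) g f) = cd (Refl X) g" "pr (Refl X) (cm (Refl X) g f) = Comp C (pr (Refl X) g) (pr (Refl X) f)"
    using Refl_in[OF X, of "Comp C v u" q] f g vu pu by (simp_all add: Refl_def)
next
  fix f g h assume "f \<in> Ar (Refl X)" "g \<in> Ar (Refl X)" "h \<in> Ar (Refl X)"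
    and c: "dm (Refl X) g = cd (Refl X) f" "dm (Refl X) h = cd (Refl X) g"
  then obtain u p v q w r where f: "f = (u, p)" "u \<in> Mor C" and g: "g = (v, q)" "v \<in> Mor C"
    and h: "h = (w, r)" "w \<in> Mor C" using Refl_cases[OF X] by metis
  have "Dom C v = Cod C u" "Dom C w = Cod C v"
    using c f g h Ident_C_eq[of "Dom C v" "Cod C u"] Ident_C_eq[of "Dom C w" "Cod C v"] by (simp_all add: Refl_def)
  then show "cm (Refl X) h (cm (Refl X) g f) = cm (Refl X) (cm (Refl X) h g) f"
    using f g h C_assoc by (simp add: Refl_def)
qed

lemma dfib_Refl:
  assumes X: "over C X"
  shows "dfib C (Refl X)"
  unfolding dfib_def
proof (intro ballI impI)
  fix e u assume e: "e \<in> Ar (Refl X)" "cd (Refl X) e = e" and u: "u \<in> Mor C" "Ident C (Cod C u) = pr (Refl X) e"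
  obtain i p where i: "e = (i, p)" "i \<in> Mor C" "p \<in> El C X" "conn_rep X p = p" "Cod C i = Dom C (fst p)"
    by (rule Refl_cases[OF X e(1)])
  have ii: "i = Ident C (Cod C i)" using e(2) by (simp add: Refl_def i)
  have "Ident C (Cod C u) = i" using u(2) by (simp add: Refl_def i(1))
  then have "Ident C (Cod C u) = Ident C (Cod C i)" using ii by (rule trans)
  then have ui: "Cod C u = Cod C i" using Ident_C_eq[of "Cod C u" "Cod C i"] u(1) i(2) by simp
  show "\<exists>!g. g \<in> Ar (Refl X) \<and> cd (Refl X) g = e \<and> pr (Refl X) g = u"
  proof (rule ex1I[of _ "(u, p)"])
    have "cd (Refl X) (u, p) = e" unfolding i(1) using ii ui by (simp add: Refl_def)
    then show "(u, p) \<in> Ar (Refl X) \<and> cd (Refl X) (u, p) = e \<and> pr (Refl X) (u, p) = u"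
      using Refl_in[OF X u(1) i(3)] i(4,5) ui by (simp add: Refl_def)
    show "g = (u, p)" if "g \<in> Ar (Refl X) \<and> cd (Refl X) g = e \<and> pr (Refl X) g = u" for g
      using that by (cases g) (auto simp: Refl_def i)
  qed
qed

text \<open>The point \<open>(f, a)\<close> arises by precomposing the identity point at
  \<open>a\<close> with \<open>f\<close>, so its component is the restriction along \<open>f\<close>
  of the value of the unit at \<open>a\<close>. Hence these values generate the reflection under
  restriction, as \<open>Refl_point\<close> records.\<close>

lemma Refl_restr:
  assumes X: "over C X" and p: "p \<in> El C X"
  shows "refl_unit X (snd p) \<in> Ar (Refl X)" "cd (Refl X) (refl_unit X (snd p)) = refl_unit X (snd p)"
    "restr (Refl X) (fst p) (refl_unit X (snd p)) = (Ident C (Dom C (fst p)), conn_rep X p)"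
proof -
  let ?a = "snd p" and ?f = "fst p"
  note pD = ElD(1-4)[OF p]
  have q: "(pr X ?a, ?a) \<in> El C X" by (rule El_id[OF X pD(2,3)])
  have D: "Dom C (pr X ?a) = Cod C ?f" "Cod C (pr X ?a) = Cod C ?f" using ElD(1,4)[OF p] by simp_all
  have u: "refl_unit X ?a = (pr X ?a, conn_rep X (pr X ?a, ?a))" using pD by (simp add: refl_unit_def)
  show 1: "refl_unit X ?a \<in> Ar (Refl X)" unfolding u by (rule Refl_in[OF X _ q]) (use D pD in simp_all)
  show 2: "cd (Refl X) (refl_unit X ?a) = refl_unit X ?a" unfolding u using pD by (simp add: Refl_def)
  have g: "(?f, conn_rep X (pr X ?a, ?a)) \<in> Ar (Refl X)" by (rule Refl_in[OF X pD(1) q]) (use D in simp)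
  have "lift (Refl X) ?f (refl_unit X ?a) = (?f, conn_rep X (pr X ?a, ?a))"
    by (rule lift_unique[OF over_Refl[OF X] dfib_Refl[OF X] g]) (use ElD(4)[OF p] in \<open>simp_all add: Refl_def u\<close>)
  moreover have "conn_rep X (Comp C (fst (conn_rep X (pr X ?a, ?a))) ?f, snd (conn_rep X (pr X ?a, ?a))) = conn_rep X p"
    using conn_rep_precomp[OF X q pD(1)] D pD by simp
  ultimately show "restr (Refl X) ?f (refl_unit X ?a) = (Ident C (Dom C ?f), conn_rep X p)" by (simp add: Refl_def)
qed

lemma Refl_point:
  assumes X: "over C X" and e: "e \<in> Ar (Refl X)" "cd (Refl X) e = e"
  shows "\<exists>p \<in> El C X. e = restr (Refl X) (fst p) (refl_unit X (snd p))"
proof -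
  obtain i p where i: "e = (i, p)" "i \<in> Mor C" "p \<in> El C X" "conn_rep X p = p" "Cod C i = Dom C (fst p)"
    by (rule Refl_cases[OF X e(1)])
  have "Ident C (Cod C i) = i" using e(2) by (simp add: Refl_def i(1))
  then have "e = restr (Refl X) (fst p) (refl_unit X (snd p))"
    unfolding Refl_restr(3)[OF X i(3)] using i(1,4,5) by simp
  then show ?thesis using i(3) by blast
qed

lemma refl_unit_omor:
  assumes X: "over C X"
  shows "omor X (Refl X) (refl_unit X)"
  unfolding omor_def
proof (intro conjI ballI impI)
  fix g assume g: "g \<in> Ar X"
  note o = overD[OF X g]
  have q: "(pr X (cd X g), cd X g) \<in> El C X" by (rule El_id[OF X o(2,6)])
  have "conn C X (Ident C (Dom C (pr X g)), dm X g) (Comp C (pr X g) (Ident C (Dom C (pr X g))), cd X g)"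
    by (rule conn_step[OF g]) (use o(9) in simp_all)
  then have s: "conn C X (pr X (dm X g), dm X g) (pr X g, cd X g)" using o by simp
  have r: "conn_rep X (Comp C (fst (conn_rep X (pr X (cd X g), cd X g))) (pr X g), snd (conn_rep X (pr X (cd X g), cd X g))) =
      conn_rep X (pr X g, cd X g)"
    using conn_rep_precomp[OF X q o(9)] o by simp
  have r': "conn_rep X (pr X g, cd X g) = conn_rep X (pr X (dm X g), dm X g)"
    using s conn_rep_eq_iff conn_in[OF X s] conn_sym by blast
  show "refl_unit X g \<in> Ar (Refl X)" unfolding refl_unit_def by (rule Refl_in[OF X o(9) q]) (use o in simp)
  show "refl_unit X (dm X g) = dm (Refl X) (refl_unit X g)"
    using r r' o by (simp add: refl_unit_def Refl_def)
  show "refl_unit X (cd X g) = cd (Refl X) (refl_unit X g)" using o by (simp add: refl_unit_def Refl_def)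
  show "pr (Refl X) (refl_unit X g) = pr X g" by (simp add: refl_unit_def Refl_def)
next
  fix f g assume "f \<in> Ar X" "g \<in> Ar X" "dm X g = cd X f"
  from over_compD[OF X this] show "refl_unit X (cm X g f) = cm (Refl X) (refl_unit X g) (refl_unit X f)"
    by (simp add: refl_unit_def Refl_def)
qed

text \<open>An extension has to send the component of \<open>(f, a)\<close> to the restriction of
  \<open>\<phi> a\<close> along \<open>f\<close>; by \<open>conn_restr\<close> this does not depend
  on the representative.\<close>

lemma Refl_extend:
  assumes X: "over C X" and oQ: "over C Q" and Q: "dfib C Q" and \<phi>: "omor X Q \<phi>"
  obtains \<psi> where "omor (Refl X) Q \<psi>" "\<And>g. g \<in> Ar X \<Longrightarrow> \<psi> (refl_unit X g) = \<phi> g"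
proof -
  note oL = over_Refl[OF X]
  let ?\<sigma> = "\<lambda>e. restr Q (fst (snd e)) (\<phi> (snd (snd e)))"
  have El\<phi>: "\<phi> (snd p) \<in> Ar Q" "cd Q (\<phi> (snd p)) = \<phi> (snd p)" "fst p \<in> Mor C"
    "Ident C (Cod C (fst p)) = pr Q (\<phi> (snd p))" if "p \<in> El C X" for p
    using ElD[OF El_omor[OF \<phi> that]] by simp_all
  note r = restr[OF oQ Q El\<phi>]
  have 1: "?\<sigma> a \<in> Ar Q \<and> cd Q (?\<sigma> a) = ?\<sigma> a \<and> pr Q (?\<sigma> a) = pr (Refl X) a"
    if a: "a \<in> Ar (Refl X)" "cd (Refl X) a = a" for a
  proof -
    obtain u p where f: "a = (u, p)" "u \<in> Mor C" "p \<in> El C X" "conn_rep X p = p" "Cod C u = Dom C (fst p)"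
      by (rule Refl_cases[OF X a(1)])
    then have "u = Ident C (Cod C u)" using a(2) by (simp add: Refl_def)
    then show ?thesis using r[OF f(3) f(3) f(3) f(3)] f by (simp add: Refl_def)
  qed
  have 2: "restr Q (pr (Refl X) g) (?\<sigma> (cd (Refl X) g)) = ?\<sigma> (dm (Refl X) g)" if g: "g \<in> Ar (Refl X)" for g
  proof -
    obtain u p where f: "g = (u, p)" "u \<in> Mor C" "p \<in> El C X" "conn_rep X p = p" "Cod C u = Dom C (fst p)"
      by (rule Refl_cases[OF X g])
    have p': "(Comp C (fst p) u, snd p) \<in> El C X" by (rule El_precomp[OF f(3,2,5)])
    have "?\<sigma> (dm (Refl X) g) = restr Q (Comp C (fst p) u) (\<phi> (snd p))"
      using conn_restr[OF X oQ Q \<phi> conn_rep[OF p']] by (simp add: Refl_def f)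
    also have "\<dots> = restr Q u (restr Q (fst p) (\<phi> (snd p)))"
      by (rule restr_Comp[OF oQ Q El\<phi>[OF f(3)] f(2,5)])
    finally show ?thesis by (simp add: Refl_def f)
  qed
  obtain \<psi> where \<psi>: "omor (Refl X) Q \<psi>" "\<And>a. a \<in> Ar (Refl X) \<Longrightarrow> cd (Refl X) a = a \<Longrightarrow> \<psi> a = ?\<sigma> a"
    using build_into_dfib[OF oL oQ Q, of ?\<sigma>] 1 2 by blast
  have \<psi>\<eta>: "omor X Q (\<lambda>g. \<psi> (refl_unit X g))" by (rule omor_compose[OF X refl_unit_omor[OF X] \<psi>(1)])
  have "\<psi> (refl_unit X a) = \<phi> a" if a: "a \<in> Ar X" "cd X a = a" for a
  proof -
    have p: "(pr X a, a) \<in> El C X" by (rule El_id[OF X a])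
    have "\<psi> (refl_unit X a) = ?\<sigma> (refl_unit X a)" using Refl_restr(1,2)[OF X p] \<psi>(2) by simp
    also have "\<dots> = restr Q (fst (conn_rep X (pr X a, a))) (\<phi> (snd (conn_rep X (pr X a, a))))"
      using a by (simp add: refl_unit_def)
    also have "\<dots> = restr Q (pr X a) (\<phi> a)" using conn_restr[OF X oQ Q \<phi> conn_rep[OF p]] by simp
    also have "\<dots> = \<phi> a" using omor_lift(2)[OF X oQ Q \<phi> a(1)] a dm_identity[OF X a] by simp
    finally show ?thesis .
  qed
  then have "\<psi> (refl_unit X g) = \<phi> g" if "g \<in> Ar X" for g
    using omor_dfib_unique[OF X oQ Q \<psi>\<eta> \<phi> _ that] by blast
  then show thesis using that \<psi>(1) by blast
qed

text \<open>Every object of the reflection is a restriction of a value of the unit, and functors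
  between discrete fibrations commute with restriction.\<close>

lemma Refl_extend_unique:
  assumes X: "over C X" and oQ: "over C Q" and Q: "dfib C Q" and \<psi>: "omor (Refl X) Q \<psi>" and \<psi>': "omor (Refl X) Q \<psi>'"
    and eq: "\<And>g. g \<in> Ar X \<Longrightarrow> \<psi> (refl_unit X g) = \<psi>' (refl_unit X g)" and g: "g \<in> Ar (Refl X)"
  shows "\<psi> g = \<psi>' g"
proof (rule omor_dfib_unique[OF over_Refl[OF X] oQ Q \<psi> \<psi>' _ g])
  fix e assume "e \<in> Ar (Refl X)" "cd (Refl X) e = e"
  then obtain p where p: "p \<in> El C X" "e = restr (Refl X) (fst p) (refl_unit X (snd p))"
    using Refl_point[OF X] by blast
  have h: "Ident C (Cod C (fst p)) = pr (Refl X) (refl_unit X (snd p))"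
    using ElD(5)[OF p(1)] by (simp add: Refl_def refl_unit_def)
  note \<eta> = Refl_restr(1,2)[OF X p(1)] ElD(1)[OF p(1)] h
  have "\<psi> e = restr Q (fst p) (\<psi> (refl_unit X (snd p)))"
    unfolding p(2) by (rule omor_restr[OF over_Refl[OF X] dfib_Refl[OF X] oQ Q \<psi> \<eta>, symmetric])
  also have "\<dots> = restr Q (fst p) (\<psi>' (refl_unit X (snd p)))" using eq[OF ElD(2)[OF p(1)]] by simp
  also have "\<dots> = \<psi>' e"
    unfolding p(2) by (rule omor_restr[OF over_Refl[OF X] dfib_Refl[OF X] oQ Q \<psi>' \<eta>])
  finally show "\<psi> e = \<psi>' e" .
qed

section \<open>Weak equivalences\<close>

lemma dfib_iso:
  assumes X: "over C X" and \<phi>: "omor X Y \<phi>" and bij: "bij_betw \<phi> (Ar X) (Ar Y)" and d: "dfib C X"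
  shows "dfib C Y"
  unfolding dfib_def
proof (intro ballI impI)
  fix e u assume e: "e \<in> Ar Y" "cd Y e = e" and u: "u \<in> Mor C" "Ident C (Cod C u) = pr Y e"
  let ?\<psi> = "inv_into (Ar X) \<phi>"
  have \<psi>: "omor Y X ?\<psi>" by (rule omor_inverse[OF X \<phi> bij])
  have \<phi>\<psi>: "\<phi> (?\<psi> y) = y" if "y \<in> Ar Y" for y using that bij by (auto simp: bij_betw_def f_inv_into_f)
  have \<psi>\<phi>: "?\<psi> (\<phi> x) = x" if "x \<in> Ar X" for x using that bij by (auto simp: bij_betw_def)
  have e': "?\<psi> e \<in> Ar X" "cd X (?\<psi> e) = ?\<psi> e" "pr X (?\<psi> e) = pr Y e"
    using omorD[OF \<psi> e(1)] e(2) by auto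
  have "Ident C (Cod C u) = pr X (?\<psi> e)" using u(2) e'(3) by simp
  note l = lift[OF d e'(1,2) u(1) this]
  show "\<exists>!g. g \<in> Ar Y \<and> cd Y g = e \<and> pr Y g = u"
  proof (rule ex1I[of _ "\<phi> (lift X u (?\<psi> e))"])
    show "\<phi> (lift X u (?\<psi> e)) \<in> Ar Y \<and> cd Y (\<phi> (lift X u (?\<psi> e))) = e \<and> pr Y (\<phi> (lift X u (?\<psi> e))) = u"
      using omorD[OF \<phi> l(1)] l \<phi>\<psi>[OF e(1)] by simp
    fix g assume g: "g \<in> Ar Y \<and> cd Y g = e \<and> pr Y g = u"
    then have "lift X u (?\<psi> e) = ?\<psi> g" using omorD[OF \<psi>, of g] by (intro lift_unique[OF X d]) auto
    then show "g = \<phi> (lift X u (?\<psi> e))" using \<phi>\<psi> g by simp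
  qed
qed

definition weqs where
  "weqs = {w \<in> Mor K. \<forall>Q \<in> Obj K. dfib C (view Q) \<longrightarrow>
     (\<forall>g \<in> hom K (Dom K w) Q. \<exists>!h. h \<in> hom K (Cod K w) Q \<and> Comp K h w = g)}"

lemma weqsI:
  assumes "w \<in> hom K A B"
    and "\<And>Q g. Q \<in> Obj K \<Longrightarrow> dfib C (view Q) \<Longrightarrow> g \<in> hom K A Q \<Longrightarrow> \<exists>h \<in> hom K B Q. Comp K h w = g"
    and "\<And>Q h k. Q \<in> Obj K \<Longrightarrow> dfib C (view Q) \<Longrightarrow> h \<in> hom K B Q \<Longrightarrow> k \<in> hom K B Q \<Longrightarrow>
      Comp K h w = Comp K k w \<Longrightarrow> h = k"
  shows "w \<in> weqs"
  unfolding weqs_def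
proof (intro CollectI conjI ballI impI)
  show "w \<in> Mor K" using hom_Mor[OF assms(1)] by simp
  fix Q g assume Q: "Q \<in> Obj K" "dfib C (view Q)" and g: "g \<in> hom K (Dom K w) Q"
  have AB: "Dom K w = A" "Cod K w = B" using hom_Mor[OF assms(1)] by auto
  have "g \<in> hom K A Q" using g AB by simp
  then obtain h where h: "h \<in> hom K B Q" "Comp K h w = g" using assms(2)[OF Q] by blast
  have "k = h" if k: "k \<in> hom K B Q \<and> Comp K k w = g" for k
    by (rule assms(3)[OF Q _ h(1)]) (use k h(2) in simp_all)
  then show "\<exists>!h. h \<in> hom K (Cod K w) Q \<and> Comp K h w = g" unfolding AB using h by blast
qed

lemma weqs_extend:
  assumes "w \<in> weqs" "w \<in> hom K A B" "Q \<in> Obj K" "dfib C (view Q)" "g \<in> hom K A Q"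
  obtains h where "h \<in> hom K B Q" "Comp K h w = g"
proof -
  have AB: "Dom K w = A" "Cod K w = B" using hom_Mor[OF assms(2)] by auto
  have "\<forall>Q \<in> Obj K. dfib C (view Q) \<longrightarrow> (\<forall>g \<in> hom K A Q. \<exists>!h. h \<in> hom K B Q \<and> Comp K h w = g)"
    using assms(1) unfolding weqs_def AB[symmetric] by blast
  then show thesis using assms(3-5) that by blast
qed

lemma weqs_unique:
  assumes "w \<in> weqs" "w \<in> hom K A B" "Q \<in> Obj K" "dfib C (view Q)" "h \<in> hom K B Q" "k \<in> hom K B Q"
    "Comp K h w = Comp K k w"
  shows "h = k"
proof -
  have AB: "Dom K w = A" "Cod K w = B" using hom_Mor[OF assms(2)] by auto
  have "\<forall>Q \<in> Obj K. dfib C (view Q) \<longrightarrow> (\<forall>g \<in> hom K A Q. \<exists>!h. h \<in> hom K B Q \<and> Comp K h w = g)"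
    using assms(1) unfolding weqs_def AB[symmetric] by blast
  moreover have "Comp K k w \<in> hom K A Q" using Comp_K(1)[OF assms(2,6)] .
  ultimately show ?thesis using assms(3-7) by blast
qed

text \<open>The last two clauses say that the fibres of \<open>R\<close> are the sets of components
  of the comma categories of \<open>X\<close>. They preserve this information about
  \<open>Refl\<close> after it has been copied into \<open>K\<close>.\<close>

definition reflection where
  "reflection X R \<eta> \<longleftrightarrow> R \<in> Obj K \<and> dfib C (view R) \<and> \<eta> \<in> hom K X R \<and> \<eta> \<in> weqs \<and>
     (\<forall>p \<in> El C (view X). \<forall>q \<in> El C (view X).
        restr (view R) (fst p) (act \<eta> (snd p)) = restr (view R) (fst q) (act \<eta> (snd q)) \<longrightarrow> conn C (view X) p q) \<and>
     (\<forall>e \<in> M R. cd (view R) e = e \<longrightarrow>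
        (\<exists>p \<in> El C (view X). e = restr (view R) (fst p) (act \<eta> (snd p))))"

lemma reflection_exists:
  assumes X: "X \<in> Obj K"
  shows "\<exists>R \<eta>. reflection X R \<eta>"
proof -
  note oX = over_view[OF X]
  let ?L = "Refl (view X)"
  note oL = over_Refl[OF oX] and dL = dfib_Refl[OF oX]
  have "El C (view X) \<subseteq> Mor C \<times> M X" by (auto simp: El_def)
  then have "sml (El C (view X))" by (rule small_subset[OF _ small_Times[OF small_C(1) small_view[OF X]]])
  then have "sml (Mor C \<times> conn_rep (view X) ` El C (view X))" by (intro small_Times small_C small_image)
  moreover have "Ar ?L \<subseteq> Mor C \<times> conn_rep (view X) ` El C (view X)" by (auto simp: Refl_def)
  ultimately have sL: "sml (Ar ?L)" by (meson small_subset)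
  obtain \<iota> :: "'u \<times> 'u \<times> 'u \<Rightarrow> 'u" where inj: "inj_on \<iota> (Ar ?L)" using sL by (rule small_embed)
  obtain R where R: "R \<in> Obj K" "omor ?L (view R) \<iota>" "bij_betw \<iota> (Ar ?L) (M R)"
    by (rule realise[OF oL sL inj])
  note oR = over_view[OF R(1)]
  let ?j = "inv_into (Ar ?L) \<iota>"
  have j: "omor (view R) ?L ?j" by (rule omor_inverse[OF oL R(2,3)])
  have dR: "dfib C (view R)" by (rule dfib_iso[OF oL R(2,3) dL])
  have \<iota>j: "\<iota> (?j y) = y" if "y \<in> M R" for y using that R(3) by (auto simp: bij_betw_def f_inv_into_f)
  have j\<iota>: "?j (\<iota> x) = x" if "x \<in> Ar ?L" for x using that inj by simp
  note u = refl_unit_omor[OF oX]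
  define \<eta> where "\<eta> = mk X R (\<lambda>g. \<iota> (refl_unit (view X) g))"
  have \<eta>: "\<eta> \<in> hom K X R" unfolding \<eta>_def by (rule mk_hom[OF X R(1) omor_compose[OF oX u R(2)]])
  have a\<eta>: "act \<eta> g = \<iota> (refl_unit (view X) g)" if "g \<in> M X" for g using that by (simp add: \<eta>_def)
  have "\<eta> \<in> weqs"
  proof (rule weqsI[OF \<eta>])
    fix Q g assume Q: "Q \<in> Obj K" "dfib C (view Q)" and g: "g \<in> hom K X Q"
    obtain \<psi> where \<psi>: "omor ?L (view Q) \<psi>" "\<And>x. x \<in> M X \<Longrightarrow> \<psi> (refl_unit (view X) x) = act g x"
      using Refl_extend[OF oX over_view[OF Q(1)] Q(2) act_omor[OF g]] by blast
    have h: "mk R Q (\<lambda>y. \<psi> (?j y)) \<in> hom K R Q" by (rule mk_hom[OF R(1) Q(1) omor_compose[OF oR j \<psi>(1)]])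
    have "Comp K (mk R Q (\<lambda>y. \<psi> (?j y))) \<eta> = g"
    proof (rule hom_eqI[OF Comp_K(1)[OF \<eta> h] g])
      fix x assume x: "x \<in> M X"
      have "?j (act \<eta> x) = refl_unit (view X) x" using a\<eta>[OF x] j\<iota> omorD(1)[OF u x] by simp
      then show "act (Comp K (mk R Q (\<lambda>y. \<psi> (?j y))) \<eta>) x = act g x"
        using Comp_K(2)[OF \<eta> h x] act_in[OF \<eta> x] \<psi>(2)[OF x] by simp
    qed
    then show "\<exists>h \<in> hom K R Q. Comp K h \<eta> = g" using h by blast
  next
    fix Q h k assume Q: "Q \<in> Obj K" "dfib C (view Q)" and h: "h \<in> hom K R Q" and k: "k \<in> hom K R Q"
      and e: "Comp K h \<eta> = Comp K k \<eta>"
    have hk: "omor ?L (view Q) (\<lambda>y. act h (\<iota> y))" "omor ?L (view Q) (\<lambda>y. act k (\<iota> y))"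
      using omor_compose[OF oL R(2)] act_omor h k by blast+
    have "act h (\<iota> (refl_unit (view X) x)) = act k (\<iota> (refl_unit (view X) x))" if x: "x \<in> M X" for x
      using Comp_K(2)[OF \<eta> h x] Comp_K(2)[OF \<eta> k x] e a\<eta>[OF x] by simp
    then have eq: "act h (\<iota> y) = act k (\<iota> y)" if "y \<in> Ar ?L" for y
      using Refl_extend_unique[OF oX over_view[OF Q(1)] Q(2) hk _ that] by blast
    show "h = k"
    proof (rule hom_eqI[OF h k])
      fix y assume y: "y \<in> M R"
      show "act h y = act k y" using eq[OF omorD(1)[OF j y]] \<iota>j[OF y] by simp
    qed
  qed
  moreover have rs: "restr (view R) (fst p) (act \<eta> (snd p)) = \<iota> (Ident C (Dom C (fst p)), conn_rep (view X) p)"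
    if p: "p \<in> El C (view X)" for p
  proof -
    note L = Refl_restr[OF oX p] and pD = ElD[OF p]
    have "Ident C (Cod C (fst p)) = pr ?L (refl_unit (view X) (snd p))"
      using omorD(4)[OF u pD(2)] pD(5) by simp
    from omor_restr[OF oL dL oR dR R(2) L(1,2) pD(1) this] show ?thesis
      using L(3) a\<eta>[OF pD(2)] by simp
  qed
  moreover have "conn C (view X) p q" if p: "p \<in> El C (view X)" and q: "q \<in> El C (view X)"
    and e: "restr (view R) (fst p) (act \<eta> (snd p)) = restr (view R) (fst q) (act \<eta> (snd q))" for p q
  proof -
    have in_L: "(Ident C (Dom C (fst p)), conn_rep (view X) p) \<in> Ar ?L" if "p \<in> El C (view X)" for p
      using Refl_in[OF oX _ that] ElD(1)[OF that] by simp
    have "\<iota> (Ident C (Dom C (fst p)), conn_rep (view X) p) = \<iota> (Ident C (Dom C (fst q)), conn_rep (view X) q)"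
      using e rs p q by simp
    then have "conn_rep (view X) p = conn_rep (view X) q" using inj_onD[OF inj] in_L p q by blast
    then show ?thesis using conn_rep_eq_iff p q by blast
  qed
  moreover have "\<exists>p \<in> El C (view X). e = restr (view R) (fst p) (act \<eta> (snd p))"
    if e: "e \<in> M R" "cd (view R) e = e" for e
  proof -
    have "?j e \<in> Ar ?L" "cd ?L (?j e) = ?j e" using omorD[OF j e(1)] e(2) by auto
    then obtain p where p: "p \<in> El C (view X)" "?j e = restr ?L (fst p) (refl_unit (view X) (snd p))"
      using Refl_point[OF oX] by blast
    have "e = \<iota> (Ident C (Dom C (fst p)), conn_rep (view X) p)"
      using \<iota>j[OF e(1)] p(2) Refl_restr(3)[OF oX p(1)] by simp
    then show ?thesis using rs[OF p(1)] p(1) by (intro bexI[of _ p]) simp_all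
  qed
  ultimately have "reflection X R \<eta>" unfolding reflection_def using R(1) dR \<eta> by blast
  then show ?thesis by blast
qed

lemma reflectionD:
  assumes "reflection X R \<eta>"
  shows "R \<in> Obj K" "dfib C (view R)" "\<eta> \<in> hom K X R" "\<eta> \<in> weqs"
    "\<And>p q. p \<in> El C (view X) \<Longrightarrow> q \<in> El C (view X) \<Longrightarrow>
       restr (view R) (fst p) (act \<eta> (snd p)) = restr (view R) (fst q) (act \<eta> (snd q)) \<Longrightarrow> conn C (view X) p q"
    "\<And>e. e \<in> M R \<Longrightarrow> cd (view R) e = e \<Longrightarrow> \<exists>p \<in> El C (view X). e = restr (view R) (fst p) (act \<eta> (snd p))"
  using assms unfolding reflection_def by blast+

section \<open>Weak equivalences detected on components\<close>

definition conn_inj where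
  "conn_inj X Y \<phi> \<longleftrightarrow> (\<forall>p \<in> El C X. \<forall>q \<in> El C X. conn C Y (fst p, \<phi> (snd p)) (fst q, \<phi> (snd q)) \<longrightarrow> conn C X p q)"

definition conn_surj where
  "conn_surj X Y \<phi> \<longleftrightarrow> (\<forall>q \<in> El C Y. \<exists>p \<in> El C X. conn C Y q (fst p, \<phi> (snd p)))"

text \<open>Extending the unit of \<open>A\<close> along \<open>w\<close> gives \<open>h\<close>,
  and \<open>h\<close> after \<open>w\<close> separates the components of \<open>A\<close>; hence
  injectivity. For surjectivity, \<open>h\<close> turns a point of \<open>B\<close> into an element
  of the reflection of \<open>A\<close>, represented by some point \<open>p\<close>. The map
  \<open>k\<close> between the reflections carries it back to the component of the given point, as
  \<open>k\<close> after \<open>h\<close> is the unit of \<open>B\<close> by uniqueness.\<close>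

lemma weqs_conn:
  assumes w: "w \<in> weqs" "w \<in> hom K A B"
  shows "conn_inj (view A) (view B) (act w)" "conn_surj (view A) (view B) (act w)"
proof -
  note AB = homD[OF w(2)]
  obtain RA \<eta>A RB \<eta>B where RA: "reflection A RA \<eta>A" and RB: "reflection B RB \<eta>B"
    using reflection_exists AB by blast
  note ra = reflectionD[OF RA] and rb = reflectionD[OF RB]
  note oRA = over_view[OF ra(1)] and oRB = over_view[OF rb(1)]
  note oA = over_view[OF AB(1)] and oB = over_view[OF AB(2)]
  obtain h where h: "h \<in> hom K B RA" "Comp K h w = \<eta>A" by (rule weqs_extend[OF w ra(1-3)])
  have hw: "act h (act w x) = act \<eta>A x" if "x \<in> M A" for x
    using Comp_K(2)[OF w(2) h(1) that] h(2) by simp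
  show "conn_inj (view A) (view B) (act w)"
    unfolding conn_inj_def
  proof (intro ballI impI)
    fix p q assume p: "p \<in> El C (view A)" and q: "q \<in> El C (view A)"
      and c: "conn C (view B) (fst p, act w (snd p)) (fst q, act w (snd q))"
    have "restr (view RA) (fst p) (act h (act w (snd p))) = restr (view RA) (fst q) (act h (act w (snd q)))"
      using conn_restr[OF oB oRA ra(2) act_omor[OF h(1)] c] by simp
    then show "conn C (view A) p q" using ra(5)[OF p q] hw ElD(2)[OF p] ElD(2)[OF q] by simp
  qed
  have Bw: "Comp K \<eta>B w \<in> hom K A RB" by (rule Comp_K(1)[OF w(2) rb(3)])
  obtain k where k: "k \<in> hom K RA RB" "Comp K k \<eta>A = Comp K \<eta>B w"
    by (rule weqs_extend[OF ra(4,3) rb(1,2) Bw])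
  have kh: "Comp K k h = \<eta>B"
    by (rule weqs_unique[OF w rb(1,2) Comp_K(1)[OF h(1) k(1)] rb(3)])
      (use K_assoc[OF w(2) h(1) k(1)] h(2) k(2) in simp)
  show "conn_surj (view A) (view B) (act w)"
    unfolding conn_surj_def
  proof (intro ballI)
    fix q assume q: "q \<in> El C (view B)"
    note qD = ElD[OF q] and hq = ElD[OF El_omor[OF act_omor[OF h(1)] q], unfolded fst_conv snd_conv]
    let ?e = "restr (view RA) (fst q) (act h (snd q))"
    note e = restr[OF oRA ra(2) hq(2,3,1,5)]
    obtain p where p: "p \<in> El C (view A)" "?e = restr (view RA) (fst p) (act \<eta>A (snd p))"
      using ra(6)[OF e(1,2)] by blast
    note pD = ElD[OF p(1)] and \<eta>p = ElD[OF El_omor[OF act_omor[OF ra(3)] p(1)], unfolded fst_conv snd_conv]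
    have wp: "(fst p, act w (snd p)) \<in> El C (view B)" by (rule El_omor[OF act_omor[OF w(2)] p(1)])
    have "restr (view RB) (fst q) (act \<eta>B (snd q)) = restr (view RB) (fst q) (act k (act h (snd q)))"
      using Comp_K(2)[OF h(1) k(1) qD(2)] kh by simp
    also have "\<dots> = act k ?e"
      by (rule omor_restr[OF oRA ra(2) oRB rb(2) act_omor[OF k(1)] hq(2,3,1,5)])
    also have "\<dots> = restr (view RB) (fst p) (act k (act \<eta>A (snd p)))"
      unfolding p(2) by (rule omor_restr[OF oRA ra(2) oRB rb(2) act_omor[OF k(1)] \<eta>p(2,3,1,5), symmetric])
    also have "\<dots> = restr (view RB) (fst p) (act \<eta>B (act w (snd p)))"
      using Comp_K(2)[OF ra(3) k(1) pD(2)] k(2) Comp_K(2)[OF w(2) rb(3) pD(2)] by simp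
    finally have "conn C (view B) q (fst p, act w (snd p))" using rb(5)[OF q wp] by simp
    then show "\<exists>p\<in>El C (view A). conn C (view B) q (fst p, act w (snd p))" using p(1) by blast
  qed
qed

text \<open>To extend \<open>g\<close> at an object \<open>b\<close>, the component of the identity
  point at \<open>b\<close> is represented by a point of \<open>A\<close>, and the image under
  \<open>g\<close> is restricted along it. Surjectivity provides the point, injectivity makes the
  value independent of it. Surjectivity also gives uniqueness of extensions.\<close>

lemma conn_weqs:
  assumes w: "w \<in> hom K A B"
    and inj: "conn_inj (view A) (view B) (act w)" and surj: "conn_surj (view A) (view B) (act w)"
  shows "w \<in> weqs"
proof (rule weqsI[OF w])
  note AB = homD[OF w]
  note oA = over_view[OF AB(1)] and oB = over_view[OF AB(2)] and ow = act_omor[OF w]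
  fix Q h k assume Q: "Q \<in> Obj K" "dfib C (view Q)" and h: "h \<in> hom K B Q" and k: "k \<in> hom K B Q"
    and e: "Comp K h w = Comp K k w"
  note oQ = over_view[OF Q(1)]
  have hkw: "act h (act w x) = act k (act w x)" if "x \<in> M A" for x
    using Comp_K(2)[OF w h that] Comp_K(2)[OF w k that] e by simp
  have eq: "act h b = act k b" if b: "b \<in> M B" "cd (view B) b = b" for b
  proof -
    have q: "(pr (view B) b, b) \<in> El C (view B)" by (rule El_id[OF oB b])
    then obtain p where p: "p \<in> El C (view A)" "conn C (view B) (pr (view B) b, b) (fst p, act w (snd p))"
      using surj unfolding conn_surj_def by blast
    have r: "restr (view Q) (pr (view B) b) (act f b) = act f b" if f: "f \<in> hom K B Q" for f
      using omor_lift(2)[OF oB oQ Q(2) act_omor[OF f] b(1)] b dm_identity[OF oB b] by simp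
    have "act h b = restr (view Q) (fst p) (act h (act w (snd p)))"
      using conn_restr[OF oB oQ Q(2) act_omor[OF h] p(2)] r[OF h] by simp
    also have "\<dots> = restr (view Q) (fst p) (act k (act w (snd p)))" using hkw ElD(2)[OF p(1)] by simp
    also have "\<dots> = act k b"
      using conn_restr[OF oB oQ Q(2) act_omor[OF k] p(2)] r[OF k] by simp
    finally show ?thesis .
  qed
  show "h = k"
    using omor_dfib_unique[OF oB oQ Q(2) act_omor[OF h] act_omor[OF k]] eq by (intro hom_eqI[OF h k]) blast
next
  note AB = homD[OF w]
  note oA = over_view[OF AB(1)] and oB = over_view[OF AB(2)] and ow = act_omor[OF w]
  fix Q g assume Q: "Q \<in> Obj K" "dfib C (view Q)" and g: "g \<in> hom K A Q"
  note oQ = over_view[OF Q(1)] and og = act_omor[OF g]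
  have "\<forall>q\<in>El C (view B). \<exists>p. p \<in> El C (view A) \<and> conn C (view B) q (fst p, act w (snd p))"
    using surj unfolding conn_surj_def by blast
  then obtain s where s: "\<And>q. q \<in> El C (view B) \<Longrightarrow> s q \<in> El C (view A)"
    and sc: "\<And>q. q \<in> El C (view B) \<Longrightarrow> conn C (view B) q (fst (s q), act w (snd (s q)))" by metis
  define \<tau> where "\<tau> p = restr (view Q) (fst p) (act g (snd p))" for p
  have \<tau>: "\<tau> p = \<tau> p'" if "p \<in> El C (view A)" "p' \<in> El C (view A)"
    "conn C (view B) (fst p, act w (snd p)) (fst p', act w (snd p'))" for p p'
    unfolding \<tau>_def using inj that unfolding conn_inj_def by (intro conn_restr[OF oA oQ Q(2) og]) blast
  have \<tau>Q: "\<tau> p \<in> M Q" "cd (view Q) (\<tau> p) = \<tau> p" "pr (view Q) (\<tau> p) = Ident C (Dom C (fst p))"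
    if p: "p \<in> El C (view A)" for p
    using restr[OF oQ Q(2)] ElD[OF El_omor[OF og p]] unfolding \<tau>_def by auto
  define \<sigma> where "\<sigma> b = \<tau> (s (pr (view B) b, b))" for b
  have id: "(pr (view B) b, b) \<in> El C (view B)" if "b \<in> M B" "cd (view B) b = b" for b
    by (rule El_id[OF oB that])
  have "\<exists>\<phi>. omor (view B) (view Q) \<phi> \<and> (\<forall>b\<in>M B. cd (view B) b = b \<longrightarrow> \<phi> b = \<sigma> b)"
  proof (rule build_into_dfib[OF oB oQ Q(2), of \<sigma>])
    fix b assume b: "b \<in> M B" "cd (view B) b = b"
    have "Dom C (fst (s (pr (view B) b, b))) = Dom C (pr (view B) b)"
      using conn_in[OF oB sc[OF id[OF b]]] by simp
    moreover have "Ident C (Dom C (pr (view B) b)) = pr (view B) b"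
      using overD(10)[OF oB b(1)] dm_identity[OF oB b] by simp
    ultimately show "\<sigma> b \<in> M Q \<and> cd (view Q) (\<sigma> b) = \<sigma> b \<and> pr (view Q) (\<sigma> b) = pr (view B) b"
      using \<tau>Q[OF s[OF id[OF b]]] unfolding \<sigma>_def by simp
  next
    fix f assume f: "f \<in> M B"
    note o = overD[OF oB f]
    let ?c = "cd (view B) f" and ?d = "dm (view B) f" and ?u = "pr (view B) f"
    let ?p = "s (pr (view B) ?c, ?c)"
    note c = id[OF o(2,6)] and d = id[OF o(1,4)]
    have Du: "Cod C ?u = Dom C (fst ?p)" using conn_in[OF oB sc[OF c]] o by simp
    have p': "(Comp C (fst ?p) ?u, snd ?p) \<in> El C (view A)" by (rule El_precomp[OF s[OF c] o(9) Du])
    have "conn C (view B) (Comp C (pr (view B) ?c) ?u, ?c) (Comp C (fst ?p) ?u, act w (snd ?p))"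
      using conn_precomp[OF oB sc[OF c] o(9)] o by simp
    then have 1: "conn C (view B) (?u, ?c) (Comp C (fst ?p) ?u, act w (snd ?p))" using o by simp
    have "conn C (view B) (Ident C (Dom C ?u), ?d) (Comp C ?u (Ident C (Dom C ?u)), ?c)"
      by (rule conn_step[OF f]) (use o(9) in simp_all)
    then have 2: "conn C (view B) (pr (view B) ?d, ?d) (?u, ?c)" using o by simp
    \<comment> \<open>Naturality: the point chosen at the codomain, precomposed with
      \<open>?u\<close>, and the point chosen at the domain are connected in \<open>B\<close>, so
      \<open>\<tau>\<close> takes the same value on both.\<close>
    have "\<tau> (Comp C (fst ?p) ?u, snd ?p) = \<tau> (s (pr (view B) ?d, ?d))"
      by (rule \<tau>[OF p' s[OF d]])
        (use conn_trans[OF conn_sym[OF 1] conn_trans[OF conn_sym[OF 2] sc[OF d]]] in simp)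
    moreover have "\<tau> (Comp C (fst ?p) ?u, snd ?p) = restr (view Q) ?u (\<tau> ?p)"
      unfolding \<tau>_def fst_conv snd_conv
      by (rule restr_Comp[OF oQ Q(2)]) (use ElD[OF El_omor[OF og s[OF c]]] o(9) Du in auto)
    ultimately show "restr (view Q) ?u (\<sigma> ?c) = \<sigma> ?d" by (simp add: \<sigma>_def)
  qed blast
  then obtain \<phi> where \<phi>: "omor (view B) (view Q) \<phi>" "\<And>b. b \<in> M B \<Longrightarrow> cd (view B) b = b \<Longrightarrow> \<phi> b = \<sigma> b" by blast
  have h: "mk B Q \<phi> \<in> hom K B Q" by (rule mk_hom[OF AB(2) Q(1) \<phi>(1)])
  have "act (Comp K (mk B Q \<phi>) w) a = act g a" if a: "a \<in> M A" "cd (view A) a = a" for a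
  proof -
    note wa = omorD[OF ow a(1)]
    have wid: "cd (view B) (act w a) = act w a" using wa(3) a(2) by simp
    have pa: "(pr (view A) a, a) \<in> El C (view A)" by (rule El_id[OF oA a])
    have "act (Comp K (mk B Q \<phi>) w) a = \<sigma> (act w a)"
      using Comp_K(2)[OF w h a(1)] wa(1) \<phi>(2)[OF wa(1) wid] by simp
    also have "\<dots> = \<tau> (pr (view A) a, a)"
      unfolding \<sigma>_def
      by (rule \<tau>[OF s[OF id[OF wa(1) wid]] pa]) (use conn_sym[OF sc[OF id[OF wa(1) wid]]] wa(4) in simp)
    also have "\<dots> = act g a"
      unfolding \<tau>_def using omor_lift(2)[OF oA oQ Q(2) og a(1)] a dm_identity[OF oA a] by simp
    finally show ?thesis .
  qed
  then have "Comp K (mk B Q \<phi>) w = g"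
    using omor_dfib_unique[OF oA oQ Q(2) act_omor[OF Comp_K(1)[OF w h]] og]
    by (intro hom_eqI[OF Comp_K(1)[OF w h] g]) blast
  then show "\<exists>h \<in> hom K B Q. Comp K h w = g" using h by blast
qed

section \<open>The two weak factorisation systems\<close>

lemma iso_in_K:
  "iso_in K f \<longleftrightarrow> f \<in> Mor K \<and> (\<exists>g \<in> hom K (Cod K f) (Dom K f).
     Comp K g f = Ident K (Dom K f) \<and> Comp K f g = Ident K (Cod K f))"
  by (simp add: iso_in_def)

lemma liftsI:
  assumes "f \<in> hom K A B" "g \<in> hom K X Y"
    and "\<And>u v. u \<in> hom K A X \<Longrightarrow> v \<in> hom K B Y \<Longrightarrow> Comp K g u = Comp K v f \<Longrightarrow>
      \<exists>h \<in> hom K B X. Comp K h f = u \<and> Comp K g h = v"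
  shows "lifts K f g"
  using assms hom_Mor[OF assms(1)] hom_Mor[OF assms(2)] by (simp add: lifts_def)

lemma liftsD:
  assumes "lifts K f g" "f \<in> hom K A B" "g \<in> hom K X Y" "u \<in> hom K A X" "v \<in> hom K B Y" "Comp K g u = Comp K v f"
  obtains h where "h \<in> hom K B X" "Comp K h f = u" "Comp K g h = v"
proof -
  have "\<exists>h \<in> hom K B X. Comp K h f = u \<and> Comp K g h = v"
    using assms hom_Mor[OF assms(2)] hom_Mor[OF assms(3)] by (simp add: lifts_def)
  then show thesis using that by blast
qed

lemma iso_lifts_right:
  assumes f: "f \<in> hom K A B" and g: "iso_in K g"
  shows "lifts K f g"
proof -
  define X Y where "X = Dom K g" and "Y = Cod K g"
  have gh: "g \<in> hom K X Y" using g Mor_hom unfolding X_def Y_def iso_in_K by blast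
  obtain k where k: "k \<in> hom K Y X" "Comp K k g = Ident K X" "Comp K g k = Ident K Y"
    using g unfolding X_def Y_def iso_in_K by blast
  show ?thesis
  proof (rule liftsI[OF f gh])
    fix u v assume u: "u \<in> hom K A X" and v: "v \<in> hom K B Y" and e: "Comp K g u = Comp K v f"
    have "Comp K (Comp K k v) f = u" "Comp K g (Comp K k v) = v"
      using K_assoc[OF f v k(1)] K_assoc[OF u gh k(1)] K_assoc[OF v k(1) gh] e k(2,3) K_unit(2)[OF u] K_unit(2)[OF v]
      by simp_all
    then show "\<exists>h \<in> hom K B X. Comp K h f = u \<and> Comp K g h = v" using Comp_K(1)[OF v k(1)] by blast
  qed
qed

text \<open>In the square from \<open>f\<close> to itself with identities as the other two sides, a
  lift is a two-sided inverse.\<close>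

lemma self_lift_iso:
  assumes f: "f \<in> Mor K" and l: "lifts K f f"
  shows "iso_in K f"
proof -
  define A B where "A = Dom K f" and "B = Cod K f"
  have fh: "f \<in> hom K A B" using f Mor_hom by (simp add: A_def B_def)
  note AB = homD[OF fh]
  obtain h where "h \<in> hom K B A" "Comp K h f = Ident K A" "Comp K f h = Ident K B"
    by (rule liftsD[OF l fh fh Ident_K(1)[OF AB(1)] Ident_K(1)[OF AB(2)]]) (simp_all add: K_unit[OF fh])
  then show ?thesis using f by (auto simp: iso_in_K A_def B_def)
qed

lemma iso_weqs:
  assumes "iso_in K f"
  shows "f \<in> weqs"
proof -
  define A B where "A = Dom K f" and "B = Cod K f"
  have fh: "f \<in> hom K A B" using assms Mor_hom unfolding A_def B_def iso_in_K by blast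
  obtain k where k: "k \<in> hom K B A" "Comp K k f = Ident K A" "Comp K f k = Ident K B"
    using assms unfolding A_def B_def iso_in_K by blast
  show ?thesis
  proof (rule weqsI[OF fh])
    fix Q g assume "g \<in> hom K A Q"
    then have "Comp K g k \<in> hom K B Q" "Comp K (Comp K g k) f = g"
      using Comp_K(1)[OF k(1)] K_assoc[OF fh k(1)] k(2) K_unit(1) by auto
    then show "\<exists>h \<in> hom K B Q. Comp K h f = g" by blast
  next
    fix Q a b assume a: "a \<in> hom K B Q" and b: "b \<in> hom K B Q" and e: "Comp K a f = Comp K b f"
    have "a = Comp K (Comp K a f) k" using K_assoc[OF k(1) fh a] k(3) K_unit(1)[OF a] by simp
    also have "\<dots> = b" using K_assoc[OF k(1) fh b] k(3) K_unit(1)[OF b] e by simp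
    finally show "a = b" .
  qed
qed

text \<open>Precomposition with a composite is the composite of the precompositions, and bijections
  have the two-out-of-three property.\<close>

lemma weqs_comp:
  assumes f: "f \<in> hom K A B" and g: "g \<in> hom K B D"
  shows "f \<in> weqs \<Longrightarrow> g \<in> weqs \<Longrightarrow> Comp K g f \<in> weqs"
    "f \<in> weqs \<Longrightarrow> Comp K g f \<in> weqs \<Longrightarrow> g \<in> weqs"
    "g \<in> weqs \<Longrightarrow> Comp K g f \<in> weqs \<Longrightarrow> f \<in> weqs"
proof -
  note gf = Comp_K(1)[OF f g]
  show "Comp K g f \<in> weqs" if W: "f \<in> weqs" "g \<in> weqs"
  proof (rule weqsI[OF gf])
    fix Q a assume Q: "Q \<in> Obj K" "dfib C (view Q)" and a: "a \<in> hom K A Q"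
    obtain b where b: "b \<in> hom K B Q" "Comp K b f = a" by (rule weqs_extend[OF W(1) f Q a])
    obtain c where c: "c \<in> hom K D Q" "Comp K c g = b" by (rule weqs_extend[OF W(2) g Q b(1)])
    show "\<exists>h \<in> hom K D Q. Comp K h (Comp K g f) = a" using K_assoc[OF f g c(1)] b c by auto
  next
    fix Q h k assume Q: "Q \<in> Obj K" "dfib C (view Q)" and h: "h \<in> hom K D Q" and k: "k \<in> hom K D Q"
      and e: "Comp K h (Comp K g f) = Comp K k (Comp K g f)"
    have "Comp K h g = Comp K k g"
      by (rule weqs_unique[OF W(1) f Q Comp_K(1)[OF g h] Comp_K(1)[OF g k]])
        (use K_assoc[OF f g h] K_assoc[OF f g k] e in simp)
    then show "h = k" by (rule weqs_unique[OF W(2) g Q h k])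
  qed
  show "g \<in> weqs" if W: "f \<in> weqs" "Comp K g f \<in> weqs"
  proof (rule weqsI[OF g])
    fix Q b assume Q: "Q \<in> Obj K" "dfib C (view Q)" and b: "b \<in> hom K B Q"
    obtain c where c: "c \<in> hom K D Q" "Comp K c (Comp K g f) = Comp K b f"
      by (rule weqs_extend[OF W(2) gf Q Comp_K(1)[OF f b]])
    have "Comp K c g = b"
      by (rule weqs_unique[OF W(1) f Q Comp_K(1)[OF g c(1)] b]) (use K_assoc[OF f g c(1)] c(2) in simp)
    then show "\<exists>h \<in> hom K D Q. Comp K h g = b" using c(1) by blast
  next
    fix Q h k assume Q: "Q \<in> Obj K" "dfib C (view Q)" and h: "h \<in> hom K D Q" and k: "k \<in> hom K D Q"
      and e: "Comp K h g = Comp K k g"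
    show "h = k"
      by (rule weqs_unique[OF W(2) gf Q h k]) (use K_assoc[OF f g h] K_assoc[OF f g k] e in simp)
  qed
  show "f \<in> weqs" if W: "g \<in> weqs" "Comp K g f \<in> weqs"
  proof (rule weqsI[OF f])
    fix Q a assume Q: "Q \<in> Obj K" "dfib C (view Q)" and a: "a \<in> hom K A Q"
    obtain c where c: "c \<in> hom K D Q" "Comp K c (Comp K g f) = a" by (rule weqs_extend[OF W(2) gf Q a])
    show "\<exists>h \<in> hom K B Q. Comp K h f = a"
      using K_assoc[OF f g c(1)] c Comp_K(1)[OF g c(1)] by (intro bexI[of _ "Comp K c g"]) auto
  next
    fix Q h k assume Q: "Q \<in> Obj K" "dfib C (view Q)" and h: "h \<in> hom K B Q" and k: "k \<in> hom K B Q"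
      and e: "Comp K h f = Comp K k f"
    obtain h' where h': "h' \<in> hom K D Q" "Comp K h' g = h" by (rule weqs_extend[OF W(1) g Q h])
    obtain k' where k': "k' \<in> hom K D Q" "Comp K k' g = k" by (rule weqs_extend[OF W(1) g Q k])
    have "h' = k'"
      by (rule weqs_unique[OF W(2) gf Q h'(1) k'(1)])
        (use K_assoc[OF f g h'(1)] K_assoc[OF f g k'(1)] h'(2) k'(2) e in simp)
    then show "h = k" using h' k' by simp
  qed
qed

lemma two_out_of_three_weqs: "two_out_of_three K weqs"
  unfolding two_out_of_three_def
proof (intro ballI impI)
  fix f g assume "f \<in> Mor K" "g \<in> Mor K" "Dom K g = Cod K f"
  then have f: "f \<in> hom K (Dom K f) (Cod K f)" and g: "g \<in> hom K (Cod K f) (Cod K g)"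
    using Mor_hom[of f] Mor_hom[of g] by auto
  show "(f \<in> weqs \<and> g \<in> weqs \<longrightarrow> Comp K g f \<in> weqs) \<and> (f \<in> weqs \<and> Comp K g f \<in> weqs \<longrightarrow> g \<in> weqs) \<and>
    (g \<in> weqs \<and> Comp K g f \<in> weqs \<longrightarrow> f \<in> weqs)"
    using weqs_comp[OF f g] by blast
qed

definition fibs where "fibs = rlp K weqs"

lemma fibsI: 
  assumes "p \<in> hom K X Y"
    and "\<And>A B w u v. w \<in> weqs \<Longrightarrow> w \<in> hom K A B \<Longrightarrow> u \<in> hom K A X \<Longrightarrow> v \<in> hom K B Y \<Longrightarrow>
      Comp K p u = Comp K v w \<Longrightarrow> \<exists>h \<in> hom K B X. Comp K h w = u \<and> Comp K p h = v"
  shows "p \<in> fibs"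
  unfolding fibs_def rlp_def
proof (intro CollectI conjI ballI)
  show "p \<in> Mor K" using hom_Mor[OF assms(1)] by simp
  fix w assume w: "w \<in> weqs"
  then have "w \<in> hom K (Dom K w) (Cod K w)" by (intro Mor_hom) (simp add: weqs_def)
  then show "lifts K w p" using assms(2)[OF w] by (intro liftsI[OF _ assms(1)])
qed

text \<open>A map in both classes lifts against itself, hence is an isomorphism.\<close>

lemma fibs_weqs: "fibs \<inter> weqs = {f. iso_in K f}"
proof (intro set_eqI iffI)
  fix f assume "f \<in> fibs \<inter> weqs"
  then show "f \<in> {f. iso_in K f}" using self_lift_iso by (auto simp: fibs_def rlp_def)
next
  fix f assume f: "f \<in> {f. iso_in K f}"
  then have "f \<in> Mor K" by (simp add: iso_in_K)
  moreover have "lifts K w f" if "w \<in> weqs" for w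
    using iso_lifts_right[OF Mor_hom] f that by (simp add: weqs_def)
  ultimately show "f \<in> fibs \<inter> weqs" using iso_weqs f by (simp add: fibs_def rlp_def)
qed

lemma rlp_all: "rlp K (Mor K) = {f. iso_in K f}"
proof (intro set_eqI iffI)
  fix f assume "f \<in> rlp K (Mor K)"
  then show "f \<in> {f. iso_in K f}" using self_lift_iso by (auto simp: rlp_def)
next
  fix f assume "f \<in> {f. iso_in K f}"
  then show "f \<in> rlp K (Mor K)" using iso_lifts_right[OF Mor_hom] by (simp add: rlp_def iso_in_K)
qed

lemma iso_Ident: "X \<in> Obj K \<Longrightarrow> iso_in K (Ident K X)"
  using Ident_K(1)[of X] hom_Mor[OF Ident_K(1), of X] K_unit[OF Ident_K(1), of X] by (auto simp: iso_in_K)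

lemma wfs_all_iso: "weak_factorisation_system K (Mor K) {f. iso_in K f}"
  unfolding weak_factorisation_system_def
proof (intro conjI ballI)
  show "Mor K = llp K {f. iso_in K f}" using iso_lifts_right[OF Mor_hom] by (auto simp: llp_def)
  show "{f. iso_in K f} = rlp K (Mor K)" by (simp add: rlp_all)
  fix f assume f: "f \<in> Mor K"
  have "iso_in K (Ident K (Cod K f))" "Dom K (Ident K (Cod K f)) = Cod K f" "f = Comp K (Ident K (Cod K f)) f"
    using iso_Ident hom_Mor[OF Ident_K(1)] K_unit(2)[OF Mor_hom[OF f]] f by auto
  then show "\<exists>l\<in>Mor K. \<exists>r\<in>{f. iso_in K f}. Cod K l = Dom K r \<and> f = Comp K r l" using f by (metis mem_Collect_eq)
qed

section \<open>Fibrant objects\<close>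

lemma bij_of_inverse:
  assumes f: "f \<in> hom K A B" and g: "g \<in> hom K B A" and e: "Comp K g f = Ident K A" "Comp K f g = Ident K B"
  shows "bij_betw (act f) (M A) (M B)"
proof (rule bij_betwI[where g = "act g"])
  note AB = homD[OF f]
  show "act f \<in> M A \<rightarrow> M B" "act g \<in> M B \<rightarrow> M A" using act_in f g by auto
  show "act g (act f x) = x" if "x \<in> M A" for x
    using Comp_K(2)[OF f g that] e(1) Ident_K(2)[OF AB(1) that] by simp
  show "act f (act g x) = x" if "x \<in> M B" for x
    using Comp_K(2)[OF g f that] e(2) Ident_K(2)[OF AB(2) that] by simp
qed

text \<open>The lift and its upper triangle come from extending into \<open>P\<close>; the lower
  triangle commutes by uniqueness of extensions into \<open>Q\<close>.\<close>

lemma dfib_lifts: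
  assumes P: "dfib C (view P)" and Q: "dfib C (view Q)" and F: "F \<in> hom K P Q"
  shows "F \<in> fibs"
proof (rule fibsI[OF F])
  note PQ = homD[OF F]
  fix A B w u v assume w: "w \<in> weqs" "w \<in> hom K A B" and u: "u \<in> hom K A P" and v: "v \<in> hom K B Q"
    and e: "Comp K F u = Comp K v w"
  obtain h where h: "h \<in> hom K B P" "Comp K h w = u" by (rule weqs_extend[OF w PQ(1) P u])
  have "Comp K F h = v"
    by (rule weqs_unique[OF w PQ(2) Q Comp_K(1)[OF h(1) F] v]) (use K_assoc[OF w(2) h(1) F] h(2) e in simp)
  then show "\<exists>h \<in> hom K B P. Comp K h w = u \<and> Comp K F h = v" using h by blast
qed

lemma dfib_weq_iff_iso:
  assumes P: "dfib C (view P)" and Q: "dfib C (view Q)" and F: "F \<in> hom K P Q"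
  shows "F \<in> weqs \<longleftrightarrow> iso_in K F"
  using dfib_lifts[OF assms] fibs_weqs by auto

lemma terminal_exists: "\<exists>t. terminal K t"
proof -
  have "\<exists>Z \<pi>. product_cone ({} :: 'u set) (\<lambda>_. undefined) Z \<pi>"
    by (rule products) (simp_all add: small_finite)
  then obtain Z \<pi> where "product_cone ({} :: 'u set) (\<lambda>_. undefined) Z \<pi>" by blast
  note Z = product_coneD[OF this]
  have "\<exists>!f. f \<in> hom K Y Z" if Y: "Y \<in> Obj K" for Y
  proof -
    obtain G where G: "G \<in> hom K Y Z" using Z(3)[OF Y] by blast
    have "F = G" if F: "F \<in> hom K Y Z" for F
    proof (rule hom_eqI[OF F G])
      fix y assume y: "y \<in> M Y"
      show "act F y = act G y"
        by (rule Z(4)) (use act_in[OF F y] act_in[OF G y] omorD(4)[OF act_omor[OF F] y] omorD(4)[OF act_omor[OF G] y] in auto)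
    qed
    then show ?thesis using G by blast
  qed
  then have "terminal K Z" unfolding terminal_def using Z(1) by blast
  then show ?thesis by blast
qed

text \<open>Lifting the unit of the reflection against the map to the terminal object yields a
  retraction \<open>h\<close> of the unit. Uniqueness of extensions into \<open>R\<close> makes
  \<open>h\<close> an inverse, and a category isomorphic to a discrete fibration is one.\<close>

lemma fibrant_iff_dfib:
  assumes P: "P \<in> Obj K"
  shows "(\<exists>t. terminal K t \<and> (\<exists>f \<in> hom K P t. f \<in> fibs)) \<longleftrightarrow> dfib C (view P)"
proof
  assume "\<exists>t. terminal K t \<and> (\<exists>f \<in> hom K P t. f \<in> fibs)"
  then obtain t f where t: "terminal K t" and f: "f \<in> hom K P t" "f \<in> fibs" by blast
  obtain R \<eta> where "reflection P R \<eta>" using reflection_exists[OF P] by blast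
  note r = reflectionD[OF this]
  have "lifts K \<eta> f" using f(2) r(4) by (simp add: fibs_def rlp_def)
  moreover obtain v where v: "v \<in> hom K R t" using t r(1) by (auto simp: terminal_def)
  moreover have "Comp K f (Ident K P) = Comp K v \<eta>"
    using t P K_unit(1)[OF f(1)] f(1) Comp_K(1)[OF r(3) v] by (auto simp: terminal_def)
  ultimately obtain h where h: "h \<in> hom K R P" "Comp K h \<eta> = Ident K P"
    using liftsD[OF _ r(3) f(1) Ident_K(1)[OF P]] by metis
  have "Comp K \<eta> h = Ident K R"
    by (rule weqs_unique[OF r(4,3,1,2) Comp_K(1)[OF h(1) r(3)] Ident_K(1)[OF r(1)]])
      (use K_assoc[OF r(3) h(1) r(3)] h(2) K_unit[OF r(3)] in simp)
  then show "dfib C (view P)"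
    using dfib_iso[OF over_view[OF r(1)] act_omor[OF h(1)] bij_of_inverse[OF h(1) r(3) _ h(2)] r(2)] by blast
next
  assume d: "dfib C (view P)"
  obtain t where t: "terminal K t" using terminal_exists by blast
  then obtain f where f: "f \<in> hom K P t" using P by (auto simp: terminal_def)
  have "f \<in> fibs"
  proof (rule fibsI[OF f])
    fix A B w u v assume w: "w \<in> weqs" "w \<in> hom K A B" and u: "u \<in> hom K A P" and v: "v \<in> hom K B t"
    obtain h where h: "h \<in> hom K B P" "Comp K h w = u" by (rule weqs_extend[OF w P d u])
    have "Comp K f h = v" using t Comp_K(1)[OF h(1) f] v homD(1)[OF v] by (auto simp: terminal_def)
    then show "\<exists>h \<in> hom K B P. Comp K h w = u \<and> Comp K f h = v" using h by blast
  qed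
  then show "\<exists>t. terminal K t \<and> (\<exists>f \<in> hom K P t. f \<in> fibs)" using t f by blast
qed

section \<open>Factorisation and the retract argument\<close>

lemma binary_product:
  assumes X: "X \<in> Obj K" and Y: "Y \<in> Obj K"
  obtains Z p q where "Z \<in> Obj K" "p \<in> hom K Z X" "q \<in> hom K Z Y"
    "\<And>W f g. f \<in> hom K W X \<Longrightarrow> g \<in> hom K W Y \<Longrightarrow> \<exists>h \<in> hom K W Z. Comp K p h = f \<and> Comp K q h = g"
    "\<And>x y. x \<in> M Z \<Longrightarrow> y \<in> M Z \<Longrightarrow> act p x = act p y \<Longrightarrow> act q x = act q y \<Longrightarrow> x = y"
proof -
  have "\<And>b. b \<in> UNIV \<Longrightarrow> (if b then X else Y) \<in> Obj K" using X Y by simp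
  then obtain Z \<pi> where "product_cone (UNIV :: bool set) (\<lambda>b. if b then X else Y) Z \<pi>"
    using products[of "UNIV :: bool set" "\<lambda>b. if b then X else Y"] small_finite[of "UNIV :: bool set"] by auto
  note Z = product_coneD[OF this]
  have p: "\<pi> True \<in> hom K Z X" and q: "\<pi> False \<in> hom K Z Y" using Z(2)[of True] Z(2)[of False] by auto
  show thesis
  proof (rule that[OF Z(1) p q])
    fix W f g assume f: "f \<in> hom K W X" and g: "g \<in> hom K W Y"
    show "\<exists>h \<in> hom K W Z. Comp K (\<pi> True) h = f \<and> Comp K (\<pi> False) h = g"
    proof -
      have "\<exists>G \<in> hom K W Z. \<forall>b\<in>UNIV. Comp K (\<pi> b) G = (if b then f else g)"
        by (rule Z(3)[OF homD(1)[OF f]]) (simp add: f g)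
      then obtain G where "G \<in> hom K W Z" "\<And>b. Comp K (\<pi> b) G = (if b then f else g)" by blast
      then show ?thesis by (intro bexI[of _ G]) simp_all
    qed
  next
    fix x y assume xy: "x \<in> M Z" "y \<in> M Z" and e: "act (\<pi> True) x = act (\<pi> True) y" "act (\<pi> False) x = act (\<pi> False) y"
    show "x = y"
    proof (rule Z(4)[OF xy])
      show "pr (view Z) x = pr (view Z) y"
        using omorD(4)[OF act_omor[OF p] xy(1)] omorD(4)[OF act_omor[OF p] xy(2)] e by simp
      show "act (\<pi> i) x = act (\<pi> i) y" for i using e by (cases i) auto
    qed
  qed
qed

lemma closed_image_equaliser:
  assumes k: "k \<in> hom K E Z" "inj_on (act k) (M E)" and \<psi>: "\<psi> \<in> hom K E Q" "\<psi>' \<in> hom K E Q"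
  shows "closed (view Z) (act k ` {e \<in> M E. act \<psi> e = act \<psi>' e})"
proof -
  note E = homD(1)[OF k(1)]
  let ?E = "{e \<in> M E. \<forall>t\<in>(UNIV :: unit set). act \<psi> e = act \<psi>' e}"
  have c: "closed (view E) ?E"
    by (rule closed_equaliser[OF over_view[OF E]]) (rule act_omor[OF \<psi>(1)] act_omor[OF \<psi>(2)])+
  have o: "omor (view E\<lparr>Ar := ?E\<rparr>) (view Z) (act k)"
    using omor_compose[OF over_restrict[OF over_view[OF E] c] omor_restrict_inclusion[OF c] act_omor[OF k(1)]] .
  have "inj_on (act k) (Ar (view E\<lparr>Ar := ?E\<rparr>))" using k(2) by (auto simp: inj_on_def)
  from closed_image[OF over_restrict[OF over_view[OF E] c] o this] show ?thesis by simp
qed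

lemma factorisation:
  assumes f: "f \<in> hom K X Y"
  obtains E l r where "l \<in> hom K X E" "r \<in> hom K E Y" "l \<in> weqs" "r \<in> fibs" "Comp K r l = f"
proof -
  note XY = homD[OF f]
  obtain R \<eta> where "reflection X R \<eta>" using reflection_exists[OF XY(1)] by blast
  note r = reflectionD(1-4)[OF this]
  obtain Z p q where Z: "Z \<in> Obj K" and p: "p \<in> hom K Z Y" and q: "q \<in> hom K Z R"
    and pair: "\<And>W f g. f \<in> hom K W Y \<Longrightarrow> g \<in> hom K W R \<Longrightarrow> \<exists>h \<in> hom K W Z. Comp K p h = f \<and> Comp K q h = g"
    and jinj: "\<And>x y. x \<in> M Z \<Longrightarrow> y \<in> M Z \<Longrightarrow> act p x = act p y \<Longrightarrow> act q x = act q y \<Longrightarrow> x = y"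
    using binary_product[OF XY(2) r(1)] by metis
  obtain i where i: "i \<in> hom K X Z" "Comp K p i = f" "Comp K q i = \<eta>" using pair[OF f r(3)] by blast
  have iZ: "act i ` M X \<subseteq> M Z" using act_in[OF i(1)] by blast
  \<comment> \<open>The right lifting property of the inclusion of \<open>N\<close> into
    \<open>Z\<close>, phrased by membership of arrows instead of existence of lifts; in this form it
    passes to intersections.\<close>
  define stable where "stable N \<longleftrightarrow> closed (view Z) N \<and>
    (\<forall>A B w v. w \<in> weqs \<longrightarrow> w \<in> hom K A B \<longrightarrow> v \<in> hom K B Z \<longrightarrow> (\<forall>a \<in> M A. act v (act w a) \<in> N) \<longrightarrow> (\<forall>b \<in> M B. act v b \<in> N))" for N
  define N where "N = \<Inter>{N. stable N \<and> act i ` M X \<subseteq> N}"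
  have "stable (M Z)" unfolding stable_def using closed_Ar[OF over_view[OF Z]] act_in by blast
  then have ne: "{N. stable N \<and> act i ` M X \<subseteq> N} \<noteq> {}" using iZ by blast
  have Nc: "closed (view Z) N"
    unfolding N_def by (rule closed_Inter[OF _ ne]) (simp add: stable_def)
  have iN: "act i ` M X \<subseteq> N" by (auto simp: N_def)
  have Nmin: "N \<subseteq> N'" if "stable N'" "act i ` M X \<subseteq> N'" for N' using that by (auto simp: N_def)
  have Nst: "act v b \<in> N"
    if w: "w \<in> weqs" "w \<in> hom K A B" and v: "v \<in> hom K B Z" and vw: "\<And>a. a \<in> M A \<Longrightarrow> act v (act w a) \<in> N" and b: "b \<in> M B"
    for A B w v b
    unfolding N_def
  proof
    fix N' assume N': "N' \<in> {N. stable N \<and> act i ` M X \<subseteq> N}"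
    then have "\<forall>a \<in> M A. act v (act w a) \<in> N'" using vw Nmin by blast
    then show "act v b \<in> N'" using N' w v b unfolding stable_def by blast
  qed
  obtain E k where k: "k \<in> hom K E Z" "inj_on (act k) (M E)" "act k ` M E = N" by (rule sub_exists[OF Z Nc])
  obtain l where l: "l \<in> hom K X E" "Comp K k l = i"
    using factor_through_sub[OF k(1,2) i(1)] iN k(3) by blast
  define t where "t = Comp K p k"
  have t: "t \<in> hom K E Y" unfolding t_def by (rule Comp_K(1)[OF k(1) p])
  have kl: "act k (act l x) = act i x" if "x \<in> M X" for x using Comp_K(2)[OF l(1) k(1) that] l(2) by simp
  have "Comp K t l = f" unfolding t_def using K_assoc[OF l(1) k(1) p] l(2) i(2) by simp
  moreover have "t \<in> fibs"
  proof (rule fibsI[OF t])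
    fix A B w u v assume w: "w \<in> weqs" "w \<in> hom K A B" and u: "u \<in> hom K A E" and v: "v \<in> hom K B Y"
      and e: "Comp K t u = Comp K v w"
    have ku: "Comp K k u \<in> hom K A Z" by (rule Comp_K(1)[OF u k(1)])
    have qku: "Comp K q (Comp K k u) \<in> hom K A R" by (rule Comp_K(1)[OF ku q])
    obtain g where g: "g \<in> hom K B R" "Comp K g w = Comp K q (Comp K k u)"
      by (rule weqs_extend[OF w r(1,2) qku])
    \<comment> \<open>The diagonal into the product: \<open>v\<close> in the direction of
      \<open>Y\<close>, and in the direction of \<open>R\<close> the extension \<open>g\<close>,
      available because \<open>R\<close> is a discrete fibration.\<close>
    obtain d where d: "d \<in> hom K B Z" "Comp K p d = v" "Comp K q d = g" using pair[OF v g(1)] by blast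
    have dw: "Comp K d w = Comp K k u"
    proof (rule hom_eqI[OF Comp_K(1)[OF w(2) d(1)] ku])
      fix a assume a: "a \<in> M A"
      show "act (Comp K d w) a = act (Comp K k u) a"
      proof (rule jinj)
        show "act (Comp K d w) a \<in> M Z" "act (Comp K k u) a \<in> M Z"
          using act_in[OF Comp_K(1)[OF w(2) d(1)] a] act_in[OF ku a] by auto
        have "Comp K p (Comp K d w) = Comp K p (Comp K k u)"
          using K_assoc[OF w(2) d(1) p] K_assoc[OF u k(1) p] d(2) e by (simp add: t_def)
        then show "act p (act (Comp K d w) a) = act p (act (Comp K k u) a)"
          using Comp_K(2)[OF Comp_K(1)[OF w(2) d(1)] p a] Comp_K(2)[OF ku p a] by simp
        have "Comp K q (Comp K d w) = Comp K q (Comp K k u)"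
          using K_assoc[OF w(2) d(1) q] d(3) g(2) by simp
        then show "act q (act (Comp K d w) a) = act q (act (Comp K k u) a)"
          using Comp_K(2)[OF Comp_K(1)[OF w(2) d(1)] q a] Comp_K(2)[OF ku q a] by simp
      qed
    qed
    have "act d (act w a) \<in> N" if a: "a \<in> M A" for a
    proof -
      have "act d (act w a) = act k (act u a)"
        using Comp_K(2)[OF w(2) d(1) a] Comp_K(2)[OF u k(1) a] dw by simp
      then show ?thesis unfolding k(3)[symmetric] using act_in[OF u a] by (simp only: imageI)
    qed
    then have "act d ` M B \<subseteq> act k ` M E" using Nst[OF w d(1)] k(3) by blast
    then obtain h where h: "h \<in> hom K B E" "Comp K k h = d" by (rule factor_through_sub[OF k(1,2) d(1)])
    have "Comp K h w = u"
      by (rule mono_of_inj[OF k(1,2) Comp_K(1)[OF w(2) h(1)] u]) (use K_assoc[OF w(2) h(1) k(1)] h(2) dw in simp)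
    moreover have "Comp K t h = v" unfolding t_def using K_assoc[OF h(1) k(1) p] h(2) d(2) by simp
    ultimately show "\<exists>h \<in> hom K B E. Comp K h w = u \<and> Comp K t h = v" using h(1) by blast
  qed
  moreover have "l \<in> weqs"
  proof (rule weqsI[OF l(1)])
    fix Q g assume Q: "Q \<in> Obj K" "dfib C (view Q)" and g: "g \<in> hom K X Q"
    \<comment> \<open>Existence of extensions along \<open>l\<close>: extend along the unit to
      \<open>R\<close> and precompose with the projection of \<open>E\<close> to
      \<open>R\<close>.\<close>
    obtain g' where g': "g' \<in> hom K R Q" "Comp K g' \<eta> = g" by (rule weqs_extend[OF r(4,3) Q g])
    have qk: "Comp K q k \<in> hom K E R" by (rule Comp_K(1)[OF k(1) q])
    have "Comp K (Comp K g' (Comp K q k)) l = g"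
      using K_assoc[OF l(1) qk g'(1)] K_assoc[OF l(1) k(1) q] l(2) i(3) g'(2) by simp
    then show "\<exists>h \<in> hom K E Q. Comp K h l = g" using Comp_K(1)[OF qk g'(1)] by blast
  next
    fix Q \<psi> \<psi>' assume Q: "Q \<in> Obj K" "dfib C (view Q)" and \<psi>: "\<psi> \<in> hom K E Q" and \<psi>': "\<psi>' \<in> hom K E Q"
      and e: "Comp K \<psi> l = Comp K \<psi>' l"
    let ?E = "{x \<in> M E. act \<psi> x = act \<psi>' x}"
    have "stable (act k ` ?E)"
      unfolding stable_def
    proof (intro conjI allI impI)
      show "closed (view Z) (act k ` ?E)" by (rule closed_image_equaliser[OF k(1,2) \<psi> \<psi>'])
      fix A B w v assume w: "w \<in> weqs" "w \<in> hom K A B" and v: "v \<in> hom K B Z" and vw: "\<forall>a \<in> M A. act v (act w a) \<in> act k ` ?E"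
      then have "\<And>a. a \<in> M A \<Longrightarrow> act v (act w a) \<in> N" using k(3) by blast
      then have "act v ` M B \<subseteq> act k ` M E" using Nst[OF w v] k(3) by blast
      then obtain v' where v': "v' \<in> hom K B E" "Comp K k v' = v" by (rule factor_through_sub[OF k(1,2) v])
      have kv: "act k (act v' b) = act v b" if "b \<in> M B" for b using Comp_K(2)[OF v'(1) k(1) that] v'(2) by simp
      have c: "Comp K \<psi> v' \<in> hom K B Q" "Comp K \<psi>' v' \<in> hom K B Q" using Comp_K(1)[OF v'(1)] \<psi> \<psi>' by auto
      \<comment> \<open>Both functors agree after \<open>w\<close> and their target is a discrete
        fibration, so they agree; thus \<open>v\<close> does not leave the equaliser.\<close>
      have "Comp K \<psi> v' = Comp K \<psi>' v'"
      proof (rule weqs_unique[OF w Q c], rule hom_eqI[OF Comp_K(1)[OF w(2) c(1)] Comp_K(1)[OF w(2) c(2)]])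
        fix a assume a: "a \<in> M A"
        have wa: "act w a \<in> M B" by (rule act_in[OF w(2) a])
        obtain x where x: "x \<in> ?E" "act v (act w a) = act k x" using vw a by blast
        have "act k (act v' (act w a)) = act k x" using kv[OF wa] x(2) by simp
        then have "act v' (act w a) = x" using inj_onD[OF k(2)] act_in[OF v'(1) wa] x(1) by blast
        then have "act \<psi> (act v' (act w a)) = act \<psi>' (act v' (act w a))" using x(1) by simp
        then show "act (Comp K (Comp K \<psi> v') w) a = act (Comp K (Comp K \<psi>' v') w) a"
          using Comp_K(2)[OF w(2) c(1) a] Comp_K(2)[OF w(2) c(2) a] Comp_K(2)[OF v'(1) \<psi> wa] Comp_K(2)[OF v'(1) \<psi>' wa] by simp
      qed
      then have "act v' b \<in> ?E" if "b \<in> M B" for b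
        using Comp_K(2)[OF v'(1) \<psi> that] Comp_K(2)[OF v'(1) \<psi>' that] act_in[OF v'(1) that] by simp
      then show "\<forall>b \<in> M B. act v b \<in> act k ` ?E" using kv by force
    qed
    moreover have "act i ` M X \<subseteq> act k ` ?E"
    proof
      fix z assume "z \<in> act i ` M X"
      then obtain x where x: "x \<in> M X" "z = act i x" by blast
      have "act l x \<in> ?E" using Comp_K(2)[OF l(1) \<psi> x(1)] Comp_K(2)[OF l(1) \<psi>' x(1)] e act_in[OF l(1) x(1)] by simp
      then have "act k (act l x) \<in> act k ` ?E" by (rule imageI)
      then show "z \<in> act k ` ?E" using kl[OF x(1)] x(2) by simp
    qed
    ultimately have NE: "N \<subseteq> act k ` ?E" by (rule Nmin)
    show "\<psi> = \<psi>'"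
    proof (rule hom_eqI[OF \<psi> \<psi>'])
      fix x assume x: "x \<in> M E"
      then have "act k x \<in> act k ` ?E" using NE k(3) by blast
      then obtain y where "y \<in> ?E" "act k x = act k y" by blast
      then have "x \<in> ?E" using inj_onD[OF k(2)] x by blast
      then show "act \<psi> x = act \<psi>' x" by simp
    qed
  qed
  ultimately show thesis using that l(1) t by blast
qed

text \<open>Retract argument: a lift of \<open>f\<close> against its right factor \<open>r\<close>
  makes \<open>f\<close> a retract of the weak equivalence \<open>l\<close>, and extensions along
  \<open>l\<close> and their uniqueness pass to \<open>f\<close>.\<close>

lemma llp_fibs: "llp K fibs = weqs"
proof (intro set_eqI iffI)
  fix w assume w: "w \<in> weqs"
  then have "w \<in> Mor K" by (simp add: weqs_def)
  then show "w \<in> llp K fibs" using w by (simp add: llp_def fibs_def rlp_def)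
next
  fix f assume f: "f \<in> llp K fibs"
  define A B where "A = Dom K f" and "B = Cod K f"
  have fh: "f \<in> hom K A B" using f Mor_hom by (simp add: A_def B_def llp_def)
  note AB = homD[OF fh]
  obtain E l r where l: "l \<in> hom K A E" "l \<in> weqs" and r: "r \<in> hom K E B" "r \<in> fibs" and rl: "Comp K r l = f"
    by (rule factorisation[OF fh])
  have "lifts K f r" using f r(2) by (simp add: llp_def)
  then obtain h where h: "h \<in> hom K B E" "Comp K h f = l" "Comp K r h = Ident K B"
    by (rule liftsD[OF _ fh r(1) l(1) Ident_K(1)[OF AB(2)]]) (simp add: rl K_unit[OF fh])
  show "f \<in> weqs"
  proof (rule weqsI[OF fh])
    fix Q g assume Q: "Q \<in> Obj K" "dfib C (view Q)" and g: "g \<in> hom K A Q"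
    obtain g' where g': "g' \<in> hom K E Q" "Comp K g' l = g" by (rule weqs_extend[OF l(2,1) Q g])
    have "Comp K (Comp K g' h) f = g" using K_assoc[OF fh h(1) g'(1)] h(2) g'(2) by simp
    then show "\<exists>h \<in> hom K B Q. Comp K h f = g" using Comp_K(1)[OF h(1) g'(1)] by blast
  next
    fix Q a b assume Q: "Q \<in> Obj K" "dfib C (view Q)" and a: "a \<in> hom K B Q" and b: "b \<in> hom K B Q"
      and e: "Comp K a f = Comp K b f"
    have ab: "Comp K a r = Comp K b r"
      by (rule weqs_unique[OF l(2,1) Q Comp_K(1)[OF r(1) a] Comp_K(1)[OF r(1) b]])
        (use K_assoc[OF l(1) r(1) a] K_assoc[OF l(1) r(1) b] rl e in simp)
    show "a = b"
      using K_assoc[OF h(1) r(1) a] K_assoc[OF h(1) r(1) b] ab h(3) K_unit(1)[OF a] K_unit(1)[OF b] by simp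
  qed
qed

lemma wfs_weqs_fibs: "weak_factorisation_system K weqs fibs"
  unfolding weak_factorisation_system_def
proof (intro conjI ballI)
  show "weqs = llp K fibs" by (simp add: llp_fibs)
  show "fibs = rlp K weqs" by (simp add: fibs_def)
  fix f assume "f \<in> Mor K"
  then have f: "f \<in> hom K (Dom K f) (Cod K f)" by (rule Mor_hom)
  obtain E l r where lr: "l \<in> hom K (Dom K f) E" "r \<in> hom K E (Cod K f)" "l \<in> weqs" "r \<in> fibs" "Comp K r l = f"
    by (rule factorisation[OF f])
  have "Cod K l = Dom K r" using hom_Mor[OF lr(1)] hom_Mor[OF lr(2)] by simp
  then show "\<exists>l\<in>weqs. \<exists>r\<in>fibs. Cod K l = Dom K r \<and> f = Comp K r l" using lr(3-5) by blast
qed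

section \<open>Generating sets\<close>

lemma El_restrict: "closed X N \<Longrightarrow> p \<in> El C (X\<lparr>Ar := N\<rparr>) \<longleftrightarrow> p \<in> El C X \<and> snd p \<in> N"
  by (auto simp: El_def closed_def)

lemma conn_restrict_mono:
  assumes X: "over C X" and N: "closed X N" and c: "conn C (X\<lparr>Ar := N\<rparr>) p q"
  shows "conn C X p q"
  using conn_omor[OF over_restrict[OF X N] omor_restrict_inclusion[OF N] c] by simp

lemma bounded_source:
  assumes "inj_on (act i) (M S)" "act i ` M S = N" "|N| \<le>o |B|"
  shows "|M S| \<le>o |B|"
proof -
  have "|M S| \<le>o |N|" using assms(1,2) card_of_ordLeq[of "M S" N] by blast
  then show ?thesis using assms(3) ordLeq_transitive by blast
qed

text \<open>Transport along the isomorphisms of \<open>P\<close> and \<open>R\<close> with the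
  subcategories \<open>NA\<close> and \<open>ND\<close>. It allows weak equivalences to be cut out
  of \<open>w\<close> by choosing sets of arrows inside \<open>A\<close> and
  \<open>D\<close>.\<close>

lemma weqs_of_restricted_conn:
  assumes w: "w \<in> hom K A D" and a: "a \<in> hom K P A" "inj_on (act a) (M P)" and d: "d \<in> hom K R D" "inj_on (act d) (M R)"
    and t: "t \<in> hom K P R" "Comp K d t = Comp K w a"
    and NA: "NA = act a ` M P" and ND: "ND = act d ` M R"
    and inj: "conn_inj (view A\<lparr>Ar := NA\<rparr>) (view D\<lparr>Ar := ND\<rparr>) (act w)"
    and surj: "conn_surj (view A\<lparr>Ar := NA\<rparr>) (view D\<lparr>Ar := ND\<rparr>) (act w)"
  shows "t \<in> weqs"
proof (rule conn_weqs[OF t(1)])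
  let ?XA = "view A\<lparr>Ar := NA\<rparr>" and ?XD = "view D\<lparr>Ar := ND\<rparr>"
  note oA = over_view[OF homD(2)[OF a(1)]] and oD = over_view[OF homD(2)[OF d(1)]]
  note oP = over_view[OF homD(1)[OF a(1)]] and oR = over_view[OF homD(1)[OF d(1)]]
  have cA: "closed (view A) NA" unfolding NA by (rule closed_image[OF oP act_omor[OF a(1)] a(2)])
  have cD: "closed (view D) ND" unfolding ND by (rule closed_image[OF oR act_omor[OF d(1)] d(2)])
  note oXA = over_restrict[OF oA cA] and oXD = over_restrict[OF oD cD]
  have oa: "omor (view P) ?XA (act a)" by (rule omor_into_restrict[OF act_omor[OF a(1)]]) (simp add: NA)
  have od: "omor (view R) ?XD (act d)" by (rule omor_into_restrict[OF act_omor[OF d(1)]]) (simp add: ND)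
  let ?a = "inv_into (M P) (act a)" and ?d = "inv_into (M R) (act d)"
  have oa': "omor ?XA (view P) ?a" by (rule omor_inverse[OF oP oa]) (use a(2) in \<open>simp add: bij_betw_def NA\<close>)
  have od': "omor ?XD (view R) ?d" by (rule omor_inverse[OF oR od]) (use d(2) in \<open>simp add: bij_betw_def ND\<close>)
  have dt: "act d (act t x) = act w (act a x)" if "x \<in> M P" for x
    using Comp_K(2)[OF t(1) d(1) that] Comp_K(2)[OF a(1) w that] t(2) by simp
  have aa: "?a (act a x) = x" if "x \<in> M P" for x using a(2) that by simp
  have dd: "?d (act d x) = x" if "x \<in> M R" for x using d(2) that by simp
  show "conn_inj (view P) (view R) (act t)"
    unfolding conn_inj_def
  proof (intro ballI impI)
    fix p q assume p: "p \<in> El C (view P)" and q: "q \<in> El C (view P)"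
      and c: "conn C (view R) (fst p, act t (snd p)) (fst q, act t (snd q))"
    note pP = ElD(2)[OF p] and qP = ElD(2)[OF q]
    have "conn C ?XD (fst p, act w (act a (snd p))) (fst q, act w (act a (snd q)))"
      using conn_omor[OF oR od c] dt[OF pP] dt[OF qP] by simp
    then have "conn C ?XA (fst p, act a (snd p)) (fst q, act a (snd q))"
      using inj El_omor[OF oa p] El_omor[OF oa q] unfolding conn_inj_def by (metis fst_conv snd_conv)
    from conn_omor[OF oXA oa' this] show "conn C (view P) p q" using aa pP qP by simp
  qed
  show "conn_surj (view P) (view R) (act t)"
    unfolding conn_surj_def
  proof
    fix q assume q: "q \<in> El C (view R)"
    obtain p where p: "p \<in> El C ?XA" "conn C ?XD (fst q, act d (snd q)) (fst p, act w (snd p))"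
      using surj El_omor[OF od q] unfolding conn_surj_def by (metis fst_conv snd_conv)
    have p': "(fst p, ?a (snd p)) \<in> El C (view P)" by (rule El_omor[OF oa' p(1)])
    then have x: "?a (snd p) \<in> M P" using ElD(2) by fastforce
    have "snd p \<in> act a ` M P" using ElD(2)[OF p(1)] by (simp add: NA)
    then have "act w (snd p) = act d (act t (?a (snd p)))" using dt[OF x] by (simp add: f_inv_into_f)
    then have "?d (act w (snd p)) = act t (?a (snd p))" using dd[OF act_in[OF t(1) x]] by simp
    then have "conn C (view R) q (fst p, act t (?a (snd p)))"
      using conn_omor[OF oXD od' p(2)] dd[OF ElD(2)[OF q]] by simp
    then show "\<exists>p \<in> El C (view P). conn C (view R) q (fst p, act t (snd p))"
      using p' by (intro bexI[of _ "(fst p, ?a (snd p))"]) simp_all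
  qed
qed

lemma conn_support:
  assumes X: "over C X"
  obtains F where "\<And>p q. conn C X p q \<Longrightarrow> finite (F p q)" "\<And>p q. conn C X p q \<Longrightarrow> F p q \<subseteq> Ar X"
    "\<And>p q N. conn C X p q \<Longrightarrow> closed X N \<Longrightarrow> F p q \<subseteq> N \<Longrightarrow> conn C (X\<lparr>Ar := N\<rparr>) p q"
proof -
  let ?F = "\<lambda>p q. SOME F. finite F \<and> F \<subseteq> Ar X \<and> (\<forall>N. closed X N \<longrightarrow> F \<subseteq> N \<longrightarrow> conn C (X\<lparr>Ar := N\<rparr>) p q)"
  have "finite (?F p q) \<and> ?F p q \<subseteq> Ar X \<and> (\<forall>N. closed X N \<longrightarrow> ?F p q \<subseteq> N \<longrightarrow> conn C (X\<lparr>Ar := N\<rparr>) p q)"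
    if "conn C X p q" for p q by (rule someI_ex[OF conn_finite[OF X that]])
  then show thesis using that[of ?F] by blast
qed

text \<open>
  Close up under the zigzags that witness \<open>conn_inj\<close> and \<open>conn_surj\<close> for \<open>w\<close>, as in the downward
  Loewenheim-Skolem theorem.
\<close>

lemma bounded_weq_cover:
  fixes B :: "'u set"
  assumes B: "infinite B" and CB: "|Mor C| \<le>o |B|" and w: "w \<in> weqs" "w \<in> hom K A D"
    and NA: "NA \<subseteq> M A" "|NA| \<le>o |B|" and ND: "ND \<subseteq> M D" "|ND| \<le>o |B|"
  obtains P a R d t where "a \<in> hom K P A" "inj_on (act a) (M P)" "d \<in> hom K R D" "inj_on (act d) (M R)"
    "t \<in> hom K P R" "t \<in> weqs" "Comp K d t = Comp K w a" "NA \<subseteq> act a ` M P" "ND \<subseteq> act d ` M R"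
    "|M P| \<le>o |B|" "|M R| \<le>o |B|"
proof -
  note AD = homD[OF w(2)]
  note oA = over_view[OF AD(1)] and oD = over_view[OF AD(2)] and ow = act_omor[OF w(2)]
  let ?A = "view A" and ?D = "view D" and ?w = "act w"
  have "\<forall>q\<in>El C ?D. \<exists>p. p \<in> El C ?A \<and> conn C ?D q (fst p, ?w (snd p))"
    using weqs_conn(2)[OF w] unfolding conn_surj_def by blast
  then obtain s where s: "\<And>q. q \<in> El C ?D \<Longrightarrow> s q \<in> El C ?A"
    and sc: "\<And>q. q \<in> El C ?D \<Longrightarrow> conn C ?D q (fst (s q), ?w (snd (s q)))" by metis
  obtain FA where FA: "\<And>p q. conn C ?A p q \<Longrightarrow> finite (FA p q)" "\<And>p q. conn C ?A p q \<Longrightarrow> FA p q \<subseteq> M A"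
    "\<And>p q N. conn C ?A p q \<Longrightarrow> closed ?A N \<Longrightarrow> FA p q \<subseteq> N \<Longrightarrow> conn C (?A\<lparr>Ar := N\<rparr>) p q"
    using conn_support[OF oA] by blast
  obtain FD where FD: "\<And>p q. conn C ?D p q \<Longrightarrow> finite (FD p q)" "\<And>p q. conn C ?D p q \<Longrightarrow> FD p q \<subseteq> M D"
    "\<And>p q N. conn C ?D p q \<Longrightarrow> closed ?D N \<Longrightarrow> FD p q \<subseteq> N \<Longrightarrow> conn C (?D\<lparr>Ar := N\<rparr>) p q"
    using conn_support[OF oD] by blast
  define clo where "clo X f g = {dm X f, cd X f} \<union> (if dm X g = cd X f then {cm X g f} else {})"
    for X :: "('u, 'u) overcat" and f g
  have clo: "clo X f g \<subseteq> Ar X \<and> |clo X f g| \<le>o |B|" if "over C X" "f \<in> Ar X" "g \<in> Ar X" for X f g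
    using that overD(1,2)[OF that(1,2)] over_compD(1)[OF that] bounded_finite[OF B, of "clo X f g"]
    by (auto simp: clo_def)
  \<comment> \<open>Supports of zigzags between points over the objects \<open>x\<close> and
    \<open>y\<close>, one for each pair of base arrows; they will witness \<open>conn_inj\<close>.
    Unconnected pairs contribute nothing.\<close>
  define ZA where "ZA x y p = (if conn C ?A (fst p, x) (snd p, y) then FA (fst p, x) (snd p, y) else {})" for x y p
  \<comment> \<open>Supports of the zigzags that lead from the point \<open>(f, x)\<close> of
    \<open>D\<close> to the image of the point \<open>s (f, x)\<close> chosen in \<open>A\<close>;
    they will witness \<open>conn_surj\<close>, together with the objects of \<open>A\<close>
    collected in \<open>GS\<close>.\<close>
  define ZD where "ZD x f = (if (f, x) \<in> El C ?D then FD (f, x) (fst (s (f, x)), ?w (snd (s (f, x)))) else {})" for x f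
  define GA where "GA x y = clo ?A x y \<union> (\<Union>p\<in>Mor C \<times> Mor C. ZA x y p)" for x y
  define GD where "GD x y = clo ?D x y \<union> (\<Union>f\<in>Mor C. ZD x f)" for x y
  define GS where "GS x = (\<lambda>f. snd (s (f, x))) ` {f \<in> Mor C. (f, x) \<in> El C ?D}" for x
  have fin: "|F| \<le>o |B|" if "finite F" for F :: "'u set" by (rule bounded_finite[OF B that])
  have ZA: "ZA x y p \<subseteq> M A \<and> |ZA x y p| \<le>o |B|" for x y p
    using FA(1,2) fin by (auto simp: ZA_def)
  have ZD: "ZD x f \<subseteq> M D \<and> |ZD x f| \<le>o |B|" for x f
    using FD(1,2)[OF sc] fin by (auto simp: ZD_def)
  have GA: "GA x y \<subseteq> M A \<and> |GA x y| \<le>o |B|" if "x \<in> M A" "y \<in> M A" for x y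
  proof
    show "GA x y \<subseteq> M A" using clo[OF oA that] ZA unfolding GA_def by blast
    show "|GA x y| \<le>o |B|" unfolding GA_def
      using clo[OF oA that] ZA by (intro bounded_Un[OF B] bounded_UN[OF B] bounded_Times[OF B] CB) auto
  qed
  have GD: "GD x y \<subseteq> M D \<and> |GD x y| \<le>o |B|" if "x \<in> M D" "y \<in> M D" for x y
  proof
    show "GD x y \<subseteq> M D" using clo[OF oD that] ZD unfolding GD_def by blast
    show "|GD x y| \<le>o |B|" unfolding GD_def
      using clo[OF oD that] ZD by (intro bounded_Un[OF B] bounded_UN[OF B] CB) auto
  qed
  have GS: "GS x \<subseteq> M A \<and> |GS x| \<le>o |B|" for x
  proof
    show "GS x \<subseteq> M A" using ElD(2)[OF s] by (auto simp: GS_def)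
    show "|GS x| \<le>o |B|" unfolding GS_def by (intro bounded_image bounded_subset[OF _ CB]) blast
  qed
  \<comment> \<open>A single closure on the disjoint sum, because the two sides feed each other: an
    arrow of \<open>A\<close> adds its image under \<open>w\<close> to \<open>D\<close>, an object
    of \<open>D\<close> adds the objects of its chosen points to \<open>A\<close>.\<close>
  define G where "G x y = (case x of Inl a \<Rightarrow> (case y of Inl a' \<Rightarrow> Inl ` GA a a' \<union> {Inr (?w a)} | Inr _ \<Rightarrow> {})
    | Inr b \<Rightarrow> (case y of Inl _ \<Rightarrow> {} | Inr b' \<Rightarrow> Inr ` GD b b' \<union> Inl ` GS b))" for x y
  let ?S = "Inl ` M A \<union> Inr ` M D :: ('u + 'u) set"
  have Gb: "G x y \<subseteq> ?S \<and> |G x y| \<le>o |B|" if xy: "x \<in> ?S" "y \<in> ?S" for x y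
  proof (cases x)
    case (Inl a)
    then have a: "a \<in> M A" using xy by auto
    show ?thesis
    proof (cases y)
      case (Inl a')
      then have a': "a' \<in> M A" using xy by auto
      have "G x y = Inl ` GA a a' \<union> {Inr (?w a)}" using \<open>x = Inl a\<close> Inl by (simp add: G_def)
      moreover have "|Inl ` GA a a' \<union> {Inr (?w a)} :: ('u + 'u) set| \<le>o |B|"
        using GA[OF a a'] by (intro bounded_Un[OF B bounded_image bounded_finite[OF B]]) auto
      moreover have "Inl ` GA a a' \<union> {Inr (?w a)} \<subseteq> ?S" using GA[OF a a'] act_in[OF w(2) a] by auto
      ultimately show ?thesis by (simp only:)
    next
      case (Inr b)
      then have "G x y = {}" using \<open>x = Inl a\<close> by (simp add: G_def)
      then show ?thesis using bounded_finite[OF B, of "{} :: ('u + 'u) set"] by simp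
    qed
  next
    case (Inr b)
    then have b: "b \<in> M D" using xy by auto
    show ?thesis
    proof (cases y)
      case (Inl a')
      then have "G x y = {}" using \<open>x = Inr b\<close> by (simp add: G_def)
      then show ?thesis using bounded_finite[OF B, of "{} :: ('u + 'u) set"] by simp
    next
      case (Inr b')
      then have b': "b' \<in> M D" using xy by auto
      have "G x y = Inr ` GD b b' \<union> Inl ` GS b" using \<open>x = Inr b\<close> Inr by (simp add: G_def)
      moreover have "|Inr ` GD b b' \<union> Inl ` GS b :: ('u + 'u) set| \<le>o |B|"
        using GD[OF b b'] GS[of b] by (intro bounded_Un[OF B bounded_image bounded_image]) auto
      moreover have "Inr ` GD b b' \<union> Inl ` GS b \<subseteq> ?S" using GD[OF b b'] GS[of b] by auto
      ultimately show ?thesis by (simp only:)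
    qed
  qed
  have NS: "Inl ` NA \<union> Inr ` ND \<subseteq> ?S" using NA(1) ND(1) by blast
  have Nb: "|Inl ` NA \<union> Inr ` ND :: ('u + 'u) set| \<le>o |B|" by (rule bounded_Un[OF B bounded_image[OF NA(2)] bounded_image[OF ND(2)]])
  have "\<exists>X'. Inl ` NA \<union> Inr ` ND \<subseteq> X' \<and> X' \<subseteq> ?S \<and> |X'| \<le>o |B| \<and> (\<forall>x\<in>X'. \<forall>y\<in>X'. G x y \<subseteq> X')"
  proof (rule bounded_closure[OF B NS Nb, of G])
    show "G x y \<subseteq> ?S \<and> |G x y| \<le>o |B|" if "x \<in> ?S" "y \<in> ?S" for x y by (rule Gb[OF that])
  next
    fix X' assume "Inl ` NA \<union> Inr ` ND \<subseteq> X'" "X' \<subseteq> ?S" "|X'| \<le>o |B|"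
      "\<And>x y. x \<in> X' \<Longrightarrow> y \<in> X' \<Longrightarrow> G x y \<subseteq> X'"
    then show ?thesis by (intro exI[of _ X'] conjI ballI)
  qed
  then obtain X' where X: "Inl ` NA \<union> Inr ` ND \<subseteq> X' \<and> X' \<subseteq> ?S \<and> |X'| \<le>o |B| \<and> (\<forall>x\<in>X'. \<forall>y\<in>X'. G x y \<subseteq> X')"
    by (rule exE)
  note X' = X[THEN conjunct1] X[THEN conjunct2, THEN conjunct1] X[THEN conjunct2, THEN conjunct2, THEN conjunct1]
    X[THEN conjunct2, THEN conjunct2, THEN conjunct2, rule_format]
  define VA where "VA = {a. Inl a \<in> X'}"
  define VD where "VD = {b. Inr b \<in> X'}"
  have VAM: "VA \<subseteq> M A" and VDM: "VD \<subseteq> M D" using X'(2) by (auto simp: VA_def VD_def)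
  have sub: "VA \<subseteq> projl ` X'" "VD \<subseteq> projr ` X'"
    using image_eqI[of _ projl "Inl _" X'] image_eqI[of _ projr "Inr _" X']
    by (simp_all add: VA_def VD_def subset_eq)
  have VAb: "|VA| \<le>o |B|" by (rule bounded_subset[OF sub(1) bounded_image[OF X'(3)]])
  have VDb: "|VD| \<le>o |B|" by (rule bounded_subset[OF sub(2) bounded_image[OF X'(3)]])
  have VA_G: "GA x y \<subseteq> VA" "?w x \<in> VD" if "x \<in> VA" "y \<in> VA" for x y
    using X'(4)[of "Inl x" "Inl y"] that by (auto simp: VA_def VD_def G_def)
  have VD_G: "GD x y \<subseteq> VD" "GS x \<subseteq> VA" if "x \<in> VD" "y \<in> VD" for x y
    using X'(4)[of "Inr x" "Inr y"] that by (auto simp: VA_def VD_def G_def)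
  have cA: "closed ?A VA"
    unfolding closed_def
  proof (intro conjI ballI impI VAM)
    fix f assume f: "f \<in> VA"
    show "dm ?A f \<in> VA" "cd ?A f \<in> VA" using VA_G(1)[OF f f] by (auto simp: GA_def clo_def)
    fix g assume g: "g \<in> VA" "dm ?A g = cd ?A f"
    show "cm ?A g f \<in> VA" using VA_G(1)[OF f g(1)] g(2) by (auto simp: GA_def clo_def)
  qed
  have cD: "closed ?D VD"
    unfolding closed_def
  proof (intro conjI ballI impI VDM)
    fix f assume f: "f \<in> VD"
    show "dm ?D f \<in> VD" "cd ?D f \<in> VD" using VD_G(1)[OF f f] by (auto simp: GD_def clo_def)
    fix g assume g: "g \<in> VD" "dm ?D g = cd ?D f"
    show "cm ?D g f \<in> VD" using VD_G(1)[OF f g(1)] g(2) by (auto simp: GD_def clo_def)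
  qed
  have inj: "conn_inj (?A\<lparr>Ar := VA\<rparr>) (?D\<lparr>Ar := VD\<rparr>) ?w"
    unfolding conn_inj_def
  proof (intro ballI impI)
    fix p q assume "p \<in> El C (?A\<lparr>Ar := VA\<rparr>)" "q \<in> El C (?A\<lparr>Ar := VA\<rparr>)"
      and c: "conn C (?D\<lparr>Ar := VD\<rparr>) (fst p, ?w (snd p)) (fst q, ?w (snd q))"
    then have p: "p \<in> El C ?A" "snd p \<in> VA" and q: "q \<in> El C ?A" "snd q \<in> VA" using El_restrict[OF cA] by auto
    have "conn C ?D (fst p, ?w (snd p)) (fst q, ?w (snd q))" by (rule conn_restrict_mono[OF oD cD c])
    then have pq: "conn C ?A p q" using weqs_conn(1)[OF w] p q unfolding conn_inj_def by blast
    then have "FA p q = ZA (snd p) (snd q) (fst p, fst q)" by (simp add: ZA_def)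
    then have "FA p q \<subseteq> GA (snd p) (snd q)" using ElD(1)[OF p(1)] ElD(1)[OF q(1)] by (auto simp: GA_def)
    then have "FA p q \<subseteq> VA" using VA_G(1)[OF p(2) q(2)] by blast
    then show "conn C (?A\<lparr>Ar := VA\<rparr>) p q" by (rule FA(3)[OF pq cA])
  qed
  have surj: "conn_surj (?A\<lparr>Ar := VA\<rparr>) (?D\<lparr>Ar := VD\<rparr>) ?w"
    unfolding conn_surj_def
  proof
    fix q assume "q \<in> El C (?D\<lparr>Ar := VD\<rparr>)"
    then have q: "q \<in> El C ?D" "snd q \<in> VD" using El_restrict[OF cD] by auto
    have qe: "q = (fst q, snd q)" by simp
    have "snd (s q) \<in> GS (snd q)" using ElD(1)[OF q(1)] q(1) unfolding GS_def by (intro image_eqI[of _ _ "fst q"]) simp_all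
    then have "snd (s q) \<in> VA" using VD_G(2)[OF q(2) q(2)] by blast
    then have sq: "s q \<in> El C (?A\<lparr>Ar := VA\<rparr>)" using El_restrict[OF cA] s[OF q(1)] by simp
    have "FD q (fst (s q), ?w (snd (s q))) = ZD (snd q) (fst q)" using q(1) by (simp add: ZD_def)
    then have "FD q (fst (s q), ?w (snd (s q))) \<subseteq> VD"
      using VD_G(1)[OF q(2) q(2)] ElD(1)[OF q(1)] by (auto simp: GD_def)
    then have "conn C (?D\<lparr>Ar := VD\<rparr>) q (fst (s q), ?w (snd (s q)))" by (rule FD(3)[OF sc[OF q(1)] cD])
    then show "\<exists>p \<in> El C (?A\<lparr>Ar := VA\<rparr>). conn C (?D\<lparr>Ar := VD\<rparr>) q (fst p, ?w (snd p))" using sq by blast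
  qed
  obtain P a where a: "a \<in> hom K P A" "inj_on (act a) (M P)" "act a ` M P = VA" by (rule sub_exists[OF AD(1) cA])
  obtain R d where d: "d \<in> hom K R D" "inj_on (act d) (M R)" "act d ` M R = VD" by (rule sub_exists[OF AD(2) cD])
  note wa = Comp_K[OF a(1) w(2)]
  have "act (Comp K w a) ` M P \<subseteq> act d ` M R"
  proof
    fix y assume "y \<in> act (Comp K w a) ` M P"
    then obtain x where x: "x \<in> M P" "y = ?w (act a x)" using wa(2) by auto
    then have "act a x \<in> VA" using a(3) by blast
    then show "y \<in> act d ` M R" using VA_G(2) d(3) x(2) by blast
  qed
  then obtain t where t: "t \<in> hom K P R" "Comp K d t = Comp K w a" by (rule factor_through_sub[OF d(1,2) wa(1)])
  have "t \<in> weqs" by (rule weqs_of_restricted_conn[OF w(2) a(1,2) d(1,2) t a(3)[symmetric] d(3)[symmetric] inj surj])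
  moreover have "NA \<subseteq> act a ` M P" "ND \<subseteq> act d ` M R" using X'(1) a(3) d(3) by (auto simp: VA_def VD_def)
  moreover have "|M P| \<le>o |B|" "|M R| \<le>o |B|" using bounded_source a(2,3) VAb d(2,3) VDb by blast+
  ultimately show thesis using that a(1,2) d(1,2) t by blast
qed

section \<open>Lifting against bounded maps\<close>

definition maps_carried_by :: "'u set \<Rightarrow> ('u cat_functor \<times> 'u cat_functor \<times> 'u cat_functor) set" where
  "maps_carried_by B = {F \<in> Mor K. Dom K F \<in> carried_by B \<and> Cod K F \<in> carried_by B}"

lemma small_maps_carried_by: "sml B \<Longrightarrow> sml (maps_carried_by B)"
proof (rule small_subset)
  show "maps_carried_by B \<subseteq> (\<Union>(P, Q)\<in>carried_by B \<times> carried_by B. hom K P Q)" using Mor_hom by (force simp: maps_carried_by_def)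
  show "sml (\<Union>(P, Q)\<in>carried_by B \<times> carried_by B. hom K P Q)" if "sml B"
    by (intro small_UN small_Times small_carried_by that) (auto simp: small_hom)
qed

text \<open>Source and target are replaced by isomorphic copies in \<open>carried_by B\<close>.
  Composition with isomorphisms at the ends preserves weak equivalences, and a lift for the copy is
  carried back along the inverses.\<close>

lemma copy_maps_carried_by:
  fixes B :: "'u set"
  assumes F: "F \<in> hom K A D" and A: "|M A| \<le>o |B|" and D: "|M D| \<le>o |B|"
  shows "\<exists>F' \<in> maps_carried_by B. (F \<in> weqs \<longrightarrow> F' \<in> weqs) \<and> (\<forall>p \<in> Mor K. lifts K F' p \<longrightarrow> lifts K F p)"
proof -
  note AD = homD[OF F]
  obtain A' i j where a: "A' \<in> carried_by B" and i: "i \<in> hom K A' A" and j: "j \<in> hom K A A'"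
    and ij: "Comp K j i = Ident K A'" "Comp K i j = Ident K A" by (rule copy_carried_by[OF AD(1) A])
  obtain D' k l where d: "D' \<in> carried_by B" and k: "k \<in> hom K D' D" and l: "l \<in> hom K D D'"
    and kl: "Comp K l k = Ident K D'" "Comp K k l = Ident K D" by (rule copy_carried_by[OF AD(2) D])
  have Fi: "Comp K F i \<in> hom K A' D" by (rule Comp_K(1)[OF i F])
  let ?F = "Comp K l (Comp K F i)"
  have F': "?F \<in> hom K A' D'" by (rule Comp_K(1)[OF Fi l])
  have "?F \<in> maps_carried_by B" using hom_Mor[OF F'] a d by (simp add: maps_carried_by_def)
  moreover have "?F \<in> weqs" if W: "F \<in> weqs"
  proof -
    have "iso_in K i" unfolding iso_in_K using hom_Mor[OF i] j ij by auto
    moreover have "iso_in K l" unfolding iso_in_K using hom_Mor[OF l] k kl by auto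
    ultimately show ?thesis using weqs_comp(1)[OF i F] weqs_comp(1)[OF Fi l] W iso_weqs by blast
  qed
  moreover have "lifts K F p" if p: "p \<in> Mor K" and lp: "lifts K ?F p" for p
  proof (rule liftsI[OF F Mor_hom[OF p]])
    fix u v assume u: "u \<in> hom K A (Dom K p)" and v: "v \<in> hom K D (Cod K p)" and e: "Comp K p u = Comp K v F"
    note ph = Mor_hom[OF p]
    have ui: "Comp K u i \<in> hom K A' (Dom K p)" and vk: "Comp K v k \<in> hom K D' (Cod K p)"
      using Comp_K(1)[OF i u] Comp_K(1)[OF k v] .
    have kF: "Comp K k ?F = Comp K F i" using K_assoc[OF Fi l k] kl(2) K_unit(2)[OF Fi] by simp
    have "Comp K p (Comp K u i) = Comp K (Comp K v k) ?F"
      using K_assoc[OF i u ph] K_assoc[OF F' k v] K_assoc[OF i F v] kF e by simp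
    then obtain h where h: "h \<in> hom K D' (Dom K p)" "Comp K h ?F = Comp K u i" "Comp K p h = Comp K v k"
      by (rule liftsD[OF lp F' ph ui vk])
    have Fj: "Comp K ?F j = Comp K l F"
      using K_assoc[OF j Fi l] K_assoc[OF j i F] ij(2) K_unit(1)[OF F] by simp
    have "Comp K (Comp K h l) F = Comp K h (Comp K ?F j)" using K_assoc[OF F l h(1)] Fj by simp
    also have "\<dots> = Comp K (Comp K u i) j" using K_assoc[OF j F' h(1)] h(2) by simp
    also have "\<dots> = u" using K_assoc[OF j i u] ij(2) K_unit(1)[OF u] by simp
    finally have "Comp K (Comp K h l) F = u" .
    moreover have "Comp K p (Comp K h l) = v"
      using K_assoc[OF l h(1) ph] h(3) K_assoc[OF l k v] kl(2) K_unit(1)[OF v] by simp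
    ultimately show "\<exists>h \<in> hom K D (Dom K p). Comp K h F = u \<and> Comp K p h = v" using Comp_K(1)[OF l h(1)] by blast
  qed
  ultimately show ?thesis by blast
qed

lemma rlp_maps_carried_by_lifts:
  fixes B :: "'u set"
  assumes F: "F \<in> hom K A D" "|M A| \<le>o |B|" "|M D| \<le>o |B|"
  shows "p \<in> rlp K (maps_carried_by B) \<Longrightarrow> lifts K F p"
    "p \<in> rlp K (maps_carried_by B \<inter> weqs) \<Longrightarrow> F \<in> weqs \<Longrightarrow> lifts K F p"
  using copy_maps_carried_by[OF assms] unfolding rlp_def by blast+

text \<open>Injectivity on arrows: if \<open>p\<close> identifies \<open>x\<close> and
  \<open>x'\<close>, restrict \<open>p\<close> to a functor \<open>F\<close> from the subcategory
  generated by them to a bounded subcategory of \<open>Y\<close>; a lift against \<open>F\<close>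
  recovers both arrows from their common image. Surjectivity: lift against the inclusion of the
  empty category into the subcategory generated by an arrow of \<open>Y\<close>.\<close>

lemma rlp_maps_carried_by:
  assumes B: "infinite B"
  shows "rlp K (maps_carried_by B) = {f. iso_in K f}"
proof (intro set_eqI iffI)
  fix p assume "p \<in> {f. iso_in K f}"
  then show "p \<in> rlp K (maps_carried_by B)" using iso_lifts_right[OF Mor_hom] by (simp add: rlp_def maps_carried_by_def iso_in_K)
next
  fix p assume pr: "p \<in> rlp K (maps_carried_by B)"
  define X Y where "X = Dom K p" and "Y = Cod K p"
  have p: "p \<in> hom K X Y" using pr Mor_hom by (simp add: rlp_def X_def Y_def)
  note XY = homD[OF p]
  note oX = over_view[OF XY(1)] and oY = over_view[OF XY(2)]
  have "inj_on (act p) (M X)"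
  proof (rule inj_onI)
    fix x x' assume x: "x \<in> M X" "x' \<in> M X" and e: "act p x = act p x'"
    have xs: "{x, x'} \<subseteq> M X" "|{x, x'}| \<le>o |B|" using x bounded_finite[OF B, of "{x, x'}"] by auto
    note g = generated[OF oX xs(1)] and gb = bounded_generated[OF oX B xs]
    obtain A k where k: "k \<in> hom K A X" "inj_on (act k) (M A)" "act k ` M A = generated (view X) {x, x'}"
      by (rule sub_exists[OF XY(1) g(1)])
    have Ab: "|M A| \<le>o |B|" by (rule bounded_source[OF k(2,3) gb])
    note pk = Comp_K[OF k(1) p]
    have ys: "act (Comp K p k) ` M A \<subseteq> M Y" "|act (Comp K p k) ` M A| \<le>o |B|"
      using act_in[OF pk(1)] bounded_image[OF Ab] by auto
    note g' = generated[OF oY ys(1)] and gb' = bounded_generated[OF oY B ys]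
    obtain D l where l: "l \<in> hom K D Y" "inj_on (act l) (M D)" "act l ` M D = generated (view Y) (act (Comp K p k) ` M A)"
      by (rule sub_exists[OF XY(2) g'(1)])
    have Db: "|M D| \<le>o |B|" by (rule bounded_source[OF l(2,3) gb'])
    have "act (Comp K p k) ` M A \<subseteq> act l ` M D" using g'(2) l(3) by simp
    then obtain F where F: "F \<in> hom K A D" "Comp K l F = Comp K p k" by (rule factor_through_sub[OF l(1,2) pk(1)])
    obtain h where h: "h \<in> hom K D X" "Comp K h F = k" "Comp K p h = l"
      by (rule liftsD[OF rlp_maps_carried_by_lifts(1)[OF F(1) Ab Db pr] F(1) p k(1) l(1) F(2)[symmetric]])
    have "x \<in> act k ` M A" "x' \<in> act k ` M A" using g(2) k(3) by auto
    then obtain y y' where y: "y \<in> M A" "y' \<in> M A" "act k y = x" "act k y' = x'" by blast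
    have lF: "act l (act F z) = act p (act k z)" if "z \<in> M A" for z
      using Comp_K(2)[OF F(1) l(1) that] Comp_K(2)[OF k(1) p that] F(2) by simp
    have "act l (act F y) = act l (act F y')" using lF y e by simp
    then have "act F y = act F y'" using inj_onD[OF l(2)] act_in[OF F(1)] y(1,2) by blast
    then show "x = x'" using Comp_K(2)[OF F(1) h(1) y(1)] Comp_K(2)[OF F(1) h(1) y(2)] h(2) y(3,4) by simp
  qed
  moreover have "act p ` M X = M Y"
  proof
    show "act p ` M X \<subseteq> M Y" using act_in[OF p] by blast
    show "M Y \<subseteq> act p ` M X"
    proof
      fix y assume y: "y \<in> M Y"
      have ys: "{y} \<subseteq> M Y" "|{y}| \<le>o |B|" using y bounded_finite[OF B, of "{y}"] by auto
      note g = generated[OF oY ys(1)] and gb = bounded_generated[OF oY B ys]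
      obtain D l where l: "l \<in> hom K D Y" "inj_on (act l) (M D)" "act l ` M D = generated (view Y) {y}"
        by (rule sub_exists[OF XY(2) g(1)])
      have Db: "|M D| \<le>o |B|" by (rule bounded_source[OF l(2,3) gb])
      have "closed (view Y) {}" by (simp add: closed_def)
      then obtain A k where k: "k \<in> hom K A Y" "inj_on (act k) (M A)" "act k ` M A = {}" by (rule sub_exists[OF XY(2)])
      have A0: "M A = {}" using k(3) by simp
      have Ab: "|M A| \<le>o |B|" unfolding A0 by (rule bounded_finite[OF B]) simp
      have "omor (view A) (view D) id" "omor (view A) (view X) id" using A0 by (simp_all add: omor_def)
      then have F: "mk A D id \<in> hom K A D" and u: "mk A X id \<in> hom K A X"
        using mk_hom homD(1)[OF k(1)] homD(1)[OF l(1)] XY(1) by blast+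
      have "Comp K p (mk A X id) = Comp K l (mk A D id)"
        by (rule hom_eqI[OF Comp_K(1)[OF u p] Comp_K(1)[OF F l(1)]]) (simp add: A0)
      then obtain h where h: "h \<in> hom K D X" "Comp K p h = l"
        by (rule liftsD[OF rlp_maps_carried_by_lifts(1)[OF F Ab Db pr] F p u l(1)])
      have "y \<in> act l ` M D" using g(2) l(3) by simp
      then obtain z where z: "z \<in> M D" "y = act l z" by blast
      then have "y = act p (act h z)" using Comp_K(2)[OF h(1) p z(1)] h(2) by simp
      then show "y \<in> act p ` M X" using act_in[OF h(1) z(1)] by blast
    qed
  qed
  ultimately have "bij_betw (act p) (M X) (M Y)" by (simp add: bij_betw_def)
  then obtain j where "j \<in> hom K Y X" "Comp K j p = Ident K X" "Comp K p j = Ident K Y" by (rule iso_of_bij[OF p])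
  then have "iso_in K p" unfolding iso_in_K using hom_Mor[OF p] by auto
  then show "p \<in> {f. iso_in K f}" by simp
qed

text \<open>
  Let \<open>V\<close> be generated by the graphs of \<open>h\<close> and \<open>h'\<close> inside the product of \<open>X\<close> and \<open>D\<close> over the base.
  Its projection to \<open>D\<close> has two sections that agree after \<open>w\<close> and jointly generate \<open>V\<close>, so it is a
  weak equivalence; a lift of the projection to \<open>X\<close> against it is equal to both \<open>h\<close> and \<open>h'\<close>.
\<close>

lemma rlp_bounded_weqs_unique:
  fixes B :: "'u set"
  assumes B: "infinite B" and p: "p \<in> hom K X Y" "p \<in> rlp K (maps_carried_by B \<inter> weqs)"
    and w: "w \<in> weqs" "w \<in> hom K A D" and D: "|M D| \<le>o |B|"
    and h: "h \<in> hom K D X" and h': "h' \<in> hom K D X"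
    and eq: "Comp K h w = Comp K h' w" "Comp K p h = Comp K p h'"
  shows "h = h'"
proof -
  note XY = homD[OF p(1)] and AD = homD[OF w(2)]
  obtain Z f g where Z: "Z \<in> Obj K" and f: "f \<in> hom K Z X" and g: "g \<in> hom K Z D"
    and pair: "\<And>W a b. a \<in> hom K W X \<Longrightarrow> b \<in> hom K W D \<Longrightarrow> \<exists>h \<in> hom K W Z. Comp K f h = a \<and> Comp K g h = b"
    and jinj: "\<And>x y. x \<in> M Z \<Longrightarrow> y \<in> M Z \<Longrightarrow> act f x = act f y \<Longrightarrow> act g x = act g y \<Longrightarrow> x = y"
    using binary_product[OF XY(1) AD(2)] by metis
  note idD = Ident_K(1)[OF AD(2)]
  obtain s where s: "s \<in> hom K D Z" "Comp K f s = h" "Comp K g s = Ident K D" using pair[OF h idD] by blast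
  obtain s' where s': "s' \<in> hom K D Z" "Comp K f s' = h'" "Comp K g s' = Ident K D" using pair[OF h' idD] by blast
  define G where "G = act s ` M D \<union> act s' ` M D"
  have GZ: "G \<subseteq> M Z" using act_in[OF s(1)] act_in[OF s'(1)] by (auto simp: G_def)
  have Gb: "|G| \<le>o |B|" unfolding G_def by (rule bounded_Un[OF B bounded_image[OF D] bounded_image[OF D]])
  note gen = generated[OF over_view[OF Z] GZ]
  obtain V k where k: "k \<in> hom K V Z" "inj_on (act k) (M V)" "act k ` M V = generated (view Z) G"
    by (rule sub_exists[OF Z gen(1)])
  have Vb: "|M V| \<le>o |B|" by (rule bounded_source[OF k(2,3) bounded_generated[OF over_view[OF Z] B GZ Gb]])
  have "act s ` M D \<subseteq> G" "act s' ` M D \<subseteq> G" by (auto simp: G_def)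
  then have "act s ` M D \<subseteq> act k ` M V" "act s' ` M D \<subseteq> act k ` M V" using gen(2) k(3) by simp_all
  then obtain r r' where r: "r \<in> hom K D V" "Comp K k r = s" and r': "r' \<in> hom K D V" "Comp K k r' = s'"
    using factor_through_sub[OF k(1,2) s(1)] factor_through_sub[OF k(1,2) s'(1)] by metis
  have kr: "act k (act r x) = act s x" "act k (act r' x) = act s' x" if "x \<in> M D" for x
    using Comp_K(2)[OF r(1) k(1) that] Comp_K(2)[OF r'(1) k(1) that] r(2) r'(2) by simp_all
  define \<pi> where "\<pi> = Comp K g k"
  define q where "q = Comp K f k"
  have \<pi>: "\<pi> \<in> hom K V D" and q: "q \<in> hom K V X" unfolding \<pi>_def q_def using Comp_K(1)[OF k(1)] g f by auto
  have \<pi>r: "Comp K \<pi> r = Ident K D" "Comp K \<pi> r' = Ident K D"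
    unfolding \<pi>_def using K_assoc[OF r(1) k(1) g] K_assoc[OF r'(1) k(1) g] r(2) r'(2) s(3) s'(3) by simp_all
  have qr: "Comp K q r = h" "Comp K q r' = h'"
    unfolding q_def using K_assoc[OF r(1) k(1) f] K_assoc[OF r'(1) k(1) f] r(2) r'(2) s(2) s'(2) by simp_all
  have agree: "F = F'"
    if F: "F \<in> hom K V Q" and F': "F' \<in> hom K V Q" and e: "Comp K F r = Comp K F' r" "Comp K F r' = Comp K F' r'" for F F' Q
  proof (rule agree_on_generated[OF k GZ F F'])
    fix x assume x: "x \<in> M V" "act k x \<in> G"
    then obtain y where y: "y \<in> M D" "act k x = act s y \<or> act k x = act s' y" by (auto simp: G_def)
    then have "act k x = act k (act r y) \<or> act k x = act k (act r' y)" using kr by simp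
    then have "x = act r y \<or> x = act r' y"
      using inj_onD[OF k(2)] x(1) act_in[OF r(1) y(1)] act_in[OF r'(1) y(1)] by blast
    then show "act F x = act F' x"
      using Comp_K(2)[OF r(1) F y(1)] Comp_K(2)[OF r(1) F' y(1)] Comp_K(2)[OF r'(1) F y(1)] Comp_K(2)[OF r'(1) F' y(1)] e
      by auto
  qed
  have sw: "Comp K s w = Comp K s' w"
  proof (rule hom_eqI[OF Comp_K(1)[OF w(2) s(1)] Comp_K(1)[OF w(2) s'(1)]])
    fix a assume a: "a \<in> M A"
    note c = Comp_K[OF w(2) s(1)] and c' = Comp_K[OF w(2) s'(1)]
    show "act (Comp K s w) a = act (Comp K s' w) a"
    proof (rule jinj[OF act_in[OF c(1) a] act_in[OF c'(1) a]])
      have "Comp K f (Comp K s w) = Comp K f (Comp K s' w)"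
        using K_assoc[OF w(2) s(1) f] K_assoc[OF w(2) s'(1) f] s(2) s'(2) eq(1) by simp
      then show "act f (act (Comp K s w) a) = act f (act (Comp K s' w) a)"
        using Comp_K(2)[OF c(1) f a] Comp_K(2)[OF c'(1) f a] by simp
      have "Comp K g (Comp K s w) = Comp K g (Comp K s' w)"
        using K_assoc[OF w(2) s(1) g] K_assoc[OF w(2) s'(1) g] s(3) s'(3) by simp
      then show "act g (act (Comp K s w) a) = act g (act (Comp K s' w) a)"
        using Comp_K(2)[OF c(1) g a] Comp_K(2)[OF c'(1) g a] by simp
    qed
  qed
  have rw: "Comp K r w = Comp K r' w"
    by (rule mono_of_inj[OF k(1,2) Comp_K(1)[OF w(2) r(1)] Comp_K(1)[OF w(2) r'(1)]])
      (use K_assoc[OF w(2) r(1) k(1)] K_assoc[OF w(2) r'(1) k(1)] r(2) r'(2) sw in simp)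
  have "\<pi> \<in> weqs"
  proof (rule weqsI[OF \<pi>])
    fix Q F assume Q: "Q \<in> Obj K" "dfib C (view Q)" and F: "F \<in> hom K V Q"
    have Fr: "Comp K F r \<in> hom K D Q" and Fr': "Comp K F r' \<in> hom K D Q" using Comp_K(1) r(1) r'(1) F by blast+
    \<comment> \<open>The sections \<open>r\<close> and \<open>r'\<close> agree after the weak
      equivalence \<open>w\<close>, so functors to a discrete fibration do not tell them
      apart.\<close>
    have e: "Comp K F r = Comp K F r'"
      by (rule weqs_unique[OF w Q Fr Fr']) (use K_assoc[OF w(2) r(1) F] K_assoc[OF w(2) r'(1) F] rw in simp)
    have "Comp K (Comp K F r) \<pi> = F"
    proof (rule agree[OF Comp_K(1)[OF \<pi> Fr] F])
      show "Comp K (Comp K (Comp K F r) \<pi>) r = Comp K F r"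
        using K_assoc[OF r(1) \<pi> Fr] \<pi>r(1) K_unit(1)[OF Fr] by simp
      show "Comp K (Comp K (Comp K F r) \<pi>) r' = Comp K F r'"
        using K_assoc[OF r'(1) \<pi> Fr] \<pi>r(2) K_unit(1)[OF Fr] e by simp
    qed
    then show "\<exists>h \<in> hom K D Q. Comp K h \<pi> = F" using Fr by blast
  next
    fix Q a b assume a: "a \<in> hom K D Q" and b: "b \<in> hom K D Q" and e: "Comp K a \<pi> = Comp K b \<pi>"
    show "a = b"
      using K_assoc[OF r(1) \<pi> a] K_assoc[OF r(1) \<pi> b] e \<pi>r(1) K_unit(1)[OF a] K_unit(1)[OF b] by simp
  qed
  then have l: "lifts K \<pi> p" by (rule rlp_maps_carried_by_lifts(2)[OF \<pi> Vb D p(2)])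
  have ph: "Comp K p h \<in> hom K D Y" by (rule Comp_K(1)[OF h p(1)])
  have "Comp K p q = Comp K (Comp K p h) \<pi>"
  proof (rule agree[OF Comp_K(1)[OF q p(1)] Comp_K(1)[OF \<pi> ph]])
    show "Comp K (Comp K p q) r = Comp K (Comp K (Comp K p h) \<pi>) r"
      using K_assoc[OF r(1) q p(1)] K_assoc[OF r(1) \<pi> ph] qr(1) \<pi>r(1) K_unit(1)[OF ph] by simp
    show "Comp K (Comp K p q) r' = Comp K (Comp K (Comp K p h) \<pi>) r'"
      using K_assoc[OF r'(1) q p(1)] K_assoc[OF r'(1) \<pi> ph] qr(2) \<pi>r(2) K_unit(1)[OF ph] eq(2) by simp
  qed
  then obtain d where d: "d \<in> hom K D X" "Comp K d \<pi> = q" by (rule liftsD[OF l \<pi> p(1) q ph])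
  have "h = Comp K d (Comp K \<pi> r)" using K_assoc[OF r(1) \<pi> d(1)] d(2) qr(1) by simp
  also have "\<dots> = Comp K d (Comp K \<pi> r')" by (simp only: \<pi>r)
  also have "\<dots> = h'" using K_assoc[OF r'(1) \<pi> d(1)] d(2) qr(2) by simp
  finally show ?thesis .
qed

text \<open>The square is restricted to the bounded weak equivalences covering \<open>w\<close>,
  where lifts exist by hypothesis. Any two pieces lie in a third, and uniqueness of lifts there
  makes them compatible.\<close>

lemma rlp_bounded_weqs_lifts:
  fixes B :: "'u set"
  assumes B: "infinite B" and CB: "|Mor C| \<le>o |B|"
    and p: "p \<in> hom K X Y" "p \<in> rlp K (maps_carried_by B \<inter> weqs)" and w: "w \<in> weqs" "w \<in> hom K A D"
  shows "lifts K w p"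
proof (rule liftsI[OF w(2) p(1)])
  note AD = homD[OF w(2)] and XY = homD[OF p(1)]
  note oD = over_view[OF AD(2)]
  fix u v assume u: "u \<in> hom K A X" and v: "v \<in> hom K D Y" and e: "Comp K p u = Comp K v w"
  \<comment> \<open>A piece of the problem with its solution: a bounded weak equivalence
    \<open>t\<close> between subcategories of \<open>A\<close> and \<open>D\<close>, and a lift
    \<open>h\<close> of the square restricted to it.\<close>
  define sol where "sol P a R d t h \<longleftrightarrow> a \<in> hom K P A \<and> inj_on (act a) (M P) \<and> d \<in> hom K R D \<and> inj_on (act d) (M R) \<and>
    t \<in> hom K P R \<and> t \<in> weqs \<and> Comp K d t = Comp K w a \<and> |M P| \<le>o |B| \<and> |M R| \<le>o |B| \<and>
    h \<in> hom K R X \<and> Comp K h t = Comp K u a \<and> Comp K p h = Comp K v d" for P a R d t h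
  have solD: "a \<in> hom K P A" "inj_on (act a) (M P)" "d \<in> hom K R D" "inj_on (act d) (M R)"
    "t \<in> hom K P R" "t \<in> weqs" "Comp K d t = Comp K w a" "|M P| \<le>o |B|" "|M R| \<le>o |B|"
    "h \<in> hom K R X" "Comp K h t = Comp K u a" "Comp K p h = Comp K v d" if "sol P a R d t h" for P a R d t h
    using that by (auto simp: sol_def)
  have cover: "\<exists>P a R d t h. sol P a R d t h \<and> NA \<subseteq> act a ` M P \<and> ND \<subseteq> act d ` M R"
    if N: "NA \<subseteq> M A" "|NA| \<le>o |B|" "ND \<subseteq> M D" "|ND| \<le>o |B|" for NA ND
  proof -
    obtain P a R d t where a: "a \<in> hom K P A" "inj_on (act a) (M P)" and d: "d \<in> hom K R D" "inj_on (act d) (M R)"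
      and t: "t \<in> hom K P R" "t \<in> weqs" "Comp K d t = Comp K w a"
      and N': "NA \<subseteq> act a ` M P" "ND \<subseteq> act d ` M R" and b: "|M P| \<le>o |B|" "|M R| \<le>o |B|"
      by (rule bounded_weq_cover[OF B CB w N])
    have "lifts K t p" by (rule rlp_maps_carried_by_lifts(2)[OF t(1) b p(2) t(2)])
    moreover have "Comp K p (Comp K u a) = Comp K (Comp K v d) t"
      using K_assoc[OF a(1) u p(1)] K_assoc[OF a(1) w(2) v] K_assoc[OF t(1) d(1) v] e t(3) by simp
    ultimately obtain h where "h \<in> hom K R X" "Comp K h t = Comp K u a" "Comp K p h = Comp K v d"
      using liftsD[OF _ t(1) p(1) Comp_K(1)[OF a(1) u] Comp_K(1)[OF d(1) v]] by metis
    then have "sol P a R d t h" unfolding sol_def using a d t b by blast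
    then show ?thesis using N' by blast
  qed
  have factor: "\<exists>c \<in> hom K R R'. Comp K d' c = d \<and> Comp K h' c = h"
    if S: "sol P a R d t h" and S': "sol P' a' R' d' t' h'"
      and sub: "act a ` M P \<subseteq> act a' ` M P'" "act d ` M R \<subseteq> act d' ` M R'" for P a R d t h P' a' R' d' t' h'
  proof -
    note s = solD[OF S] and s' = solD[OF S']
    obtain b where b: "b \<in> hom K P P'" "Comp K a' b = a" by (rule factor_through_sub[OF s'(1,2) s(1) sub(1)])
    obtain c where c: "c \<in> hom K R R'" "Comp K d' c = d" by (rule factor_through_sub[OF s'(3,4) s(3) sub(2)])
    have ct: "Comp K c t = Comp K t' b"
    proof (rule mono_of_inj[OF s'(3,4) Comp_K(1)[OF s(5) c(1)] Comp_K(1)[OF b(1) s'(5)]])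
      show "Comp K d' (Comp K c t) = Comp K d' (Comp K t' b)"
        using K_assoc[OF s(5) c(1) s'(3)] K_assoc[OF b(1) s'(5) s'(3)] K_assoc[OF b(1) s'(1) w(2)] b(2) c(2) s(7) s'(7) by simp
    qed
    \<comment> \<open>The solution on the larger piece restricts to one on the smaller piece, and
      \<open>rlp_bounded_weqs_unique\<close> identifies it with \<open>h\<close>.\<close>
    have "Comp K h' c = h"
    proof (rule rlp_bounded_weqs_unique[OF B p s(6,5,9) Comp_K(1)[OF c(1) s'(10)] s(10)])
      show "Comp K (Comp K h' c) t = Comp K h t"
        using K_assoc[OF s(5) c(1) s'(10)] K_assoc[OF b(1) s'(5) s'(10)] K_assoc[OF b(1) s'(1) u] ct b(2) s(11) s'(11) by simp
      show "Comp K p (Comp K h' c) = Comp K p h"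
        using K_assoc[OF c(1) s'(10) p(1)] K_assoc[OF c(1) s'(3) v] c(2) s(12) s'(12) by simp
    qed
    then show ?thesis using c by blast
  qed
  have compat: "act h s = act h' s'"
    if S: "sol P a R d t h" and S': "sol P' a' R' d' t' h'" and ss: "s \<in> M R" "s' \<in> M R'" "act d s = act d' s'"
    for P a R d t h P' a' R' d' t' h' s s'
  proof -
    note k = solD[OF S] and k' = solD[OF S']
    have b: "act a ` M P \<union> act a' ` M P' \<subseteq> M A" "|act a ` M P \<union> act a' ` M P'| \<le>o |B|"
      "act d ` M R \<union> act d' ` M R' \<subseteq> M D" "|act d ` M R \<union> act d' ` M R'| \<le>o |B|"
      using act_in[OF k(1)] act_in[OF k(3)] act_in[OF k'(1)] act_in[OF k'(3)] bounded_Un[OF B bounded_image[OF k(8)] bounded_image[OF k'(8)]]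
        bounded_Un[OF B bounded_image[OF k(9)] bounded_image[OF k'(9)]] by auto
    obtain P2 a2 R2 d2 t2 h2 where S2: "sol P2 a2 R2 d2 t2 h2"
      and sub: "act a ` M P \<union> act a' ` M P' \<subseteq> act a2 ` M P2" "act d ` M R \<union> act d' ` M R' \<subseteq> act d2 ` M R2"
      using cover[OF b] by (elim exE conjE) (rule that)
    note k2 = solD[OF S2]
    obtain c where c: "c \<in> hom K R R2" "Comp K d2 c = d" "Comp K h2 c = h" using factor[OF S S2] sub by (metis Un_subset_iff)
    obtain c' where c': "c' \<in> hom K R' R2" "Comp K d2 c' = d'" "Comp K h2 c' = h'" using factor[OF S' S2] sub by (metis Un_subset_iff)
    have "act d2 (act c s) = act d2 (act c' s')"
      using Comp_K(2)[OF c(1) k2(3) ss(1)] Comp_K(2)[OF c'(1) k2(3) ss(2)] c(2) c'(2) ss(3) by simp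
    then have "act c s = act c' s'" using inj_onD[OF k2(4)] act_in[OF c(1) ss(1)] act_in[OF c'(1) ss(2)] by blast
    then show ?thesis
      using Comp_K(2)[OF c(1) k2(10) ss(1)] Comp_K(2)[OF c'(1) k2(10) ss(2)] c(3) c'(3) by simp
  qed
  \<comment> \<open>The glued lift takes the value given by any piece that contains
    \<open>m\<close>; \<open>compat\<close> shows that all pieces agree.\<close>
  define H where "H m = (SOME x. \<exists>P a R d t h s. sol P a R d t h \<and> s \<in> M R \<and> act d s = m \<and> x = act h s)" for m
  have H: "H (act d s) = act h s" if S: "sol P a R d t h" and s: "s \<in> M R" for P a R d t h s
  proof -
    have "\<exists>P' a' R' d' t' h' s'. sol P' a' R' d' t' h' \<and> s' \<in> M R' \<and> act d' s' = act d s \<and> H (act d s) = act h' s'"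
      unfolding H_def by (rule someI_ex) (use S s in blast)
    then show ?thesis using compat[OF S _ s] by metis
  qed
  \<comment> \<open>Two arrows at once, so that preservation of composites can be checked inside one
    piece.\<close>
  have cover1: "\<exists>P a R d t h. sol P a R d t h \<and> f \<in> act d ` M R \<and> g \<in> act d ` M R" if "f \<in> M D" "g \<in> M D" for f g
    using cover[of "{}" "{f, g}"] that bounded_finite[OF B, of "{} :: 'u set"] bounded_finite[OF B, of "{f, g}"] by auto
  have Ho: "omor (view D) (view X) H"
    unfolding omor_def
  proof (intro conjI ballI impI)
    fix f assume f: "f \<in> M D"
    obtain P a R d t h where S: "sol P a R d t h" and "f \<in> act d ` M R" using cover1[OF f f] by blast
    then obtain s where s: "s \<in> M R" "f = act d s" by blast
    note k = solD[OF S]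
    note od = omorD[OF act_omor[OF k(3)] s(1)] and oh = omorD[OF act_omor[OF k(10)] s(1)]
    note oR = overD(1,2)[OF over_view[OF homD(1)[OF k(3)]] s(1)]
    show "H f \<in> M X" "H (dm (view D) f) = dm (view X) (H f)" "H (cd (view D) f) = cd (view X) (H f)"
      "pr (view X) (H f) = pr (view D) f"
      using H[OF S s(1)] H[OF S oR(1)] H[OF S oR(2)] od oh s(2) by simp_all
  next
    fix f g assume f: "f \<in> M D" and g: "g \<in> M D" and gf: "dm (view D) g = cd (view D) f"
    obtain P a R d t h where S: "sol P a R d t h" and fg: "f \<in> act d ` M R" "g \<in> act d ` M R" using cover1[OF f g] by blast
    then obtain s s' where s: "s \<in> M R" "f = act d s" and s': "s' \<in> M R" "g = act d s'" by blast
    note k = solD[OF S]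
    note oR = over_view[OF homD(1)[OF k(3)]]
    have "act d (dm (view R) s') = act d (cd (view R) s)"
      using gf s s' omorD(2)[OF act_omor[OF k(3)] s'(1)] omorD(3)[OF act_omor[OF k(3)] s(1)] by simp
    then have c: "dm (view R) s' = cd (view R) s"
      using inj_onD[OF k(4)] overD(1)[OF oR s'(1)] overD(2)[OF oR s(1)] by blast
    have "H (act d (cm (view R) s' s)) = act h (cm (view R) s' s)"
      by (rule H[OF S over_compD(1)[OF oR s(1) s'(1) c]])
    then show "H (cm (view D) g f) = cm (view X) (H g) (H f)"
      using omor_comp[OF act_omor[OF k(3)] s(1) s'(1) c] omor_comp[OF act_omor[OF k(10)] s(1) s'(1) c]
        H[OF S s(1)] H[OF S s'(1)] s(2) s'(2) by simp
  qed
  have HK: "mk D X H \<in> hom K D X" by (rule mk_hom[OF AD(2) XY(1) Ho])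
  have "Comp K (mk D X H) w = u"
  proof (rule hom_eqI[OF Comp_K(1)[OF w(2) HK] u])
    fix x assume x: "x \<in> M A"
    obtain P a R d t h where S: "sol P a R d t h" and "{x} \<subseteq> act a ` M P"
      using cover[of "{x}" "{}"] x bounded_finite[OF B, of "{} :: 'u set"] bounded_finite[OF B, of "{x}"] by auto
    then obtain y where y: "y \<in> M P" "x = act a y" by blast
    note k = solD[OF S]
    have ty: "act t y \<in> M R" by (rule act_in[OF k(5) y(1)])
    have "act w x = act d (act t y)"
      using Comp_K(2)[OF k(1) w(2) y(1)] Comp_K(2)[OF k(5) k(3) y(1)] k(7) y(2) by simp
    then have "H (act w x) = act h (act t y)" using H[OF S ty] by simp
    also have "\<dots> = act u x"
      using Comp_K(2)[OF k(5) k(10) y(1)] Comp_K(2)[OF k(1) u y(1)] k(11) y(2) by simp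
    finally show "act (Comp K (mk D X H) w) x = act u x"
      using Comp_K(2)[OF w(2) HK x] act_in[OF w(2) x] by simp
  qed
  moreover have "Comp K p (mk D X H) = v"
  proof (rule hom_eqI[OF Comp_K(1)[OF HK p(1)] v])
    fix m assume m: "m \<in> M D"
    obtain P a R d t h where S: "sol P a R d t h" and "m \<in> act d ` M R" using cover1[OF m m] by blast
    then obtain s where s: "s \<in> M R" "m = act d s" by blast
    note k = solD[OF S]
    have "act p (H m) = act v m"
      using H[OF S s(1)] s(2) Comp_K(2)[OF k(10) p(1) s(1)] Comp_K(2)[OF k(3) v s(1)] k(12) by simp
    then show "act (Comp K p (mk D X H)) m = act v m" using Comp_K(2)[OF HK p(1) m] m by simp
  qed
  ultimately show "\<exists>h \<in> hom K D X. Comp K h w = u \<and> Comp K p h = v" using HK by blast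
qed

lemma rlp_bounded_weqs:
  fixes B :: "'u set"
  assumes "infinite B" "|Mor C| \<le>o |B|"
  shows "rlp K (maps_carried_by B \<inter> weqs) = fibs"
proof (intro set_eqI iffI)
  fix p assume p: "p \<in> rlp K (maps_carried_by B \<inter> weqs)"
  then have pM: "p \<in> Mor K" by (simp add: rlp_def)
  have "lifts K w p" if w: "w \<in> weqs" for w
  proof -
    have "w \<in> Mor K" using w by (simp add: weqs_def)
    then show ?thesis by (rule rlp_bounded_weqs_lifts[OF assms Mor_hom[OF pM] p w Mor_hom])
  qed
  then show "p \<in> fibs" using pM by (simp add: fibs_def rlp_def)
next
  fix p assume "p \<in> fibs"
  then show "p \<in> rlp K (maps_carried_by B \<inter> weqs)" by (simp add: fibs_def rlp_def)
qed

section \<open>The model structure\<close>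

definition discfib_model where
  "discfib_model = \<lparr>weq = weqs, cof = Mor K, fib = fibs\<rparr>"

lemma combinatorial_discfib_model: "combinatorial_model_category U K discfib_model"
proof -
  have "weqs \<subseteq> Mor K" by (auto simp: weqs_def)
  then have "Mor K \<inter> weqs = weqs" by blast
  then have "model_category U K discfib_model"
    unfolding model_category_def discfib_model_def
    using category_K complete_K cocomplete_K \<open>weqs \<subseteq> Mor K\<close> two_out_of_three_weqs wfs_all_iso wfs_weqs_fibs
    by (simp add: fibs_weqs)
  moreover have "cofibrantly_generated U K discfib_model"
  proof -
    \<comment> \<open>\<open>bounded_weq_cover\<close> adjoins zigzags for all arrows of the base,
      hence the bound on \<open>Mor C\<close>.\<close>
    obtain B :: "'u set" where B: "infinite B" "sml B" "|Mor C| \<le>o |B|"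
      using infinite_bound_exists[OF small_C(1)] by blast
    have "maps_carried_by B \<subseteq> Mor K" by (auto simp: maps_carried_by_def)
    then show ?thesis
      unfolding cofibrantly_generated_def discfib_model_def
      using small_maps_carried_by[OF B(2)] small_subset[OF _ small_maps_carried_by[OF B(2)], of "maps_carried_by B \<inter> weqs"]
        rlp_maps_carried_by[OF B(1)] rlp_bounded_weqs[OF B(1,3)] fibs_weqs
      by (intro exI[of _ "maps_carried_by B"] exI[of _ "maps_carried_by B \<inter> weqs"]) auto
  qed
  ultimately show ?thesis unfolding combinatorial_model_category_def using locally_presentable_K by blast
qed

lemma fibrant_discfib_model: "P \<in> Obj K \<Longrightarrow> fibrant K discfib_model P \<longleftrightarrow> dfib C (view P)"
  using fibrant_iff_dfib by (simp add: fibrant_def discfib_model_def)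

end

theorem theorem2p10:
  fixes C :: "('u, 'u) cat"
  assumes universe: "inaccessible_universe TYPE('u)"
    and C: "small_category C"
  shows "\<exists>M. combinatorial_model_category TYPE('u) (slice Cat C) M \<and>
           cof M = Mor (slice Cat C) \<and>
           (\<forall>P \<in> Obj (slice Cat C). fibrant (slice Cat C) M P \<longleftrightarrow> discrete_fibration P) \<and>
           (\<forall>F \<in> Mor (slice Cat C).
              fibrant (slice Cat C) M (Dom (slice Cat C) F) \<and>
              fibrant (slice Cat C) M (Cod (slice Cat C) F) \<longrightarrow>
                (F \<in> weq M \<longleftrightarrow> iso_in (slice Cat C) F)) \<and>
           (\<forall>F \<in> Mor (slice Cat C).
              fibrant (slice Cat C) M (Dom (slice Cat C) F) \<and>
              fibrant (slice Cat C) M (Cod (slice Cat C) F) \<longrightarrow> F \<in> fib M)"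
proof -
  interpret small_base "TYPE('u)" C by unfold_locales (rule universe, rule C)
  have w: "weq discfib_model = weqs" "fib discfib_model = fibs" "cof discfib_model = Mor K"
    by (simp_all add: discfib_model_def)
  show ?thesis
  proof (intro exI[of _ discfib_model] conjI ballI impI)
    show "combinatorial_model_category TYPE('u) K discfib_model" by (rule combinatorial_discfib_model)
    show "cof discfib_model = Mor K" by (rule w)
    show "fibrant K discfib_model P \<longleftrightarrow> discrete_fibration P" if "P \<in> Obj K" for P
      using fibrant_discfib_model[OF that] dfib_view[OF that] by simp
    fix F assume F: "F \<in> Mor K" and "fibrant K discfib_model (Dom K F) \<and> fibrant K discfib_model (Cod K F)"
    then have d: "dfib C (view (Dom K F))" "dfib C (view (Cod K F))"
      using fibrant_discfib_model[OF Dom_K[OF F]] fibrant_discfib_model[OF Cod_K[OF F]] by auto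
    show "F \<in> weq discfib_model \<longleftrightarrow> iso_in K F" unfolding w by (rule dfib_weq_iff_iso[OF d Mor_hom[OF F]])
    show "F \<in> fib discfib_model" unfolding w by (rule dfib_lifts[OF d Mor_hom[OF F]])
  qed
qed

end
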